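(* Let $\mathbbm{k}$ be an algebraically closed field of characteristic $p>2$, $\zeta\in\mathbbm{k}$ a primitive fourth root of unity, $\zeta^{1/2}$ a square root of $\zeta$. Let $v=2a_1+a_0$ with $1\le a_1\le p-1$, $a_0\in\{0,1\}$, and let $\theta_{v-1}$ be the twist on $\mathbb{T}_\zeta(v-1)$ in the ribbon category $\mathbf{Tilt}/\mathbf J$. 1. If $a_0=0$, then $\theta_{v-1}=\zeta^{(v-1)(v-3)/2}\,E_{v-1}=\zeta^{(4a_1^2-8a_1+3)/2}\,E_{v-1}=(-1)^{a_1}\zeta^{3/2}\,E_{v-1}$. 2. If $a_0=1$, then $\theta_{v-1}=E_{v-1}+2\zeta^{-1}\,L_{v-1}$.
   Context: Convention: $\zeta^{k/2}=(\zeta^{1/2})^k$ for $k\in\mathbb Z$. The Temperley–Lieb category $\mathbf{TL}$ over $\mathbbm{k}$ has objects $n\in\mathbb{Z}_{\ge0}$; morphisms $m\to n$ are $\mathbbm{k}$-linear combinations of planar matchings ($m$ bottom points, $n$ top points), closed loops being replaced by $-(\zeta+\zeta^{-1})=0$. Composition is vertical stacking, $\otimes$ is juxtaposition, $1_n$ is the identity on $n$ strands, $\mathrm{cup}:0\to2$, $\mathrm{cap}:2\to0$. The braiding is determined by: the crossing whose over-strand runs from bottom left to top right is $\beta_{1,1}=\zeta^{1/2}1_2+\zeta^{-1/2}\mathrm{cup}\circ\mathrm{cap}$. The ribbon structure is the canonical one, with twist on the generating object $\theta_1=\zeta^{-1/2}\,1_1$ and $\theta_{X\otimes Y}=(\theta_X\otimes\theta_Y)\circ\beta_{Y,X}\circ\beta_{X,Y}$.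 For $1\le a\le p$, $E_{2a-1}\in\mathrm{End}(2a-1)$ is the Jones–Wenzl idempotent: the unique idempotent with coefficient $1$ on $1_{2a-1}$ annihilated by capping or cupping any two adjacent strands. For $1\le a\le p-1$, $E_{2a}=E_{2a-1}\otimes1_1$. $\mathbf{Tilt}$ is the additive and idempotent completion of $\mathbf{TL}$, $\mathbb{T}_\zeta(j)$ is the image of $E_j$ (so $E_j$ is its identity morphism), and $\mathbf J$ is the thick tensor ideal generated by the image of $E_{2p-1}$; in $\mathbf{Tilt}/\mathbf J$ morphisms factoring through objects of $\mathbf J$ are zero. For even $j=2a$, $1\le a\le p-1$: $L_j=E_j\circ(1_{j-2}\otimes\mathrm{cup}\circ\mathrm{cap})\circ E_j\in\mathrm{End}(\mathbb{T}_\zeta(j))$. *)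

theory Defs
  imports
    "HOL-Computational_Algebra.Computational_Algebra"
    "HOL-Library.Poly_Mapping"
begin

section \<open>Planar matchings\<close>

text \<open>
  A boundary point is a pair (height, position), with height 0 at the bottom and 1 at the top;
  positions are counted from the left, starting at 0. A matching is stored as the symmetric
  relation "is matched with", so that the numbers of bottom and top points can be read off from
  its field.
\<close>

type_synonym point = "nat \<times> nat"
type_synonym diagram = "(point \<times> point) set"

definition boundary :: "nat \<Rightarrow> nat \<Rightarrow> point set" where
  "boundary m n = {0} \<times> {..<m} \<union> {1} \<times> {..<n}"

text \<open>
  The rank of a boundary point when one walks around the rectangle: along the bottom from left to
  right and then back along the top from right to left.
\<close>

definition boundary_rank :: "nat \<Rightarrow> nat \<Rightarrow> point \<Rightarrow> nat" where
  "boundary_rank m n x = (if fst x = 0 then snd x else m + n - 1 - snd x)"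

definition planar_matchings :: "nat \<Rightarrow> nat \<Rightarrow> diagram set" where
  "planar_matchings m n = {D. D \<subseteq> boundary m n \<times> boundary m n \<and> sym D \<and> irrefl D \<and>
     (\<forall>x\<in>boundary m n. \<exists>!y. (x, y) \<in> D) \<and>
     \<not> (\<exists>a b c d. (a, b) \<in> D \<and> (c, d) \<in> D \<and>
          boundary_rank m n a < boundary_rank m n c \<and>
          boundary_rank m n c < boundary_rank m n b \<and>
          boundary_rank m n b < boundary_rank m n d)}"

definition id_diagram :: "nat \<Rightarrow> diagram" where
  "id_diagram n = (\<Union>i<n. {((0, i), (1, i)), ((1, i), (0, i))})"

definition cup_diagram :: diagram where
  "cup_diagram = {((1, 0), (1, 1)), ((1, 1), (1, 0))}"

definition cap_diagram :: diagram where
  "cap_diagram = {((0, 0), (0, 1)), ((0, 1), (0, 0))}"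

text \<open>
  Stacking D2 on top of D1: glue puts D1 between heights 0 and 1 and D2 between heights 1 and 2.
  Two outer points are matched in the result iff a path of the glued graph connects them; the
  connected components which stay at height 1 are the closed loops.
\<close>

definition glue :: "diagram \<Rightarrow> diagram \<Rightarrow> diagram" where
  "glue D2 D1 = D1 \<union> map_prod (apfst Suc) (apfst Suc) ` D2"

definition stack :: "diagram \<Rightarrow> diagram \<Rightarrow> diagram" where
  "stack D2 D1 = {(x, y). x \<noteq> y \<and> (apfst ((*) 2) x, apfst ((*) 2) y) \<in> (glue D2 D1)\<^sup>*}"

definition closed_loops :: "diagram \<Rightarrow> diagram \<Rightarrow> nat" where
  "closed_loops D2 D1 =
     card {C. (\<exists>x\<in>Field (glue D2 D1). C = (glue D2 D1)\<^sup>* `` {x}) \<and> C \<subseteq> {1} \<times> UNIV}"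

text \<open>Juxtaposition, the second diagram being moved to the right of the first one.\<close>

definition shift_right :: "diagram \<Rightarrow> point \<Rightarrow> point" where
  "shift_right D x = (fst x, snd x + card {i. (fst x, i) \<in> Field D})"

definition juxtapose :: "diagram \<Rightarrow> diagram \<Rightarrow> diagram" where
  "juxtapose D1 D2 = D1 \<union> map_prod (shift_right D1) (shift_right D1) ` D2"


section \<open>The Temperley--Lieb category\<close>

text \<open>
  The parameter z plays the role of \<open>\<zeta>\<close>, and s that of \<open>\<zeta>\<^sup>1\<^sup>/\<^sup>2\<close>. As in the usual notation,
  \<open>tl_comp z g f\<close> is g after f, i.e. g stacked on top of f.
\<close>

type_synonym 'k tl_mor = "diagram \<Rightarrow>\<^sub>0 'k"

definition tl_hom :: "nat \<Rightarrow> nat \<Rightarrow> 'k::field tl_mor set" where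
  "tl_hom m n = {f. Poly_Mapping.keys f \<subseteq> planar_matchings m n}"

definition tl_scale :: "'k::field \<Rightarrow> 'k tl_mor \<Rightarrow> 'k tl_mor" where
  "tl_scale c f = Poly_Mapping.map ((*) c) f"

definition tl_comp :: "'k::field \<Rightarrow> 'k tl_mor \<Rightarrow> 'k tl_mor \<Rightarrow> 'k tl_mor" where
  "tl_comp z g f = (\<Sum>D2\<in>Poly_Mapping.keys g. \<Sum>D1\<in>Poly_Mapping.keys f.
     Poly_Mapping.single (stack D2 D1)
       (Poly_Mapping.lookup g D2 * Poly_Mapping.lookup f D1 *
        (- (z + inverse z)) ^ closed_loops D2 D1))"

definition tl_tensor :: "'k::field tl_mor \<Rightarrow> 'k tl_mor \<Rightarrow> 'k tl_mor" where
  "tl_tensor f g = (\<Sum>D1\<in>Poly_Mapping.keys f. \<Sum>D2\<in>Poly_Mapping.keys g.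
     Poly_Mapping.single (juxtapose D1 D2) (Poly_Mapping.lookup f D1 * Poly_Mapping.lookup g D2))"

definition tl_id :: "nat \<Rightarrow> 'k::field tl_mor" where
  "tl_id n = Poly_Mapping.single (id_diagram n) 1"

definition tl_cup :: "'k::field tl_mor" where
  "tl_cup = Poly_Mapping.single cup_diagram 1"

definition tl_cap :: "'k::field tl_mor" where
  "tl_cap = Poly_Mapping.single cap_diagram 1"


subsection \<open>Braiding and twist\<close>

definition tl_crossing :: "'k::field \<Rightarrow> 'k tl_mor" where
  "tl_crossing s = tl_scale s (tl_id 2) + tl_scale (inverse s) (tl_comp (s\<^sup>2) tl_cup tl_cap)"

text \<open>
  The components of the braiding on the objects 1, n and m, n are the values forced by the hexagon
  identities
  \<open>\<beta>\<^bsub>X, Y\<otimes>Z\<^esub> = (1\<^bsub>Y\<^esub> \<otimes> \<beta>\<^bsub>X, Z\<^esub>) \<circ> (\<beta>\<^bsub>X, Y\<^esub> \<otimes> 1\<^bsub>Z\<^esub>)\<close> and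
  \<open>\<beta>\<^bsub>X\<otimes>Y, Z\<^esub> = (\<beta>\<^bsub>X, Z\<^esub> \<otimes> 1\<^bsub>Y\<^esub>) \<circ> (1\<^bsub>X\<^esub> \<otimes> \<beta>\<^bsub>Y, Z\<^esub>)\<close>.
\<close>

primrec tl_braid_one :: "'k::field \<Rightarrow> nat \<Rightarrow> 'k tl_mor" where
  "tl_braid_one s 0 = tl_id 1"
| "tl_braid_one s (Suc n) =
     tl_comp (s\<^sup>2) (tl_tensor (tl_id n) (tl_crossing s)) (tl_tensor (tl_braid_one s n) (tl_id 1))"

primrec tl_braid :: "'k::field \<Rightarrow> nat \<Rightarrow> nat \<Rightarrow> 'k tl_mor" where
  "tl_braid s 0 n = tl_id n"
| "tl_braid s (Suc m) n =
     tl_comp (s\<^sup>2) (tl_tensor (tl_braid_one s n) (tl_id m)) (tl_tensor (tl_id 1) (tl_braid s m n))"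

text \<open>
  Likewise the twist is forced by its value on the object 1 and by
  \<open>\<theta>\<^bsub>X\<otimes>Y\<^esub> = (\<theta>\<^bsub>X\<^esub> \<otimes> \<theta>\<^bsub>Y\<^esub>) \<circ> \<beta>\<^bsub>Y, X\<^esub> \<circ> \<beta>\<^bsub>X, Y\<^esub>\<close>, used here for X = n and Y = 1.
\<close>

primrec tl_twist :: "'k::field \<Rightarrow> nat \<Rightarrow> 'k tl_mor" where
  "tl_twist s 0 = tl_id 0"
| "tl_twist s (Suc n) =
     tl_comp (s\<^sup>2) (tl_tensor (tl_twist s n) (tl_scale (inverse s) (tl_id 1)))
       (tl_comp (s\<^sup>2) (tl_braid s 1 n) (tl_braid s n 1))"


subsection \<open>Jones--Wenzl idempotents\<close>

definition is_jones_wenzl :: "'k::field \<Rightarrow> nat \<Rightarrow> 'k tl_mor \<Rightarrow> bool" where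
  "is_jones_wenzl z n e \<longleftrightarrow> e \<in> tl_hom n n \<and> tl_comp z e e = e \<and>
     Poly_Mapping.lookup e (id_diagram n) = 1 \<and>
     (\<forall>i j. i + 2 + j = n \<longrightarrow>
        tl_comp z (tl_tensor (tl_tensor (tl_id i) tl_cap) (tl_id j)) e = 0 \<and>
        tl_comp z e (tl_tensor (tl_tensor (tl_id i) tl_cup) (tl_id j)) = 0)"

definition jones_wenzl :: "'k::field \<Rightarrow> nat \<Rightarrow> 'k tl_mor" where
  "jones_wenzl z n = (THE e. is_jones_wenzl z n e)"

text \<open>The idempotent \<open>E\<^bsub>j\<^esub>\<close>; it is meaningful for \<open>1 \<le> j \<le> 2p - 1\<close> only.\<close>

definition tilt_idem :: "'k::field \<Rightarrow> nat \<Rightarrow> 'k tl_mor" where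
  "tilt_idem z j =
     (if odd j then jones_wenzl z j else tl_tensor (jones_wenzl z (j - 1)) (tl_id 1))"

text \<open>The endomorphism \<open>L\<^bsub>j\<^esub>\<close>, for even \<open>j\<close> with \<open>2 \<le> j \<le> 2p - 2\<close>.\<close>

definition tilt_loop :: "'k::field \<Rightarrow> nat \<Rightarrow> 'k tl_mor" where
  "tilt_loop z j = tl_comp z (tilt_idem z j)
     (tl_comp z (tl_tensor (tl_id (j - 2)) (tl_comp z tl_cup tl_cap)) (tilt_idem z j))"


section \<open>The additive and idempotent completion\<close>

text \<open>
  Objects of the additive completion are lists of objects of the Temperley--Lieb category, and a
  morphism from ms to ns is a matrix whose (i, j) entry is a morphism from ms ! j to ns ! i; all
  entries outside of the format are zero. Objects of Tilt are pairs consisting of such a list and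
  an idempotent endomorphism of it, which serves as the identity morphism.
\<close>

type_synonym 'k tl_mat = "nat \<Rightarrow> nat \<Rightarrow> 'k tl_mor"
type_synonym 'k tilt_obj = "nat list \<times> 'k tl_mat"

definition mat_hom :: "nat list \<Rightarrow> nat list \<Rightarrow> 'k::field tl_mat set" where
  "mat_hom ms ns = {F. \<forall>i j. if i < length ns \<and> j < length ms
     then F i j \<in> tl_hom (ms ! j) (ns ! i) else F i j = 0}"

text \<open>The argument ns is the object through which the composition takes place.\<close>

definition mat_comp :: "'k::field \<Rightarrow> nat list \<Rightarrow> 'k tl_mat \<Rightarrow> 'k tl_mat \<Rightarrow> 'k tl_mat" where
  "mat_comp z ns G F = (\<lambda>i j. \<Sum>l<length ns. tl_comp z (G i l) (F l j))"

definition tilt_objects :: "'k::field \<Rightarrow> 'k tilt_obj set" where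
  "tilt_objects z = {(ns, e). e \<in> mat_hom ns ns \<and> mat_comp z ns e e = e}"

definition tilt_hom :: "'k::field \<Rightarrow> 'k tilt_obj \<Rightarrow> 'k tilt_obj \<Rightarrow> 'k tl_mat set" where
  "tilt_hom z X Y = {F \<in> mat_hom (fst X) (fst Y).
     mat_comp z (fst Y) (snd Y) F = F \<and> mat_comp z (fst X) F (snd X) = F}"

definition tilt_iso :: "'k::field \<Rightarrow> 'k tilt_obj \<Rightarrow> 'k tilt_obj \<Rightarrow> bool" where
  "tilt_iso z X Y \<longleftrightarrow> (\<exists>F\<in>tilt_hom z X Y. \<exists>G\<in>tilt_hom z Y X.
     mat_comp z (fst Y) G F = snd X \<and> mat_comp z (fst X) F G = snd Y)"

definition tilt_sum :: "'k::field tilt_obj \<Rightarrow> 'k tilt_obj \<Rightarrow> 'k tilt_obj" where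
  "tilt_sum X Y = (let k = length (fst X) in
     (fst X @ fst Y,
      \<lambda>i j. if i < k \<and> j < k then snd X i j
            else if k \<le> i \<and> k \<le> j then snd Y (i - k) (j - k) else 0))"

text \<open>The summand (a, b) of the tensor product has index a * k + b.\<close>

definition tilt_tensor :: "'k::field tilt_obj \<Rightarrow> 'k tilt_obj \<Rightarrow> 'k tilt_obj" where
  "tilt_tensor X Y = (let k = length (fst Y) in
     ([m + n. m \<leftarrow> fst X, n \<leftarrow> fst Y],
      \<lambda>i j. tl_tensor (snd X (i div k) (j div k)) (snd Y (i mod k) (j mod k))))"

definition mat_of_tl :: "'k::field tl_mor \<Rightarrow> 'k tl_mat" where
  "mat_of_tl f = (\<lambda>i j. if i = 0 \<and> j = 0 then f else 0)"

text \<open>The object \<open>\<T>\<^bsub>\<zeta>\<^esub>(j)\<close>, the image of \<open>E\<^bsub>j\<^esub>\<close>.\<close>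

definition tilt_T :: "'k::field \<Rightarrow> nat \<Rightarrow> 'k tilt_obj" where
  "tilt_T z j = ([j], mat_of_tl (tilt_idem z j))"

text \<open>
  The extension of the twist to Tilt: diagonal on direct sums, and restricted to the image of the
  idempotent e on the object (ns, e).
\<close>

definition tilt_twist :: "'k::field \<Rightarrow> 'k tilt_obj \<Rightarrow> 'k tl_mat" where
  "tilt_twist s X = (let ns = fst X; e = snd X in
     mat_comp (s\<^sup>2) ns e
       (mat_comp (s\<^sup>2) ns (\<lambda>i j. if i = j \<and> i < length ns then tl_twist s (ns ! i) else 0) e))"


subsection \<open>Thick tensor ideals and the quotient\<close>

inductive_set thick_ideal :: "'k::field \<Rightarrow> 'k tilt_obj \<Rightarrow> 'k tilt_obj set"
  for z :: 'k and G :: "'k tilt_obj" where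
  generator: "G \<in> thick_ideal z G"
| sum: "X \<in> thick_ideal z G \<Longrightarrow> Y \<in> thick_ideal z G \<Longrightarrow> tilt_sum X Y \<in> thick_ideal z G"
| tensor_right: "X \<in> thick_ideal z G \<Longrightarrow> Y \<in> tilt_objects z \<Longrightarrow>
    tilt_tensor X Y \<in> thick_ideal z G"
| tensor_left: "X \<in> thick_ideal z G \<Longrightarrow> Y \<in> tilt_objects z \<Longrightarrow>
    tilt_tensor Y X \<in> thick_ideal z G"
| summand: "X \<in> thick_ideal z G \<Longrightarrow> Y \<in> tilt_objects z \<Longrightarrow> Z \<in> tilt_objects z \<Longrightarrow>
    tilt_iso z X (tilt_sum Y Z) \<Longrightarrow> Y \<in> thick_ideal z G"

definition J_ideal :: "'k::field \<Rightarrow> nat \<Rightarrow> 'k tilt_obj set" where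
  "J_ideal z p = thick_ideal z (tilt_T z (2 * p - 1))"

text \<open>
  Morphisms from X to Y in the quotient of Tilt by an ideal J of objects are represented by
  cosets: \<open>quot_mor z J X Y F\<close> is the class of F.
\<close>

definition factors_through ::
    "'k::field \<Rightarrow> 'k tilt_obj set \<Rightarrow> 'k tilt_obj \<Rightarrow> 'k tilt_obj \<Rightarrow> 'k tl_mat \<Rightarrow> bool" where
  "factors_through z J X Y F \<longleftrightarrow>
     (\<exists>W\<in>J. \<exists>A\<in>tilt_hom z X W. \<exists>B\<in>tilt_hom z W Y. F = mat_comp z (fst W) B A)"

definition quot_mor ::
    "'k::field \<Rightarrow> 'k tilt_obj set \<Rightarrow> 'k tilt_obj \<Rightarrow> 'k tilt_obj \<Rightarrow> 'k tl_mat \<Rightarrow> 'k tl_mat set" where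
  "quot_mor z J X Y F =
     {G \<in> tilt_hom z X Y. factors_through z J X Y (\<lambda>i j. G i j - F i j)}"

text \<open>
  The class in End(\<open>\<T>\<^bsub>\<zeta>\<^esub>(j)\<close>) modulo J of an endomorphism given as a Temperley--Lieb morphism, and
  the twist of \<open>\<T>\<^bsub>\<zeta>\<^esub>(j)\<close> in the quotient category.
\<close>

definition tiltJ_End :: "'k::field \<Rightarrow> nat \<Rightarrow> nat \<Rightarrow> 'k tl_mor \<Rightarrow> 'k tl_mat set" where
  "tiltJ_End z p j f = quot_mor z (J_ideal z p) (tilt_T z j) (tilt_T z j) (mat_of_tl f)"

definition tiltJ_twist :: "'k::field \<Rightarrow> nat \<Rightarrow> nat \<Rightarrow> 'k tl_mat set" where
  "tiltJ_twist s p j = quot_mor (s\<^sup>2) (J_ideal (s\<^sup>2) p) (tilt_T (s\<^sup>2) j) (tilt_T (s\<^sup>2) j)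
     (tilt_twist s (tilt_T (s\<^sup>2) j))"

end

theory Submission
  imports Defs
begin

text \<open>
  Write \<open>\<sigma>\<^sub>i = \<zeta>\<^sup>1\<^sup>/\<^sup>2 + \<zeta>\<^sup>-\<^sup>1\<^sup>/\<^sup>2 U\<^sub>i\<close> for the crossings, where \<open>U\<^sub>i\<^sup>2 = 0\<close> because the loop value vanishes. The twist is
  a product of crossings, and each of them acts on an idempotent killed by all \<open>U\<^sub>i\<close> as \<open>\<zeta>\<^sup>1\<^sup>/\<^sup>2\<close>; this
  gives the scalar on an odd number of strands. With one strand more, the only further contribution
  is the last strand encircling the n others, \<open>J\<^sub>n\<^sub>+\<^sub>1 = \<sigma>\<^sub>n J\<^sub>n \<sigma>\<^sub>n\<close>. Between two idempotents it expands into
  \<open>\<zeta>\<^sup>n\<close>, the term \<open>2 \<zeta>\<^sup>n\<^sup>-\<^sup>1 U\<^sub>n\<close>, and \<open>\<zeta>\<^sup>-\<^sup>1 U\<^sub>n J\<^sub>n U\<^sub>n\<close>; the latter is a closed circle around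
  n - 1 strands, which contributes the factor \<open>- (\<zeta>\<^sup>n + \<zeta>\<^sup>-\<^sup>n) = 0\<close> for odd n. Both formulas thus hold in
  the Temperley--Lieb category itself, before passing to the quotient by \<open>J\<close>.

  The idempotents on an odd number of strands come from a recursion that adds two strands at a time
  and only divides by positive integers below p.
\<close>


section \<open>Bilinearity\<close>

text \<open>The computation is done in any space with operators \<open>T i\<close> that obey the
  Temperley--Lieb relations, where a product is a composition of maps and so associative at no cost.
  Diagrams are needed to show that the hooks act in this way, that expressions correspond to
  morphisms compatibly with composition and with tensoring by identities, and that
  \<open>jw_expr\<close> meets the definite description behind \<open>jones_wenzl\<close>, which
  asks for uniqueness as well as existence. The vanishing loop value shapes these steps. It reduces
  the counting of closed loops to reachability in a graph. It rules out the usual recursion from n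
  to n + 1 strands, whose denominators include the quantum integers [n] with n even, which are zero
  at \<zeta>. A neighbouring hook at k has to help, through U_i U_k U_i = U_i; it exists on every
  odd number of strands that has a hook at all.\<close>

lemma lookup_tl_scale [simp]: "Poly_Mapping.lookup (tl_scale c f) D = c * Poly_Mapping.lookup f D"
  by (simp add: tl_scale_def map.rep_eq when_def)

lemma keys_tl_scale_subset: "Poly_Mapping.keys (tl_scale c f) \<subseteq> Poly_Mapping.keys f"
  by (auto simp: in_keys_iff)

interpretation tl: vector_space tl_scale
  by standard (auto intro!: poly_mapping_eqI simp: lookup_add algebra_simps)

lemma tl_scale_single: "tl_scale c (Poly_Mapping.single D a) = Poly_Mapping.single D (c * a)"
  by (rule poly_mapping_eqI) (simp add: lookup_single when_def)

definition tl_linear :: "('k::field tl_mor \<Rightarrow> 'k tl_mor) \<Rightarrow> bool" where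
  "tl_linear F \<longleftrightarrow> (\<forall>f g. F (f + g) = F f + F g) \<and> (\<forall>c f. F (tl_scale c f) = tl_scale c (F f))"

lemma tl_linear_add: "tl_linear F \<Longrightarrow> F (f + g) = F f + F g"
  and tl_linear_scale: "tl_linear F \<Longrightarrow> F (tl_scale c f) = tl_scale c (F f)"
  by (simp_all add: tl_linear_def)

lemma tl_linear_zero: "tl_linear F \<Longrightarrow> F 0 = 0"
  using tl_linear_scale[of F 0 0] by simp

lemma tl_linear_sum: "tl_linear F \<Longrightarrow> F (sum g A) = (\<Sum>x\<in>A. F (g x))"
  by (induction A rule: infinite_finite_induct) (simp_all add: tl_linear_zero tl_linear_add)

lemma tl_linear_compose: "tl_linear F \<Longrightarrow> tl_linear G \<Longrightarrow> tl_linear (\<lambda>f. F (G f))"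
  by (simp add: tl_linear_def)

lemma tl_mor_eq_sum:
  "f = (\<Sum>D\<in>Poly_Mapping.keys f. tl_scale (Poly_Mapping.lookup f D) (Poly_Mapping.single D 1))"
  by (rule poly_mapping_eqI)
     (simp add: lookup_sum lookup_single when_def in_keys_iff tl_scale_single)

text \<open>The set \<open>A\<close> carries the side condition, such as planarity or validity,
  under which two maps are compared on single diagrams.\<close>

lemma tl_linear_eqI:
  assumes "tl_linear F" "tl_linear G" "Poly_Mapping.keys f \<subseteq> A"
    and "\<And>D. D \<in> A \<Longrightarrow> F (Poly_Mapping.single D 1) = G (Poly_Mapping.single D 1)"
  shows "F f = G f"
proof -
  have "F f = (\<Sum>D\<in>Poly_Mapping.keys f. tl_scale (Poly_Mapping.lookup f D) (F (Poly_Mapping.single D 1)))"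
    by (subst tl_mor_eq_sum[of f]) (simp only: tl_linear_sum[OF assms(1)] tl_linear_scale[OF assms(1)])
  also have "\<dots> = (\<Sum>D\<in>Poly_Mapping.keys f. tl_scale (Poly_Mapping.lookup f D) (G (Poly_Mapping.single D 1)))"
    using assms(3,4) by (intro sum.cong) auto
  also have "\<dots> = G f"
    by (subst (3) tl_mor_eq_sum[of f]) (simp only: tl_linear_sum[OF assms(2)] tl_linear_scale[OF assms(2)])
  finally show ?thesis .
qed

definition extend_linearly ::
    "(diagram \<Rightarrow> 'k::field tl_mor) \<Rightarrow> 'k tl_mor \<Rightarrow> 'k tl_mor" where
  "extend_linearly b f = (\<Sum>D\<in>Poly_Mapping.keys f. tl_scale (Poly_Mapping.lookup f D) (b D))"

lemma extend_linearly_superset: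
  assumes "finite A" "Poly_Mapping.keys f \<subseteq> A"
  shows "extend_linearly b f = (\<Sum>D\<in>A. tl_scale (Poly_Mapping.lookup f D) (b D))"
  unfolding extend_linearly_def
  by (rule sum.mono_neutral_left) (use assms in \<open>auto simp: in_keys_iff\<close>)

lemma tl_linear_extend_linearly: "tl_linear (extend_linearly b)"
  unfolding tl_linear_def
proof (intro conjI allI)
  fix f g :: "'a tl_mor" and c
  let ?A = "Poly_Mapping.keys f \<union> Poly_Mapping.keys g"
  have "extend_linearly b (f + g) = (\<Sum>D\<in>?A. tl_scale (Poly_Mapping.lookup (f + g) D) (b D))"
    using keys_add[of f g] by (intro extend_linearly_superset) auto
  also have "\<dots> = extend_linearly b f + extend_linearly b g"
    by (simp add: extend_linearly_superset[of ?A] lookup_add tl.scale_left_distrib sum.distrib)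
  finally show "extend_linearly b (f + g) = extend_linearly b f + extend_linearly b g" .
  have "extend_linearly b (tl_scale c f) =
      (\<Sum>D\<in>Poly_Mapping.keys f. tl_scale (Poly_Mapping.lookup (tl_scale c f) D) (b D))"
    using keys_tl_scale_subset by (intro extend_linearly_superset) auto
  also have "\<dots> = tl_scale c (extend_linearly b f)"
    by (simp add: extend_linearly_def tl.scale_sum_right)
  finally show "extend_linearly b (tl_scale c f) = tl_scale c (extend_linearly b f)" .
qed

lemma extend_linearly_single: "extend_linearly b (Poly_Mapping.single D 1) = b D"
  by (simp add: extend_linearly_def)

lemma tl_linear_extend_linearly_coeff:
  assumes "\<And>D. tl_linear (\<lambda>f. b f D)"
  shows "tl_linear (\<lambda>f. extend_linearly (b f) g)"
proof -
  have "tl_scale a (b (tl_scale c f) D) = tl_scale c (tl_scale a (b f D))" for a c f D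
    using tl_linear_scale[OF assms] by (simp add: tl.scale_left_commute)
  then show ?thesis
    using tl_linear_add[OF assms]
    by (simp add: tl_linear_def extend_linearly_def sum.distrib tl.scale_right_distrib
        tl.scale_sum_right)
qed

text \<open>As a nested extension, composition is linear in the outer argument because it is an
  extension, and in the inner one because an extension depends linearly on its values.\<close>

lemma tl_comp_eq_extend_linearly:
  "tl_comp z g f = extend_linearly (\<lambda>D2. extend_linearly
     (\<lambda>D1. Poly_Mapping.single (stack D2 D1) ((- (z + inverse z)) ^ closed_loops D2 D1)) f) g"
  by (simp add: tl_comp_def extend_linearly_def tl.scale_sum_right tl_scale_single mult.assoc)

lemma tl_tensor_eq_extend_linearly:
  "tl_tensor f g = extend_linearly (\<lambda>D1. extend_linearly
     (\<lambda>D2. Poly_Mapping.single (juxtapose D1 D2) 1) g) f"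
  by (simp add: tl_tensor_def extend_linearly_def tl.scale_sum_right tl_scale_single)

lemma tl_linear_comp_left: "tl_linear (\<lambda>g. tl_comp z g f)"
  unfolding tl_comp_eq_extend_linearly by (rule tl_linear_extend_linearly)

lemma tl_linear_comp_right: "tl_linear (tl_comp z g)"
  unfolding tl_comp_eq_extend_linearly
  by (intro tl_linear_extend_linearly_coeff tl_linear_extend_linearly)

lemma tl_linear_tensor_left: "tl_linear (\<lambda>f. tl_tensor f g)"
  unfolding tl_tensor_eq_extend_linearly by (rule tl_linear_extend_linearly)

lemma tl_linear_tensor_right: "tl_linear (tl_tensor f)"
  unfolding tl_tensor_eq_extend_linearly
  by (intro tl_linear_extend_linearly_coeff tl_linear_extend_linearly)

lemma tl_comp_single:
  "tl_comp z (Poly_Mapping.single D2 1) (Poly_Mapping.single D1 1) =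
     Poly_Mapping.single (stack D2 D1) ((- (z + inverse z)) ^ closed_loops D2 D1)"
  by (simp add: tl_comp_eq_extend_linearly extend_linearly_single)

lemma tl_tensor_single:
  "tl_tensor (Poly_Mapping.single D1 1) (Poly_Mapping.single D2 1) =
     Poly_Mapping.single (juxtapose D1 D2) 1"
  by (simp add: tl_tensor_eq_extend_linearly extend_linearly_single)


section \<open>Associativity of stacking\<close>

text \<open>Think of \<open>R1\<close> as the part of a graph that is contracted to
  \<open>S\<close>, meeting the rest \<open>R2\<close> only in \<open>K\<close>. Cut a path at its
  \<open>R2\<close> steps: as these have both ends in \<open>K\<close>, each stretch in between runs
  within \<open>R1\<close> from \<open>K\<close> to \<open>K\<close> and is a single step of
  \<open>S\<close> or trivial.\<close>

lemma rtrancl_contract: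
  assumes R2: "R2 \<subseteq> K \<times> K" and "x \<in> K"
    and "S \<subseteq> R1\<^sup>*" and "\<And>x y. x \<in> K \<Longrightarrow> y \<in> K \<Longrightarrow> (x, y) \<in> R1\<^sup>* \<Longrightarrow> x \<noteq> y \<Longrightarrow> (x, y) \<in> S"
    and "y \<in> K"
  shows "(x, y) \<in> (S \<union> R2)\<^sup>* \<longleftrightarrow> (x, y) \<in> (R1 \<union> R2)\<^sup>*"
proof
  assume "(x, y) \<in> (S \<union> R2)\<^sup>*"
  moreover have "S \<union> R2 \<subseteq> (R1 \<union> R2)\<^sup>*"
    using assms(3) rtrancl_mono[of R1 "R1 \<union> R2"] by auto
  ultimately show "(x, y) \<in> (R1 \<union> R2)\<^sup>*"
    by (metis rtrancl_subset_rtrancl subsetD)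
next
  have step: "(a, b) \<in> (S \<union> R2)\<^sup>*" if "a \<in> K" "b \<in> K" "(a, b) \<in> R1\<^sup>*" for a b
    using that assms(4)[of a b] by (cases "a = b") auto
  \<comment> \<open>The invariant keeps the last visited point \<open>a\<close> of \<open>K\<close>
    at which the path is already contracted, followed by a pending stretch in
    \<open>R1\<close>.\<close>
  have "\<exists>a\<in>K. (x, a) \<in> (S \<union> R2)\<^sup>* \<and> (a, y) \<in> R1\<^sup>*" if "(x, y) \<in> (R1 \<union> R2)\<^sup>*" for y
    using that
  proof (induction rule: rtrancl_induct)
    case base
    then show ?case using \<open>x \<in> K\<close> by auto
  next
    case (step b c)
    then obtain a where a: "a \<in> K" "(x, a) \<in> (S \<union> R2)\<^sup>*" "(a, b) \<in> R1\<^sup>*" by auto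
    from step.hyps(2) show ?case
    proof
      assume "(b, c) \<in> R1"
      then show ?thesis using a by (meson rtrancl.rtrancl_into_rtrancl)
    next
      assume bc: "(b, c) \<in> R2"
      then have "(a, b) \<in> (S \<union> R2)\<^sup>*" using a R2 \<open>\<And>b a. \<lbrakk>a \<in> K; b \<in> K; (a, b) \<in> R1\<^sup>*\<rbrakk> \<Longrightarrow> (a, b) \<in> (S \<union> R2)\<^sup>*\<close> by blast
      then have "(x, c) \<in> (S \<union> R2)\<^sup>*" using a(2) bc
        by (meson UnI2 rtrancl.rtrancl_into_rtrancl rtrancl_trans)
      then show ?thesis using bc R2 by blast
    qed
  qed
  then show "(x, y) \<in> (R1 \<union> R2)\<^sup>* \<Longrightarrow> (x, y) \<in> (S \<union> R2)\<^sup>*"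
    using step \<open>y \<in> K\<close> by (meson rtrancl_trans)
qed

text \<open>Up to its first \<open>R2\<close> step a path stays in \<open>R1\<close>, and that step
  starts in \<open>K\<close>.\<close>

lemma rtrancl_first_exit:
  assumes "R2 \<subseteq> K \<times> K" "(x, y) \<in> (R1 \<union> R2)\<^sup>*" "y \<in> K"
  shows "\<exists>z\<in>K. (x, z) \<in> R1\<^sup>*"
  using assms(2,3)
proof (induction rule: converse_rtrancl_induct)
  case (step a b)
  show ?case
  proof (cases "(a, b) \<in> R1")
    case True
    then show ?thesis using step.IH[OF step.prems] by (blast intro: converse_rtrancl_into_rtrancl)
  next
    case False
    then have "a \<in> K" using step.hyps(1) assms(1) by blast
    then show ?thesis by blast
  qed
qed blast

lemma rtrancl_map_prod:
  assumes "inj f"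
  shows "(f x, f y) \<in> (map_prod f f ` R)\<^sup>* \<longleftrightarrow> (x, y) \<in> R\<^sup>*"
proof
  have "\<exists>y'. z = f y' \<and> (x, y') \<in> R\<^sup>*" if "(f x, z) \<in> (map_prod f f ` R)\<^sup>*" for z
    using that
    by (induction rule: rtrancl_induct)
       (auto dest!: injD[OF assms] intro: rtrancl_into_rtrancl)
  then show "(f x, f y) \<in> (map_prod f f ` R)\<^sup>* \<Longrightarrow> (x, y) \<in> R\<^sup>*"
    using injD[OF assms] by metis
next
  show "(x, y) \<in> R\<^sup>* \<Longrightarrow> (f x, f y) \<in> (map_prod f f ` R)\<^sup>*"
    by (induction rule: rtrancl_induct) (auto intro: rtrancl_into_rtrancl)
qed

lemma ex_rtrancl_map_prod:
  assumes "inj f"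
  shows "(\<exists>y. P y \<and> (f x, y) \<in> (map_prod f f ` R)\<^sup>*) \<longleftrightarrow> (\<exists>y. P (f y) \<and> (x, y) \<in> R\<^sup>*)"
proof -
  have "\<exists>z. y = f z" if "(f x, y) \<in> (map_prod f f ` R)\<^sup>*" for y
    using that by (induction rule: rtrancl_induct) auto
  then show ?thesis using rtrancl_map_prod[OF assms] by metis
qed

text \<open>As the loop value is zero, only the existence of a closed loop matters.\<close>

definition loop_free :: "diagram \<Rightarrow> diagram \<Rightarrow> bool" where
  "loop_free D2 D1 \<longleftrightarrow>
     (\<forall>x\<in>Field (glue D2 D1). fst x = 1 \<longrightarrow> (\<exists>y. fst y \<noteq> 1 \<and> (x, y) \<in> (glue D2 D1)\<^sup>*))"

lemma closed_loops_eq_0_iff: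
  assumes "finite D1" "finite D2"
  shows "closed_loops D2 D1 = 0 \<longleftrightarrow> loop_free D2 D1"
proof -
  let ?G = "glue D2 D1"
  \<comment> \<open>An infinite set has \<open>card\<close> 0 as well, so finiteness is what lets
    the count detect a loop.\<close>
  have fin: "finite {C. (\<exists>x\<in>Field ?G. C = ?G\<^sup>* `` {x}) \<and> C \<subseteq> {1} \<times> UNIV}"
  proof (rule finite_subset)
    show "{C. (\<exists>x\<in>Field ?G. C = ?G\<^sup>* `` {x}) \<and> C \<subseteq> {1} \<times> UNIV} \<subseteq> (\<lambda>x. ?G\<^sup>* `` {x}) ` Field ?G"
      by auto
    show "finite ((\<lambda>x. ?G\<^sup>* `` {x}) ` Field ?G)"
      using assms by (auto simp: glue_def intro!: finite_Field)
  qed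
  have "?G\<^sup>* `` {x} \<subseteq> {1} \<times> UNIV \<longleftrightarrow> fst x = 1 \<and> \<not> (\<exists>y. fst y \<noteq> 1 \<and> (x, y) \<in> ?G\<^sup>*)" for x
    by (cases x) auto
  then have "{C. (\<exists>x\<in>Field ?G. C = ?G\<^sup>* `` {x}) \<and> C \<subseteq> {1} \<times> UNIV} = {} \<longleftrightarrow> loop_free D2 D1"
    unfolding loop_free_def by blast
  then show ?thesis
    unfolding closed_loops_def card_eq_0_iff using fin by blast
qed

text \<open>This is the form in which associativity of stacking uses a diagram: a symmetric graph in
  which no boundary point, hence no gluing point, is isolated.\<close>

definition valid :: "nat \<Rightarrow> nat \<Rightarrow> diagram \<Rightarrow> bool" where
  "valid m n D \<longleftrightarrow> D \<subseteq> boundary m n \<times> boundary m n \<and> sym D \<and> boundary m n \<subseteq> Domain D"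

lemma finite_boundary: "finite (boundary m n)"
  by (simp add: boundary_def)

lemma valid_finite: "valid m n D \<Longrightarrow> finite D"
  unfolding valid_def using finite_boundary by (meson finite_SigmaI finite_subset)

lemma planar_matchings_valid: "D \<in> planar_matchings m n \<Longrightarrow> valid m n D"
  unfolding planar_matchings_def valid_def by blast

abbreviation lift :: "(nat \<Rightarrow> nat) \<Rightarrow> diagram \<Rightarrow> diagram" where
  "lift h D \<equiv> map_prod (apfst h) (apfst h) ` D"

lemma lift_lift: "lift g (lift h D) = lift (g \<circ> h) D"
  unfolding image_image by (rule image_cong) auto

lemma inj_apfst: "inj h \<Longrightarrow> inj (apfst h :: nat \<times> nat \<Rightarrow> nat \<times> nat)"
  by (auto simp: inj_on_def)

lemma mem_rtrancl_Field: "(x, y) \<in> R\<^sup>* \<Longrightarrow> x \<noteq> y \<Longrightarrow> x \<in> Field R \<and> y \<in> Field R"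
  by (metis FieldI1 FieldI2 converse_rtranclE rtranclE)

lemma mem_boundary: "(h, j) \<in> boundary m n \<longleftrightarrow> h = 0 \<and> j < m \<or> h = 1 \<and> j < n"
  by (auto simp: boundary_def)

lemma Domain_map_prod: "Domain (map_prod f g ` R) = f ` Domain R"
  and Range_map_prod: "Range (map_prod f g ` R) = g ` Range R"
  by force+

lemma Field_glue:
  assumes "D1 \<subseteq> boundary m n \<times> boundary m n" "D2 \<subseteq> boundary n l \<times> boundary n l"
  shows "Field (glue D2 D1) \<subseteq> {0} \<times> {..<m} \<union> {1} \<times> {..<n} \<union> {2} \<times> {..<l}"
proof -
  have "Field D1 \<subseteq> boundary m n" "Field D2 \<subseteq> boundary n l"
    using assms by (auto simp: Field_def)
  moreover have "Field (glue D2 D1) = Field D1 \<union> apfst Suc ` Field D2"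
    unfolding glue_def Field_Un by (simp add: Field_def Domain_map_prod Range_map_prod image_Un)
  ultimately have "Field (glue D2 D1) \<subseteq> boundary m n \<union> apfst Suc ` boundary n l"
    by blast
  also have "\<dots> \<subseteq> {0} \<times> {..<m} \<union> {1} \<times> {..<n} \<union> {2} \<times> {..<l}"
    by (auto simp: boundary_def)
  finally show ?thesis .
qed

lemma stack_subset:
  assumes "D1 \<subseteq> boundary m n \<times> boundary m n" "D2 \<subseteq> boundary n l \<times> boundary n l"
  shows "stack D2 D1 \<subseteq> boundary m l \<times> boundary m l"
proof -
  have "x \<in> boundary m l" if "apfst ((*) 2) x \<in> Field (glue D2 D1)" for x
    using subsetD[OF Field_glue[OF assms] that] by (cases x) (auto simp: mem_boundary)
  moreover have "apfst ((*) 2) x \<noteq> apfst ((*) 2) y" if "x \<noteq> y" for x y :: "nat \<times> nat"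
    using that by (cases x; cases y) auto
  ultimately have "x \<in> boundary m l \<and> y \<in> boundary m l" if "(x, y) \<in> stack D2 D1" for x y
    using that mem_rtrancl_Field[of "apfst ((*) 2) x" "apfst ((*) 2) y" "glue D2 D1"]
    by (simp add: stack_def)
  then show ?thesis by auto
qed

text \<open>One valid factor already puts every gluing point into the field of the glued graph. The
  other factor may then be the result of a stacking, of which only the inclusion
  \<open>stack_subset\<close> is at hand.\<close>

lemma loop_free_iff:
  assumes "D1 \<subseteq> boundary m n \<times> boundary m n" "D2 \<subseteq> boundary n l \<times> boundary n l"
    and "valid m n D1 \<or> valid n l D2"
  shows "loop_free D2 D1 \<longleftrightarrow> (\<forall>x\<in>{1} \<times> {..<n}. \<exists>y. fst y \<noteq> 1 \<and> (x, y) \<in> (glue D2 D1)\<^sup>*)"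
proof -
  have "(1, j) \<in> Field (glue D2 D1)" if "j < n" for j
    using assms(3)
  proof
    assume "valid m n D1"
    then have "(1, j) \<in> Domain D1" using that by (auto simp: valid_def mem_boundary)
    then show ?thesis by (auto simp: Field_def glue_def)
  next
    assume "valid n l D2"
    then have "(0, j) \<in> Domain D2" using that by (auto simp: valid_def mem_boundary)
    then show ?thesis by (force simp: Field_def glue_def)
  qed
  moreover have "x \<in> {1} \<times> {..<n}" if "x \<in> Field (glue D2 D1)" "fst x = 1" for x
    using subsetD[OF Field_glue[OF assms(1,2)] that(1)] that(2) by auto
  ultimately show ?thesis
    unfolding loop_free_def by force
qed

definition glue3 :: "diagram \<Rightarrow> diagram \<Rightarrow> diagram \<Rightarrow> diagram" where
  "glue3 D3 D2 D1 = D1 \<union> lift Suc D2 \<union> lift (Suc \<circ> Suc) D3"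

text \<open>Here \<open>M1\<close> holds the points of the level contracted first, \<open>M2\<close>
  those of the second level, \<open>B\<close> the outer points, and \<open>K\<close> whatever lies
  off the first level. A point of \<open>M1\<close> that escapes into \<open>K\<close> lands in
  \<open>B\<close> or in \<open>M2\<close>, where the second stage takes over; conversely a path to
  \<open>B\<close> leaves \<open>M1\<close> by a first exit.\<close>

lemma loops_contract:
  assumes R2: "R2 \<subseteq> K \<times> K"
    and S: "S \<subseteq> R1\<^sup>*" "\<And>x y. x \<in> K \<Longrightarrow> y \<in> K \<Longrightarrow> (x, y) \<in> R1\<^sup>* \<Longrightarrow> x \<noteq> y \<Longrightarrow> (x, y) \<in> S"
    and M: "M2 \<subseteq> K" "B \<subseteq> K" "\<And>x y. x \<in> M1 \<Longrightarrow> y \<in> K \<Longrightarrow> (x, y) \<in> R1\<^sup>* \<Longrightarrow> y \<in> M2 \<union> B"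
  shows "(\<forall>x\<in>M1. \<exists>y\<in>K. (x, y) \<in> R1\<^sup>*) \<and> (\<forall>x\<in>M2. \<exists>y\<in>B. (x, y) \<in> (S \<union> R2)\<^sup>*)
    \<longleftrightarrow> (\<forall>x\<in>M1 \<union> M2. \<exists>y\<in>B. (x, y) \<in> (R1 \<union> R2)\<^sup>*)"
    (is "?L1 \<and> ?L2 \<longleftrightarrow> ?R")
proof -
  have contract: "(x, y) \<in> (S \<union> R2)\<^sup>* \<longleftrightarrow> (x, y) \<in> (R1 \<union> R2)\<^sup>*" if "x \<in> K" "y \<in> K" for x y
    by (rule rtrancl_contract[OF R2 that(1) S that(2)])
  have mono: "R1\<^sup>* \<subseteq> (R1 \<union> R2)\<^sup>*" by (rule rtrancl_mono) auto
  have *: "?L2 \<longleftrightarrow> (\<forall>x\<in>M2. \<exists>y\<in>B. (x, y) \<in> (R1 \<union> R2)\<^sup>*)"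
    using contract M(1,2) by blast
  have "?L1" if ?R
    using that rtrancl_first_exit[OF R2] M(2) by blast
  moreover have "\<exists>y\<in>B. (x, y) \<in> (R1 \<union> R2)\<^sup>*" if asm: ?L1 ?L2 "x \<in> M1" for x
  proof -
    obtain y where y: "y \<in> K" "(x, y) \<in> R1\<^sup>*" using asm(1,3) by blast
    then have "y \<in> M2 \<union> B" using M(3) asm(3) by blast
    then obtain z where "z \<in> B" "(y, z) \<in> (R1 \<union> R2)\<^sup>*" using \<open>?L2\<close> * by blast
    then show ?thesis using y mono by (meson rtrancl_trans subsetD)
  qed
  ultimately show ?thesis unfolding * by blast
qed

context
  fixes D1 D2 D3 k m n l
  assumes D1: "valid k m D1" and D2: "valid m n D2" and D3: "valid n l D3"
begin

lemmas valid_subset = D1[unfolded valid_def, THEN conjunct1] D2[unfolded valid_def, THEN conjunct1]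
  D3[unfolded valid_def, THEN conjunct1]

text \<open>The two iterated stackings are contractions of one graph with levels 0 to 3, namely glue3:
  stacking the bottom pair first removes level 1, stacking the top pair first removes level 2.\<close>

definition bottom_level :: "nat \<Rightarrow> nat" where "bottom_level h = (if h = 0 then 0 else Suc h)"
definition top_level :: "nat \<Rightarrow> nat" where "top_level h = (if h \<le> 1 then h else Suc h)"

lemma inj_levels: "inj bottom_level" "inj top_level"
  by (auto simp: inj_on_def bottom_level_def top_level_def split: if_splits)

lemma lift_bottom_level:
  "lift bottom_level (glue D3 (stack D2 D1)) = lift bottom_level (stack D2 D1) \<union> lift (Suc \<circ> Suc) D3"
proof -
  have "bottom_level \<circ> Suc = Suc \<circ> Suc" by (auto simp: bottom_level_def)
  then show ?thesis by (simp only: glue_def image_Un lift_lift)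
qed

lemma lift_top_level:
  "lift top_level (glue (stack D3 D2) D1) = lift (top_level \<circ> Suc) (stack D3 D2) \<union> D1"
proof -
  have "lift top_level D1 = D1"
  proof -
    have "map_prod (apfst top_level) (apfst top_level) e = e" if "e \<in> D1" for e
      using subsetD[OF valid_subset(1) that] by (cases e) (auto simp: mem_boundary top_level_def)
    then show ?thesis by force
  qed
  then show ?thesis by (simp only: glue_def image_Un lift_lift Un_commute)
qed

text \<open>These are the two hypotheses on \<open>S\<close> in \<open>rtrancl_contract\<close>: up
  to renumbering the levels, stacking records precisely which distinct points off the glued level
  are connected.\<close>

lemma bottom_contract:
  "lift bottom_level (stack D2 D1) \<subseteq> (glue D2 D1)\<^sup>*"
  "fst x \<noteq> 1 \<Longrightarrow> fst y \<noteq> 1 \<Longrightarrow> (x, y) \<in> (glue D2 D1)\<^sup>* \<Longrightarrow> x \<noteq> y \<Longrightarrow>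
     (x, y) \<in> lift bottom_level (stack D2 D1)"
proof -
  have eq: "apfst bottom_level z = apfst ((*) 2) z" if "z \<in> boundary k n" for z
    using that by (cases z) (auto simp: mem_boundary bottom_level_def)
  show "lift bottom_level (stack D2 D1) \<subseteq> (glue D2 D1)\<^sup>*"
  proof clarsimp
    fix a b c d assume *: "((a, b), (c, d)) \<in> stack D2 D1"
    then have "(a, b) \<in> boundary k n" "(c, d) \<in> boundary k n"
      using stack_subset[OF valid_subset(1,2)] by auto
    then show "((bottom_level a, b), (bottom_level c, d)) \<in> (glue D2 D1)\<^sup>*"
      using * eq[of "(a, b)"] eq[of "(c, d)"] by (simp add: stack_def)
  qed
  assume *: "fst x \<noteq> 1" "fst y \<noteq> 1" "(x, y) \<in> (glue D2 D1)\<^sup>*" "x \<noteq> y"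
  have "\<exists>x'\<in>boundary k n. x = apfst ((*) 2) x'" if "fst x \<noteq> 1" "x \<in> Field (glue D2 D1)" for x
    using subsetD[OF Field_glue[OF valid_subset(1,2)] that(2)] that(1)
    by (cases x) (auto simp: boundary_def image_iff intro: bexI[of _ "(0, _)"] bexI[of _ "(1, _)"])
  then obtain x' y' where "x' \<in> boundary k n" "x = apfst ((*) 2) x'" "y' \<in> boundary k n" "y = apfst ((*) 2) y'"
    using * mem_rtrancl_Field[OF *(3,4)] by metis
  moreover from this have "(x', y') \<in> stack D2 D1"
    using * by (auto simp: stack_def)
  ultimately show "(x, y) \<in> lift bottom_level (stack D2 D1)"
    by (intro image_eqI[of _ _ "(x', y')"]) (simp_all add: eq)
qed

lemma top_contract:
  "lift (top_level \<circ> Suc) (stack D3 D2) \<subseteq> (lift Suc (glue D3 D2))\<^sup>*"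
  "fst x \<noteq> 2 \<Longrightarrow> fst y \<noteq> 2 \<Longrightarrow> (x, y) \<in> (lift Suc (glue D3 D2))\<^sup>* \<Longrightarrow> x \<noteq> y \<Longrightarrow>
     (x, y) \<in> lift (top_level \<circ> Suc) (stack D3 D2)"
proof -
  have eq: "apfst (top_level \<circ> Suc) z = apfst Suc (apfst ((*) 2) z)" if "z \<in> boundary m l" for z
    using that by (cases z) (auto simp: mem_boundary top_level_def)
  note map = rtrancl_map_prod[OF inj_apfst[OF inj_Suc]]
  show "lift (top_level \<circ> Suc) (stack D3 D2) \<subseteq> (lift Suc (glue D3 D2))\<^sup>*"
  proof clarsimp
    fix a b c d assume *: "((a, b), (c, d)) \<in> stack D3 D2"
    then have "(apfst Suc (apfst ((*) 2) (a, b)), apfst Suc (apfst ((*) 2) (c, d))) \<in> (lift Suc (glue D3 D2))\<^sup>*"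
      unfolding map by (simp add: stack_def)
    moreover have "(a, b) \<in> boundary m l" "(c, d) \<in> boundary m l"
      using * stack_subset[OF valid_subset(2,3)] by auto
    ultimately show "((top_level (Suc a), b), (top_level (Suc c), d)) \<in> (lift Suc (glue D3 D2))\<^sup>*"
      using eq[of "(a, b)"] eq[of "(c, d)"] by simp
  qed
  assume *: "fst x \<noteq> 2" "fst y \<noteq> 2" "(x, y) \<in> (lift Suc (glue D3 D2))\<^sup>*" "x \<noteq> y"
  have "\<exists>x'\<in>boundary m l. x = apfst Suc (apfst ((*) 2) x')"
    if x: "fst x \<noteq> 2" "x \<in> Field (lift Suc (glue D3 D2))" for x
  proof -
    obtain z where z: "z \<in> Field (glue D3 D2)" "x = apfst Suc z"
      using x(2) by (auto simp: Field_def)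
    show ?thesis
      using subsetD[OF Field_glue[OF valid_subset(2,3)] z(1)] x(1) z(2)
      by (cases z) (auto simp: boundary_def intro: bexI[of _ "(0, _)"] bexI[of _ "(1, _)"])
  qed
  then obtain x' y' where **: "x' \<in> boundary m l" "x = apfst Suc (apfst ((*) 2) x')"
      "y' \<in> boundary m l" "y = apfst Suc (apfst ((*) 2) y')"
    using * mem_rtrancl_Field[OF *(3,4)] by metis
  then have "(x', y') \<in> stack D3 D2"
    using * by (auto simp: stack_def map)
  then show "(x, y) \<in> lift (top_level \<circ> Suc) (stack D3 D2)"
    using ** by (auto simp: eq image_iff intro!: bexI[of _ "(x', y')"])
qed

lemma glue3_eq:
  "glue3 D3 D2 D1 = glue D2 D1 \<union> lift (Suc \<circ> Suc) D3"
  "glue3 D3 D2 D1 = lift Suc (glue D3 D2) \<union> D1"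
  by (simp_all only: glue3_def glue_def image_Un lift_lift Un_ac)

lemma outer_levels:
  "lift (Suc \<circ> Suc) D3 \<subseteq> {x. fst x \<noteq> 1} \<times> {x. fst x \<noteq> 1}"
  "D1 \<subseteq> {x. fst x \<noteq> 2} \<times> {x. fst x \<noteq> 2}"
  using valid_subset(1) by (auto simp: boundary_def)

lemma glue_bottom_rtrancl:
  assumes "fst x \<noteq> 1" "fst y \<noteq> 1"
  shows "(x, y) \<in> (lift bottom_level (glue D3 (stack D2 D1)))\<^sup>* \<longleftrightarrow> (x, y) \<in> (glue3 D3 D2 D1)\<^sup>*"
  unfolding lift_bottom_level glue3_eq(1)
  using assms bottom_contract by (intro rtrancl_contract[OF outer_levels(1)]) auto

lemma glue_top_rtrancl:
  assumes "fst x \<noteq> 2" "fst y \<noteq> 2"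
  shows "(x, y) \<in> (lift top_level (glue (stack D3 D2) D1))\<^sup>* \<longleftrightarrow> (x, y) \<in> (glue3 D3 D2 D1)\<^sup>*"
  unfolding lift_top_level glue3_eq(2)
  using assms top_contract by (intro rtrancl_contract[OF outer_levels(2)]) auto

text \<open>Both sides record reachability in \<open>glue3\<close> between levels 0 and 3. The two
  renumberings agree on the doubled heights 0 and 2, which is all that \<open>stack\<close> looks
  at.\<close>

lemma stack_assoc: "stack D3 (stack D2 D1) = stack (stack D3 D2) D1"
proof -
  have "(apfst ((*) 2) x, apfst ((*) 2) y) \<in> (glue D3 (stack D2 D1))\<^sup>* \<longleftrightarrow>
      (apfst ((*) 2) x, apfst ((*) 2) y) \<in> (glue (stack D3 D2) D1)\<^sup>*" for x y
  proof -
    let ?x = "apfst ((*) 2) x" and ?y = "apfst ((*) 2) y"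
    have eq: "apfst bottom_level (apfst ((*) 2) z) = apfst top_level (apfst ((*) 2) z)" for z :: "nat \<times> nat"
      by (cases z) (auto simp: bottom_level_def top_level_def)
    have outer: "fst (apfst bottom_level (apfst ((*) 2) z)) \<noteq> 1"
        "fst (apfst bottom_level (apfst ((*) 2) z)) \<noteq> 2" for z :: "nat \<times> nat"
      by (cases z; auto simp: bottom_level_def; presburger)+
    show ?thesis
      using glue_bottom_rtrancl[OF outer(1) outer(1), of x y] glue_top_rtrancl[OF outer(2) outer(2), of x y]
        rtrancl_map_prod[OF inj_apfst[OF inj_levels(1)], of ?x ?y "glue D3 (stack D2 D1)"]
        rtrancl_map_prod[OF inj_apfst[OF inj_levels(2)], of ?x ?y "glue (stack D3 D2) D1"]
      by (simp only: eq)
  qed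
  then show ?thesis unfolding stack_def[of D3] stack_def[of _ D1] by blast
qed

lemma inner_points:
  "(\<forall>x\<in>{1} \<times> {..<m}. \<exists>y. fst y \<noteq> 1 \<and> (x, y) \<in> (glue D2 D1)\<^sup>*) \<and>
    (\<forall>x\<in>{2} \<times> {..<n}. \<exists>y. fst y \<notin> {1, 2} \<and> (x, y) \<in> (lift bottom_level (glue D3 (stack D2 D1)))\<^sup>*)
   \<longleftrightarrow> (\<forall>x\<in>{1} \<times> {..<m} \<union> {2} \<times> {..<n}. \<exists>y. fst y \<notin> {1, 2} \<and> (x, y) \<in> (glue3 D3 D2 D1)\<^sup>*)"
  (is "?left")
  "(\<forall>x\<in>{2} \<times> {..<n}. \<exists>y. fst y \<noteq> 2 \<and> (x, y) \<in> (lift Suc (glue D3 D2))\<^sup>*) \<and>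
    (\<forall>x\<in>{1} \<times> {..<m}. \<exists>y. fst y \<notin> {1, 2} \<and> (x, y) \<in> (lift top_level (glue (stack D3 D2) D1))\<^sup>*)
   \<longleftrightarrow> (\<forall>x\<in>{1} \<times> {..<m} \<union> {2} \<times> {..<n}. \<exists>y. fst y \<notin> {1, 2} \<and> (x, y) \<in> (glue3 D3 D2 D1)\<^sup>*)"
  (is "?right")
proof -
  have exit1: "y \<in> {2} \<times> {..<n} \<union> {y. fst y \<notin> {1, 2}}"
    if "x \<in> {1} \<times> {..<m}" "y \<in> {x. fst x \<noteq> 1}" and xy: "(x, y) \<in> (glue D2 D1)\<^sup>*" for x y
  proof -
    have "x \<noteq> y" using that(1,2) by auto
    then have "y \<in> Field (glue D2 D1)" using mem_rtrancl_Field[OF xy] by blast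
    from subsetD[OF Field_glue[OF valid_subset(1,2)] this] show ?thesis using that(2) by auto
  qed
  have "(\<forall>x\<in>{1} \<times> {..<m}. \<exists>y\<in>{x. fst x \<noteq> 1}. (x, y) \<in> (glue D2 D1)\<^sup>*) \<and>
    (\<forall>x\<in>{2} \<times> {..<n}. \<exists>y\<in>{y. fst y \<notin> {1, 2}}.
      (x, y) \<in> (lift bottom_level (stack D2 D1) \<union> lift (Suc \<circ> Suc) D3)\<^sup>*)
   \<longleftrightarrow> (\<forall>x\<in>{1} \<times> {..<m} \<union> {2} \<times> {..<n}. \<exists>y\<in>{y. fst y \<notin> {1, 2}}.
      (x, y) \<in> (glue D2 D1 \<union> lift (Suc \<circ> Suc) D3)\<^sup>*)"
    by (rule loops_contract[OF outer_levels(1) bottom_contract(1) _ _ _ exit1])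
       (use bottom_contract(2) in auto)
  then show ?left
    unfolding lift_bottom_level glue3_eq(1) by (simp only: bex_simps mem_Collect_eq Bex_def)
  have exit2: "y \<in> {1} \<times> {..<m} \<union> {y. fst y \<notin> {1, 2}}"
    if "x \<in> {2} \<times> {..<n}" "y \<in> {x. fst x \<noteq> 2}" and xy: "(x, y) \<in> (lift Suc (glue D3 D2))\<^sup>*" for x y
  proof -
    have "x \<noteq> y" using that(1,2) by auto
    then have "y \<in> Field (lift Suc (glue D3 D2))" using mem_rtrancl_Field[OF xy] by blast
    then obtain z where z: "z \<in> Field (glue D3 D2)" "y = apfst Suc z"
      by (auto simp: Field_def)
    show ?thesis using subsetD[OF Field_glue[OF valid_subset(2,3)] z(1)] \<open>y \<in> {x. fst x \<noteq> 2}\<close> z(2) by auto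
  qed
  have "(\<forall>x\<in>{2} \<times> {..<n}. \<exists>y\<in>{x. fst x \<noteq> 2}. (x, y) \<in> (lift Suc (glue D3 D2))\<^sup>*) \<and>
    (\<forall>x\<in>{1} \<times> {..<m}. \<exists>y\<in>{y. fst y \<notin> {1, 2}}.
      (x, y) \<in> (lift (top_level \<circ> Suc) (stack D3 D2) \<union> D1)\<^sup>*)
   \<longleftrightarrow> (\<forall>x\<in>{2} \<times> {..<n} \<union> {1} \<times> {..<m}. \<exists>y\<in>{y. fst y \<notin> {1, 2}}.
      (x, y) \<in> (lift Suc (glue D3 D2) \<union> D1)\<^sup>*)"
    by (rule loops_contract[OF outer_levels(2) top_contract(1) _ _ _ exit2])
       (use top_contract(2) in auto)
  then show ?right
    unfolding lift_top_level glue3_eq(2) Un_commute[of "{2} \<times> {..<n}" "{1} \<times> {..<m}"]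
    by (simp only: mem_Collect_eq Bex_def)
qed

text \<open>By \<open>inner_points\<close> either side says that in \<open>glue3\<close> every point
  of the levels 1 and 2 reaches an outer level; the rest of the proof only undoes the renumbering of
  levels.\<close>

lemma loop_free_assoc:
  "loop_free D2 D1 \<and> loop_free D3 (stack D2 D1) \<longleftrightarrow> loop_free D3 D2 \<and> loop_free (stack D3 D2) D1"
proof -
  have reach: "(\<exists>y. fst y \<notin> {1, 2} \<and> ((2, j), y) \<in> (lift bottom_level G)\<^sup>*) \<longleftrightarrow>
      (\<exists>y. fst y \<noteq> 1 \<and> ((1, j), y) \<in> G\<^sup>*)"
    "(\<exists>y. fst y \<notin> {1, 2} \<and> ((1, j), y) \<in> (lift top_level G)\<^sup>*) \<longleftrightarrow>
      (\<exists>y. fst y \<noteq> 1 \<and> ((1, j), y) \<in> G\<^sup>*)"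
    "(\<exists>y. fst y \<noteq> 2 \<and> ((2, j), y) \<in> (lift Suc G)\<^sup>*) \<longleftrightarrow>
      (\<exists>y. fst y \<noteq> 1 \<and> ((1, j), y) \<in> G\<^sup>*)" for j G
  proof -
    have "fst (apfst bottom_level y) \<notin> {1, 2} \<longleftrightarrow> fst y \<noteq> 1"
        "fst (apfst top_level y) \<notin> {1, 2} \<longleftrightarrow> fst y \<noteq> 1"
        "fst (apfst Suc y) \<noteq> 2 \<longleftrightarrow> fst y \<noteq> 1" for y :: "nat \<times> nat"
      by (cases y; auto simp: bottom_level_def top_level_def)+
    moreover have "apfst bottom_level (1, j) = (2, j)" "apfst top_level (1, j) = (1, j)"
        "apfst Suc (1, j) = (2, j)"
      by (simp_all add: bottom_level_def top_level_def)
    ultimately show "(\<exists>y. fst y \<notin> {1, 2} \<and> ((2, j), y) \<in> (lift bottom_level G)\<^sup>*) \<longleftrightarrow>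
      (\<exists>y. fst y \<noteq> 1 \<and> ((1, j), y) \<in> G\<^sup>*)"
    "(\<exists>y. fst y \<notin> {1, 2} \<and> ((1, j), y) \<in> (lift top_level G)\<^sup>*) \<longleftrightarrow>
      (\<exists>y. fst y \<noteq> 1 \<and> ((1, j), y) \<in> G\<^sup>*)"
    "(\<exists>y. fst y \<noteq> 2 \<and> ((2, j), y) \<in> (lift Suc G)\<^sup>*) \<longleftrightarrow>
      (\<exists>y. fst y \<noteq> 1 \<and> ((1, j), y) \<in> G\<^sup>*)"
      using ex_rtrancl_map_prod[OF inj_apfst[OF inj_levels(1)], of "\<lambda>y. fst y \<notin> {1, 2}" "(1, j)" G]
        ex_rtrancl_map_prod[OF inj_apfst[OF inj_levels(2)], of "\<lambda>y. fst y \<notin> {1, 2}" "(1, j)" G]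
        ex_rtrancl_map_prod[OF inj_apfst[OF inj_Suc], of "\<lambda>y. fst y \<noteq> 2" "(1, j)" G]
      by (simp_all only:)
  qed
  have *: "(\<forall>x\<in>{h :: nat} \<times> {..<i}. P x) \<longleftrightarrow> (\<forall>j<i. P (h, j))" for P h and i :: nat
    by auto
  show ?thesis
    using inner_points D1 D3
    by (simp only: reach * simp_thms loop_free_iff[OF valid_subset(1,2)] loop_free_iff[OF valid_subset(2,3)]
        loop_free_iff[OF stack_subset[OF valid_subset(1,2)] valid_subset(3)]
        loop_free_iff[OF valid_subset(1) stack_subset[OF valid_subset(2,3)]] D2)
qed

end

section \<open>Associativity of composition\<close>

definition tl_valid :: "nat \<Rightarrow> nat \<Rightarrow> 'k::field tl_mor \<Rightarrow> bool" where
  "tl_valid m n f \<longleftrightarrow> Poly_Mapping.keys f \<subseteq> {D. valid m n D}"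

lemma tl_hom_valid: "f \<in> tl_hom m n \<Longrightarrow> tl_valid m n f"
  using planar_matchings_valid by (auto simp: tl_hom_def tl_valid_def)

lemma tl_valid_single: "valid m n D \<Longrightarrow> tl_valid m n (Poly_Mapping.single D 1)"
  by (simp add: tl_valid_def)

lemma tl_comp_single_zero_loop:
  assumes "z + inverse z = 0" "valid k m D1" "valid m n D2"
  shows "tl_comp z (Poly_Mapping.single D2 1) (Poly_Mapping.single D1 1) =
    (if loop_free D2 D1 then Poly_Mapping.single (stack D2 D1) 1 else 0)"
  using closed_loops_eq_0_iff[OF assms(2,3)[THEN valid_finite]]
  by (simp add: tl_comp_single assms(1) power_0_left)

lemma tl_comp_zero [simp]: "tl_comp z 0 f = 0" "tl_comp z g 0 = 0"
  by (simp_all add: tl_comp_def)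

lemma tl_comp_assoc_single:
  assumes z: "z + inverse z = 0" and D: "valid k m D1" "valid m n D2" "valid n l D3"
  shows "tl_comp z (Poly_Mapping.single D3 1) (tl_comp z (Poly_Mapping.single D2 1) (Poly_Mapping.single D1 1)) =
    tl_comp z (tl_comp z (Poly_Mapping.single D3 1) (Poly_Mapping.single D2 1)) (Poly_Mapping.single D1 1)"
proof -
  have fin: "finite D1" "finite D2" "finite D3" using D valid_finite by blast+
  have "finite (stack D2 D1)" "finite (stack D3 D2)"
    using stack_subset D finite_boundary unfolding valid_def by (meson finite_SigmaI finite_subset)+
  note loops = closed_loops_eq_0_iff[OF this(1) fin(3)] closed_loops_eq_0_iff[OF fin(1) this(2)]
  note loops = loops closed_loops_eq_0_iff[OF fin(1,2)] closed_loops_eq_0_iff[OF fin(2,3)]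
  have "loop_free D2 D1 \<and> loop_free D3 (stack D2 D1) \<longleftrightarrow> loop_free D3 D2 \<and> loop_free (stack D3 D2) D1"
    by (rule loop_free_assoc[OF D])
  then show ?thesis
    by (cases "loop_free D2 D1"; cases "loop_free D3 D2")
       (simp_all add: tl_comp_single z power_0_left loops stack_assoc[OF D])
qed

lemma tl_comp_assoc:
  assumes z: "z + inverse z = 0" and "tl_valid k m f" "tl_valid m n g" "tl_valid n l h"
  shows "tl_comp z h (tl_comp z g f) = tl_comp z (tl_comp z h g) f"
proof -
  have lin1: "tl_linear (\<lambda>h. tl_comp z (tl_comp z h g) f)" for f g
    by (rule tl_linear_compose[OF tl_linear_comp_left tl_linear_comp_left])
  have lin2: "tl_linear (\<lambda>g. tl_comp z h (tl_comp z g f))" for f h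
    by (rule tl_linear_compose[OF tl_linear_comp_right tl_linear_comp_left])
  have lin3: "tl_linear (\<lambda>g. tl_comp z (tl_comp z h g) f)" for f h
    by (rule tl_linear_compose[OF tl_linear_comp_left tl_linear_comp_right])
  have lin4: "tl_linear (\<lambda>f. tl_comp z h (tl_comp z g f))" for g h
    by (rule tl_linear_compose[OF tl_linear_comp_right tl_linear_comp_right])
  show ?thesis
  proof (rule tl_linear_eqI[OF tl_linear_comp_left lin1 assms(4)[unfolded tl_valid_def]])
    fix D3 assume D3: "D3 \<in> {D. valid n l D}"
    let ?h = "Poly_Mapping.single D3 1"
    show "tl_comp z ?h (tl_comp z g f) = tl_comp z (tl_comp z ?h g) f"
    proof (rule tl_linear_eqI[OF lin2 lin3 assms(3)[unfolded tl_valid_def]])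
      fix D2 assume D2: "D2 \<in> {D. valid m n D}"
      let ?g = "Poly_Mapping.single D2 1"
      show "tl_comp z ?h (tl_comp z ?g f) = tl_comp z (tl_comp z ?h ?g) f"
        by (rule tl_linear_eqI[OF lin4 tl_linear_comp_right assms(2)[unfolded tl_valid_def]])
           (use D2 D3 in \<open>simp add: tl_comp_assoc_single[OF z]\<close>)
    qed
  qed
qed


section \<open>Modules over the Temperley--Lieb relations with loop value zero\<close>

text \<open>The same expression is evaluated on different numbers of strands, so that adding identity
  strands amounts to evaluating it elsewhere.\<close>

datatype 'k tl_expr =
  One | Gen nat | Add "'k tl_expr" "'k tl_expr" | Mul "'k tl_expr" "'k tl_expr" | Scale 'k "'k tl_expr"

primrec tl_eval ::
    "('k \<Rightarrow> 'v \<Rightarrow> 'v::ab_group_add) \<Rightarrow> (nat \<Rightarrow> 'v \<Rightarrow> 'v) \<Rightarrow> 'k tl_expr \<Rightarrow> 'v \<Rightarrow> 'v" where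
  "tl_eval sc T One v = v"
| "tl_eval sc T (Gen i) v = T i v"
| "tl_eval sc T (Add x y) v = tl_eval sc T x v + tl_eval sc T y v"
| "tl_eval sc T (Mul x y) v = tl_eval sc T x (tl_eval sc T y v)"
| "tl_eval sc T (Scale c x) v = sc c (tl_eval sc T x v)"

primrec gens :: "'k tl_expr \<Rightarrow> nat set" where
  "gens One = {}"
| "gens (Gen i) = {i}"
| "gens (Add x y) = gens x \<union> gens y"
| "gens (Mul x y) = gens x \<union> gens y"
| "gens (Scale c x) = gens x"

text \<open>There is no idempotent on an even number of strands to pass through, so \<open>jw_expr a\<close> lives on
  \<open>2a + 1\<close> strands and the recursion adds two of them.\<close>

primrec jw_expr :: "nat \<Rightarrow> 'k::field tl_expr" where
  "jw_expr 0 = One"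
| "jw_expr (Suc a) =
     (let E = jw_expr a; u = Gen (2 * a); w = Gen (2 * a + 1); w' = Gen (2 * a - 1) in
      Add (Add E (Scale (- 1) (Add (Mul E (Mul u (Mul E w))) (Mul w (Mul E (Mul u E))))))
        (Scale (of_nat a / of_nat (Suc a)) (Mul E (Mul u (Mul w' (Mul w (Mul u E)))))))"

lemma gens_jw_expr: "gens (jw_expr a) \<subseteq> {..<2 * a}"
  by (induction a) (auto simp: Let_def)

definition crossing_expr :: "'k::field \<Rightarrow> nat \<Rightarrow> 'k tl_expr" where
  "crossing_expr s i = Add (Scale s One) (Scale (inverse s) (Gen i))"

text \<open>The braiding of one strand with n strands to its right; \<open>under_expr s n\<close>
  will be the braiding of n strands with one. They are products of the same crossings in opposite
  orders.\<close>

primrec over_expr :: "'k::field \<Rightarrow> nat \<Rightarrow> 'k tl_expr" where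
  "over_expr s 0 = One"
| "over_expr s (Suc n) = Mul (crossing_expr s n) (over_expr s n)"

primrec under_expr :: "'k::field \<Rightarrow> nat \<Rightarrow> 'k tl_expr" where
  "under_expr s 0 = One"
| "under_expr s (Suc n) = Mul (under_expr s n) (crossing_expr s n)"

primrec twist_expr :: "'k::field \<Rightarrow> nat \<Rightarrow> 'k tl_expr" where
  "twist_expr s 0 = One"
| "twist_expr s (Suc n) =
     Scale (inverse s) (Mul (twist_expr s n) (Mul (over_expr s n) (under_expr s n)))"

lemma gens_over_expr: "gens (over_expr s n) \<subseteq> {..<n}"
  and gens_under_expr: "gens (under_expr s n) \<subseteq> {..<n}"
  by (induction n) (auto simp: crossing_expr_def)

lemma gens_twist_expr: "gens (twist_expr s n) \<subseteq> {..<n - 1}"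
proof (induction n)
  case (Suc n)
  then show ?case
    using gens_over_expr[of s n] gens_under_expr[of s n] by fastforce
qed simp

text \<open>On \<open>N\<close> strands the hooks are the \<open>T i\<close> with
  \<open>Suc i < N\<close>, and the relations concern only those. Linearity is asked of every
  \<open>T i\<close>, so that evaluating an expression is linear without a side condition on its
  generators.\<close>

locale tl_module = vector_space scale
  for scale :: "'k::field \<Rightarrow> 'v::ab_group_add \<Rightarrow> 'v" (infixr "\<bullet>" 75) +
  fixes T :: "nat \<Rightarrow> 'v \<Rightarrow> 'v" and N :: nat
  assumes T_add: "T i (v + w) = T i v + T i w"
    and T_scale: "T i (c \<bullet> v) = c \<bullet> T i v"
    and T_sq: "Suc i < N \<Longrightarrow> T i (T i v) = 0"
    and T_up: "Suc (Suc i) < N \<Longrightarrow> T i (T (Suc i) (T i v)) = T i v"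
    and T_down: "Suc (Suc i) < N \<Longrightarrow> T (Suc i) (T i (T (Suc i) v)) = T (Suc i) v"
    and T_comm: "Suc i < j \<Longrightarrow> Suc j < N \<Longrightarrow> T j (T i v) = T i (T j v)"
begin

abbreviation ev :: "'k tl_expr \<Rightarrow> 'v \<Rightarrow> 'v" where
  "ev \<equiv> tl_eval scale T"

lemma ev_add: "ev x (v + w) = ev x v + ev x w"
  and ev_scale: "ev x (c \<bullet> v) = c \<bullet> ev x v"
  by (induction x arbitrary: v w)
     (simp_all add: T_add T_scale scale_right_distrib scale_left_commute)

lemma ev_zero [simp]: "ev x 0 = 0"
  using ev_add[of x 0 0] by simp

lemma ev_minus: "ev x (- v) = - ev x v"
  using ev_add[of x v "- v"] by (simp add: eq_neg_iff_add_eq_0 add.commute)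

lemma ev_diff: "ev x (v - w) = ev x v - ev x w"
  using ev_add[of x v "- w"] by (simp add: ev_minus)

lemma T_zero [simp]: "T i 0 = 0"
  using ev_zero[of "Gen i"] by simp

lemma T_minus: "T i (- v) = - T i v"
  using ev_minus[of "Gen i"] by simp

lemma T_diff: "T i (v - w) = T i v - T i w"
  using ev_diff[of "Gen i"] by simp

lemmas T_linear = T_add T_scale T_minus T_diff
lemmas ev_linear = ev_add ev_scale ev_minus ev_diff

lemma ev_T_comm:
  assumes "gens x \<subseteq> {..<k}" "k < j" "Suc j < N"
  shows "T j (ev x v) = ev x (T j v)"
  using assms
proof (induction x arbitrary: v)
  case (Gen i)
  then show ?case by (simp add: T_comm)
qed (auto simp: T_linear)

lemma double: "2 \<bullet> v = v + v"
  using scale_left_distrib[of 1 1 v] by simp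

section \<open>The idempotents on an odd number of strands\<close>

abbreviation E :: "nat \<Rightarrow> 'v \<Rightarrow> 'v" where
  "E a \<equiv> ev (jw_expr a)"

lemma E_Suc:
  "E (Suc a) v = E a v - E a (T (2*a) (E a (T (2*a+1) v))) - T (2*a+1) (E a (T (2*a) (E a v)))
     + (of_nat a / of_nat (Suc a)) \<bullet>
         E a (T (2*a) (T (2*a-1) (T (2*a+1) (T (2*a) (E a v)))))"
  by (simp add: Let_def algebra_simps)

declare jw_expr.simps(2) [simp del]

lemma T_E_comm: "2 * a < j \<Longrightarrow> Suc j < N \<Longrightarrow> T j (E a v) = E a (T j v)"
  using ev_T_comm[OF gens_jw_expr] by blast

text \<open>By induction the shorter idempotent fixes \<open>v\<close>, so each correction term of
  the recursion has a hook applied to \<open>v\<close> itself.\<close>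

lemma E_absorb_left: "(\<And>i. i < 2 * a \<Longrightarrow> T i v = 0) \<Longrightarrow> E a v = v"
  by (induction a) (simp_all add: E_Suc)

lemma E_absorb_right:
  "(\<And>i v. i < 2 * a \<Longrightarrow> ev x (T i v) = 0) \<Longrightarrow> ev x (E a v) = ev x v"
  by (induction a arbitrary: v) (simp_all add: E_Suc ev_linear)

text \<open>This partial trace is the source of the coefficients in \<open>jw_expr\<close>: with \<open>\<kappa>\<close> the coefficient of
  one step, the next one must be \<open>1 / (2 - \<kappa>)\<close>, whence \<open>a / (a + 1)\<close>.\<close>

lemma E_Suc_sandwich:
  fixes b
  defines "u' \<equiv> T (2*b)" and "w' \<equiv> T (2*b+1)" and "u \<equiv> T (2*b+2)" and "w \<equiv> T (2*b+3)"
  defines "\<kappa> \<equiv> of_nat b / of_nat (Suc b) :: 'k"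
  assumes N: "2 * b + 4 < N"
  shows "u (E (Suc b) (u v)) = (\<kappa> - 2) \<bullet> E b (u' (E b (u v)))"
    and "u (E (Suc b) (w (u v))) =
      E b (u v) - E b (u' (E b (u (w' (w (u v)))))) - E b (u (w' (u' (E b (w (u v))))))
      + \<kappa> \<bullet> E b (u' (T (2*b-1) (u (w' (u' (E b (w (u v))))))))"
proof -
  define x where "x = T (2*b-1)"
  have comm: "u (E b v) = E b (u v)" "w (E b v) = E b (w v)" "w' (E b v) = E b (w' v)"
    "u (u' v) = u' (u v)" "w (u' v) = u' (w v)" "w (w' v) = w' (w v)" for v
    using N by (simp_all add: T_E_comm T_comm u_def w_def w'_def u'_def)
  have rel: "u (u v) = 0" "u (w (u v)) = u v" "u (w' (u v)) = u v" for v
    using N T_sq[of "2*b+2"] T_up[of "2*b+2"] T_down[of "2*b+1"]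
    by (simp_all add: u_def w_def w'_def eval_nat_numeral)
  \<comment> \<open>The inner \<open>u\<close> slides past \<open>E b\<close> and \<open>u'\<close>,
    and then \<open>u w' u = u\<close> applies.\<close>
  have zigzag: "u (w' (u' (E b (u v)))) = u' (E b (u v))" for v
    using rel(3)[of "u' (E b v)"] by (simp add: comm)
  have lin: "u (v + w) = u v + u w" "u (v - w) = u v - u w" "u (c \<bullet> v) = c \<bullet> u v" for v w c
    by (simp_all add: u_def T_linear)
  have E: "E (Suc b) v = E b v - E b (u' (E b (w' v))) - E b (w' (u' (E b v)))
     + \<kappa> \<bullet> E b (u' (x (w' (u' (E b v)))))" for v
    by (simp only: E_Suc comm flip: u'_def w'_def \<kappa>_def x_def)
  \<comment> \<open>For \<open>b = 0\<close> the index \<open>2*b-1\<close> is truncated to 0 and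
    \<open>x\<close> is not the intended hook. As \<kappa> is 0 in that case, the identities for
    \<open>x\<close> are stated with this factor.\<close>
  have x_comm: "\<kappa> \<bullet> u (E b (u' (x v))) = \<kappa> \<bullet> E b (u' (x (u v)))" for v
  proof (cases b)
    case (Suc c)
    then have "u (x v) = x (u v)"
      using N by (simp add: T_comm u_def x_def)
    then show ?thesis by (simp add: comm)
  qed (simp add: \<kappa>_def)
  have x_loop: "\<kappa> \<bullet> E b (u' (x (u' v))) = \<kappa> \<bullet> E b (u' v)" for v
  proof (cases b)
    case (Suc c)
    then show ?thesis using N T_down[of "2*c+1"] by (simp add: u'_def x_def)
  qed (simp add: \<kappa>_def)
  show "u (E (Suc b) (u v)) = (\<kappa> - 2) \<bullet> E b (u' (E b (u v)))"
    unfolding E lin x_comm x_def[symmetric] by (simp add: comm rel zigzag x_loop) (simp add: scale_left_diff_distrib double)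
  show "u (E (Suc b) (w (u v))) =
      E b (u v) - E b (u' (E b (u (w' (w (u v)))))) - E b (u (w' (u' (E b (w (u v))))))
      + \<kappa> \<bullet> E b (u' (x (u (w' (u' (E b (w (u v))))))))"
    unfolding E lin x_comm x_def[symmetric] by (simp add: comm rel)
qed

definition E_kills :: "nat \<Rightarrow> bool" where
  "E_kills a \<longleftrightarrow> (\<forall>i<2 * a. \<forall>v. T i (E a v) = 0 \<and> E a (T i v) = 0)"

text \<open>Every term of the recursion is wrapped in \<open>E (Suc b)\<close>, possibly up to a
  factor \<open>w\<close>, which settles the hooks below \<open>u\<close>. The hook \<open>w\<close>
  commutes with \<open>E (Suc b)\<close>, so that \<open>w w = 0\<close> and
  \<open>w u w = w\<close> suffice. The hook \<open>u\<close> does not; there the sandwich formulas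
  express \<open>u E u\<close> and \<open>u E w u\<close> through the shorter \<open>E b\<close>,
  and the coefficients are chosen to make the outcome vanish.\<close>

lemma E_kills_Suc_Suc:
  assumes N: "2 * b + 4 < N" and b: "of_nat (b + 1) \<noteq> (0::'k)" "of_nat (b + 2) \<noteq> (0::'k)"
    and E': "E_kills b" and E: "E_kills (Suc b)"
  shows "E_kills (Suc (Suc b))"
proof -
  define u' w' u w where "u' = T (2*b)" and "w' = T (2*b+1)" and "u = T (2*b+2)" and "w = T (2*b+3)"
  define \<kappa>' \<kappa> :: 'k where "\<kappa>' = of_nat b / of_nat (Suc b)" and "\<kappa> = of_nat (Suc b) / of_nat (Suc (Suc b))"
  note sandwich = E_Suc_sandwich[OF N, folded u'_def w'_def u_def w_def \<kappa>'_def]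
  note defs = u'_def w'_def u_def w_def
  have \<kappa>: "1 + \<kappa> * (\<kappa>' - 2) = 0"
  proof -
    define x :: 'k where "x = of_nat b + 1"
    have "x \<noteq> 0" "x + 1 \<noteq> 0"
      using b by (simp_all add: x_def add.commute)
    moreover have "\<kappa> = x / (x + 1)" "\<kappa>' = (x - 1) / x"
      by (simp_all add: \<kappa>_def \<kappa>'_def x_def add.commute)
    moreover have "(x - 1) / x - 2 = - ((x + 1) / x)"
      using \<open>x \<noteq> 0\<close> by (simp add: field_simps)
    ultimately show ?thesis by simp
  qed
  have kill: "i < 2*b+2 \<Longrightarrow> T i (E (Suc b) v) = 0" "i < 2*b+2 \<Longrightarrow> E (Suc b) (T i v) = 0" for i v
    using E by (auto simp: E_kills_def)
  have idem: "E (Suc b) (E (Suc b) v) = E (Suc b) v" for v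
    by (rule E_absorb_left) (simp add: kill)
  have absorb: "E b (E (Suc b) v) = E (Suc b) v" "E (Suc b) (E b v) = E (Suc b) v" for v
    by (rule E_absorb_left E_absorb_right; simp add: kill)+
  have comm: "u (E b v) = E b (u v)" "w (E b v) = E b (w v)" "w' (E b v) = E b (w' v)"
    "u (u' v) = u' (u v)" "w (u' v) = u' (w v)" "w (w' v) = w' (w v)"
    "w (E (Suc b) v) = E (Suc b) (w v)" for v
    using N by (simp_all add: T_E_comm T_comm defs)
  have rel: "w (w v) = 0" "w (u (w v)) = w v" for v
    using N T_sq[of "2*b+3"] T_down[of "2*b+2"] by (simp_all add: defs eval_nat_numeral)
  have kill_gen: "u' (E (Suc b) v) = 0" "w' (E (Suc b) v) = 0"
      "E (Suc b) (u' v) = 0" "E (Suc b) (w' v) = 0" for v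
    by (simp_all add: kill defs)
  have lin: "u (v + z) = u v + u z" "u (v - z) = u v - u z" "u (c \<bullet> v) = c \<bullet> u v"
    "w (v + z) = w v + w z" "w (v - z) = w v - w z" "w (c \<bullet> v) = c \<bullet> w v" "w' (c \<bullet> v) = c \<bullet> w' v"
    "u 0 = 0" "w 0 = 0" "u' 0 = 0" "w' 0 = 0" for v z c
    by (simp_all add: defs T_linear)
  have F: "E (Suc (Suc b)) v = E (Suc b) v - E (Suc b) (u (E (Suc b) (w v))) - w (E (Suc b) (u (E (Suc b) v)))
     + \<kappa> \<bullet> E (Suc b) (u (w' (w (u (E (Suc b) v)))))" for v
    by (simp add: E_Suc[of "Suc b"] \<kappa>_def defs eval_nat_numeral)
  have pass: "E b (u (E (Suc b) v)) = u (E (Suc b) v)" "E b (w (u (E (Suc b) v))) = w (u (E (Suc b) v))"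
    "u' (u (E (Suc b) v)) = 0" "u' (w (u (E (Suc b) v))) = 0" for v
    by (simp_all add: absorb kill_gen lin flip: comm)
  have loop: "w (u (E (Suc b) (w v))) = E (Suc b) (w v)" for v
    using rel(2)[of "E (Suc b) v"] by (simp add: comm)
  have slide: "w (u (w' (w v))) = w' (w v)" for v
    using rel(2)[of "w' v"] by (simp add: comm)
  have cancel: "y + (\<kappa> * (\<kappa>' - 2)) \<bullet> y = 0" for y :: 'v
    using scale_left_distrib[of 1 "\<kappa> * (\<kappa>' - 2)" y] \<kappa> by simp
  \<comment> \<open>The second term vanishes. The third one cancels the first up to
    \<open>E b (u' (E b (u (w' (w (u (E (Suc b) v)))))))\<close>, which the fourth repeats with the
    factor \<open>\<kappa> * (\<kappa>' - 2)\<close>, that is -1.\<close>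
  have 1: "u (E (Suc (Suc b)) v) = 0" for v
    unfolding F lin comm sandwich
    by (simp add: pass lin kill_gen cancel sandwich)
  have 2: "w (E (Suc (Suc b)) v) = 0" for v
    unfolding F lin by (simp add: comm rel loop slide idem kill_gen lin)
  have 3: "E (Suc (Suc b)) (u v) = 0" for v
    unfolding F by (simp add: sandwich ev_linear absorb kill_gen lin comm cancel)
  have 4: "E (Suc (Suc b)) (w v) = 0" for v
    unfolding F by (simp add: rel loop idem comm lin kill_gen)
  have 5: "T i (E (Suc (Suc b)) v) = 0" if "i < 2*b+2" for i v
  proof -
    have "T i (w v) = w (T i v)" for v
      using that N by (simp add: T_comm defs)
    then show ?thesis unfolding F T_linear by (simp add: kill[OF that] lin)
  qed
  have 6: "E (Suc (Suc b)) (T i v) = 0" if "i < 2*b+2" for i v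
  proof -
    have "w (T i v) = T i (w v)" for v
      using that N by (simp add: T_comm defs)
    then show ?thesis unfolding F by (simp add: kill[OF that] lin)
  qed
  show ?thesis
    unfolding E_kills_def
  proof (intro allI impI)
    fix i v assume "i < 2 * Suc (Suc b)"
    then have "i < 2*b+2 \<or> i = 2*b+2 \<or> i = 2*b+3" by presburger
    then consider "i < 2*b+2" | "i = 2*b+2" | "i = 2*b+3" by blast
    then show "T i (E (Suc (Suc b)) v) = 0 \<and> E (Suc (Suc b)) (T i v) = 0"
      by cases (use 1 2 3 4 5 6 in \<open>simp_all only: defs simp_thms\<close>)
  qed
qed

lemma E_kills:
  assumes "2 * a < N" and "\<And>k. 0 < k \<Longrightarrow> k \<le> a \<Longrightarrow> of_nat k \<noteq> (0::'k)"
  shows "E_kills a"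
  using assms
proof (induction a rule: less_induct)
  case (less a)
  consider "a = 0" | "a = 1" | b where "a = Suc (Suc b)"
    by (metis One_nat_def nat.exhaust)
  then show ?case
  proof cases
    case 1
    then show ?thesis by (simp add: E_kills_def)
  next
    case 2
    then have N: "2 < N" using less.prems by simp
    have rel: "T 0 (T 0 v) = 0" "T 1 (T 1 v) = 0"
       "T 0 (T 1 (T 0 v)) = T 0 v" "T 1 (T 0 (T 1 v)) = T 1 v" for v
      using N T_sq[of 0] T_sq[of 1] T_up[of 0] T_down[of 0] by (simp_all add: eval_nat_numeral)
    have F: "E 1 v = v - T 0 (T 1 v) - T 1 (T 0 v)" for v
      using E_Suc[of 0] by simp
    have "T i (E 1 v) = 0 \<and> E 1 (T i v) = 0" if "i < 2" for i v
    proof -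
      have "i = 0 \<or> i = 1" using that by auto
      then show ?thesis by (auto simp: F T_linear rel simp del: One_nat_def)
    qed
    then show ?thesis by (simp add: E_kills_def 2)
  next
    case 3
    have "E_kills b" "E_kills (Suc b)"
      by (rule less.IH; use less.prems 3 in simp)+
    moreover have "of_nat (b + 1) \<noteq> (0::'k)" "of_nat (b + 2) \<noteq> (0::'k)"
      using less.prems(2)[of "b + 1"] less.prems(2)[of "b + 2"] 3 by simp_all
    ultimately show ?thesis
      unfolding 3 using less.prems(1) 3 by (intro E_kills_Suc_Suc) simp_all
  qed
qed

end

section \<open>Crossings and twists between idempotents\<close>

lemma inverse_square_eq_minus:
  fixes s :: "'k::field"
  assumes "s ^ 4 = - 1"
  shows "inverse (s\<^sup>2) = - s\<^sup>2"
  using assms by (intro inverse_unique) (simp flip: power_add)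

text \<open>For n = 2a + 1 the exponent n (n - 2) is \<open>4 * a\<^sup>2 - 1\<close>, and
  \<open>a\<^sup>2\<close> has the parity of a.\<close>

lemma twist_scalar_odd:
  fixes s :: "'k::field"
  assumes "s ^ 4 = - 1"
  shows "s powi (int (2 * a + 1) * (int (2 * a + 1) - 2)) = (- 1) ^ a * inverse s"
proof -
  have s: "s \<noteq> 0" using assms by auto
  have pow4: "s ^ (4 * k) = (- 1) ^ k" for k
    by (simp only: power_mult assms)
  have "int (2 * a + 1) * (int (2 * a + 1) - 2) = int (4 * (a * a)) + - 1"
    by (simp add: algebra_simps)
  also have "s powi \<dots> = (- 1) ^ (a * a) * inverse s"
    using s by (simp only: power_int_add power_int_of_nat pow4 power_int_minus power_int_1_right simp_thms)
  finally show ?thesis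
    by (simp add: minus_one_power_iff)
qed

context tl_module
begin

lemma crossing_kill:
  "T i v = 0 \<Longrightarrow> ev (crossing_expr s i) v = s \<bullet> v"
  by (simp add: crossing_expr_def)

lemma over_under_kill:
  assumes "\<And>i. i < n \<Longrightarrow> T i v = 0"
  shows "ev (over_expr s n) v = s ^ n \<bullet> v" "ev (under_expr s n) v = s ^ n \<bullet> v"
  using assms by (induction n) (simp_all add: crossing_kill ev_scale mult.commute)

text \<open>This is where the exponent n (n - 2) comes from: one more strand brings its own twist
  \<open>inverse s\<close> and two rows of n crossings, each crossing worth s.\<close>

lemma twist_scalar_Suc:
  fixes s :: 'k
  assumes "s \<noteq> 0"
  shows "s powi (int (Suc n) * (int (Suc n) - 2)) =
    inverse s * (s powi (int n * (int n - 2)) * (s ^ n * s ^ n))"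
proof -
  have "int (Suc n) * (int (Suc n) - 2) = -1 + (int n * (int n - 2) + (int n + int n))"
    by (simp add: algebra_simps)
  then show ?thesis
    using assms by (simp only: power_int_add power_int_minus power_int_1_right power_int_of_nat simp_thms)
qed

lemma twist_kill:
  assumes "\<And>i. Suc i < n \<Longrightarrow> T i v = 0" and "s \<noteq> 0"
  shows "ev (twist_expr s n) v = s powi (int n * (int n - 2)) \<bullet> v"
  using assms(1)
proof (induction n)
  case (Suc n)
  then show ?case
    by (simp add: over_under_kill ev_scale twist_scalar_Suc[OF \<open>s \<noteq> 0\<close>] ac_simps del: of_nat_Suc)
qed simp

lemma crossing_absorb:
  "(\<And>v. ev x (T i v) = 0) \<Longrightarrow> ev x (ev (crossing_expr s i) v) = s \<bullet> ev x v"
  by (simp add: crossing_expr_def ev_linear)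

lemma over_under_absorb:
  assumes "\<And>i v. i < n \<Longrightarrow> ev x (T i v) = 0"
  shows "ev x (ev (over_expr s n) v) = s ^ n \<bullet> ev x v" "ev x (ev (under_expr s n) v) = s ^ n \<bullet> ev x v"
  using assms by (induction n arbitrary: v) (simp_all add: crossing_absorb mult.commute)

lemma twist_absorb:
  assumes "\<And>i v. Suc i < n \<Longrightarrow> ev x (T i v) = 0" and "s \<noteq> 0"
  shows "ev x (ev (twist_expr s n) v) = s powi (int n * (int n - 2)) \<bullet> ev x v"
  using assms(1)
proof (induction n arbitrary: v)
  case (Suc n)
  then show ?case
    by (simp add: over_under_absorb ev_scale twist_scalar_Suc[OF \<open>s \<noteq> 0\<close>] ac_simps del: of_nat_Suc)
qed simp

text \<open>Removing the outer pair of crossings gives a recursion for the strand that encircles the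
  strands to its left, and for the result of closing that strand.\<close>

definition encircle :: "'k \<Rightarrow> nat \<Rightarrow> 'k tl_expr" where
  "encircle s n = Mul (over_expr s n) (under_expr s n)"

lemma gens_encircle: "gens (encircle s n) \<subseteq> {..<n}"
  using gens_over_expr[of s n] gens_under_expr[of s n] by (simp add: encircle_def)

lemma encircle_Suc:
  "ev (encircle s (Suc n)) v = ev (crossing_expr s n) (ev (encircle s n) (ev (crossing_expr s n) v))"
  by (simp add: encircle_def)

text \<open>A circle around n strands, where an empty circle has the loop value 0. If every crossing
  of those strands acts as s and \<open>\<zeta> = s\<^sup>2\<close> has square -1, the recursion is
  solved by -(\<zeta>^(n+1) + \<zeta>^(-n-1)), the familiar eigenvalue of an encircling
  loop.\<close>

primrec closed_circle :: "'k \<Rightarrow> nat \<Rightarrow> 'k tl_expr" where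
  "closed_circle s 0 = Scale 0 One"
| "closed_circle s (Suc n) = Add (Scale 2 (encircle s n)) (Scale (inverse (s\<^sup>2)) (closed_circle s n))"

lemma gens_closed_circle: "gens (closed_circle s n) \<subseteq> {..<n - 1}"
  by (induction n) (use gens_encircle in fastforce)+

text \<open>Expand the two outer crossings of the encircling strand between the hooks at n + 1. The
  term with coefficient \<open>s\<^sup>2\<close> contains the square of a hook. Each of the two
  mixed terms straightens by U_{n+1} U_n U_{n+1} = U_{n+1} and leaves one encircling strand, whence
  the 2. The term with coefficient \<open>inverse (s\<^sup>2)\<close> is the induction
  hypothesis.\<close>

lemma T_encircle_T:
  assumes "Suc n < N" "s \<noteq> 0"
  shows "T n (ev (encircle s n) (T n v)) = ev (closed_circle s n) (T n v)"
  using assms(1)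
proof (induction n arbitrary: v)
  case 0
  then show ?case by (simp add: encircle_def T_sq)
next
  case (Suc n)
  have comm: "T (Suc n) (ev (encircle s n) v) = ev (encircle s n) (T (Suc n) v)" for v
    using Suc.prems by (intro ev_T_comm[OF gens_encircle]) auto
  have comm': "T (Suc n) (ev (closed_circle s n) v) = ev (closed_circle s n) (T (Suc n) v)" for v
    using Suc.prems by (intro ev_T_comm[OF gens_closed_circle]) auto
  have rel: "T (Suc n) (T (Suc n) v) = 0" "T (Suc n) (T n (T (Suc n) v)) = T (Suc n) v" for v
    using Suc.prems by (simp_all add: T_sq T_down)
  have through: "T (Suc n) (T n (ev (encircle s n) (T (Suc n) v))) = ev (encircle s n) (T (Suc n) v)" for v
    by (simp add: rel flip: comm)
  show ?case
    using Suc assms(2)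
    by (simp add: encircle_Suc crossing_expr_def T_linear ev_linear comm comm' rel through double
        scale_right_distrib power2_eq_square)
qed

lemma encircle_absorb:
  assumes "\<And>i v. i < n \<Longrightarrow> ev x (T i v) = 0"
  shows "ev x (ev (encircle s n) v) = s ^ (2 * n) \<bullet> ev x v"
  using assms by (simp add: encircle_def over_under_absorb mult_2 power_add)

lemma encircle_kill:
  assumes "\<And>i. i < n \<Longrightarrow> T i v = 0"
  shows "ev (encircle s n) v = s ^ (2 * n) \<bullet> v"
  using assms by (simp add: encircle_def over_under_kill ev_scale mult_2 power_add)

text \<open>Two steps of the recursion contribute 2 \<zeta>^(2n+1) and \<zeta>^(-1) 2 \<zeta>^(2n)
  with \<open>\<zeta> = s\<^sup>2\<close>. They cancel because \<zeta>^(-1) = -\<zeta>; hence the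
  restriction to an even number of encircled strands.\<close>

lemma closed_circle_absorb:
  assumes "\<And>i v. i < 2 * n \<Longrightarrow> ev x (T i v) = 0" and "s ^ 4 = - 1"
  shows "ev x (ev (closed_circle s (2 * n)) v) = 0"
  using assms(1)
proof (induction n arbitrary: v)
  case (Suc n)
  note inv = inverse_square_eq_minus[OF assms(2)]
  have "s ^ (2 * Suc (2 * n)) = s\<^sup>2 * s ^ (2 * (2 * n))"
    by (simp flip: power_add)
  then have cancel: "2 * s ^ (2 * Suc (2 * n)) + inverse (s\<^sup>2) * (2 * s ^ (2 * (2 * n))) = 0"
    by (simp add: inv)
  have absorb: "ev x (ev (encircle s k) v) = s ^ (2 * k) \<bullet> ev x v" if "k \<le> Suc (2 * n)" for k
    by (rule encircle_absorb, rule Suc.prems) (use that in simp)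
  have IH: "ev x (ev (closed_circle s (2 * n)) v) = 0"
    by (rule Suc.IH, rule Suc.prems) simp
  have "closed_circle s (2 * Suc n) = Add (Scale 2 (encircle s (Suc (2 * n))))
      (Scale (inverse (s\<^sup>2)) (closed_circle s (Suc (2 * n))))"
    by simp
  then have "ev x (ev (closed_circle s (2 * Suc n)) v) =
      2 \<bullet> ev x (ev (encircle s (Suc (2 * n))) v) + inverse (s\<^sup>2) \<bullet>
        (2 \<bullet> ev x (ev (encircle s (2 * n)) v)
          + inverse (s\<^sup>2) \<bullet> ev x (ev (closed_circle s (2 * n)) v))"
    by (simp only: closed_circle.simps tl_eval.simps ev_linear)
  also have "\<dots> = 2 \<bullet> s ^ (2 * Suc (2 * n)) \<bullet> ev x v
      + inverse (s\<^sup>2) \<bullet> 2 \<bullet> s ^ (2 * (2 * n)) \<bullet> ev x v"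
    by (simp only: absorb[OF order_refl] absorb[OF le_SucI[OF order_refl]] IH scale_zero_right add_0_right)
  also have "\<dots> = (2 * s ^ (2 * Suc (2 * n)) + inverse (s\<^sup>2) * (2 * s ^ (2 * (2 * n)))) \<bullet> ev x v"
    by (simp only: scale_left_distrib scale_scale)
  finally show ?case by (simp only: cancel scale_zero_left)
qed simp

lemma E_encircle_E:
  assumes "E_kills a" "2 * a + 1 < N" "s ^ 4 = - 1"
  shows "E a (ev (encircle s (2 * a + 1)) (E a v)) =
    s ^ (2 * (2 * a + 1)) \<bullet> E a v + (2 * s ^ (2 * (2 * a))) \<bullet> E a (T (2 * a) (E a v))"
proof -
  have s: "s \<noteq> 0" using assms(3) by auto
  have kill: "T i (E a v) = 0" "E a (T i v) = 0" if "i < 2 * a" for i v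
    using assms(1) that by (auto simp: E_kills_def)
  have idem: "E a (E a v) = E a v" for v
    by (rule E_absorb_left) (simp add: kill)
  have enc: "E a (ev (encircle s (2 * a)) v) = s ^ (2 * (2 * a)) \<bullet> E a v"
      "ev (encircle s (2 * a)) (E a v) = s ^ (2 * (2 * a)) \<bullet> E a v" for v
    by (simp_all add: encircle_absorb encircle_kill kill)
  have zero: "E a (T (2 * a) (ev (encircle s (2 * a)) (T (2 * a) v))) = 0" for v
  proof -
    have "T (2 * a) (ev (encircle s (2 * a)) (T (2 * a) v)) = ev (closed_circle s (2 * a)) (T (2 * a) v)"
      using assms s by (intro T_encircle_T) auto
    also have "E a \<dots> = 0"
      by (rule closed_circle_absorb[OF kill(2) assms(3)])
    finally show ?thesis .
  qed
  let ?J = "ev (encircle s (2 * a))"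
  have "E a (ev (encircle s (2 * a + 1)) (E a v)) =
      (s * s) \<bullet> E a (?J (E a v)) + (s * inverse s) \<bullet> E a (?J (T (2 * a) (E a v)))
      + (inverse s * s) \<bullet> E a (T (2 * a) (?J (E a v)))
      + (inverse s * inverse s) \<bullet> E a (T (2 * a) (?J (T (2 * a) (E a v))))"
    unfolding Suc_eq_plus1[symmetric] encircle_Suc crossing_expr_def tl_eval.simps
    by (simp only: T_linear ev_linear scale_right_distrib scale_scale ac_simps)
  \<comment> \<open>Encircling 2a strands is the same scalar on either side of \<open>E a\<close>,
    so the two mixed terms coincide and produce the factor 2.\<close>
  also have "\<dots> = (s * s * s ^ (2 * (2 * a))) \<bullet> E a v
      + (s ^ (2 * (2 * a)) \<bullet> E a (T (2 * a) (E a v)) + s ^ (2 * (2 * a)) \<bullet> E a (T (2 * a) (E a v)))"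
    using s by (simp add: enc zero idem ev_scale T_scale)
  also have "s * s * s ^ (2 * (2 * a)) = s ^ (2 * (2 * a + 1))"
    by (simp add: power_add)
  finally show ?thesis
    by (simp only: mult_2[of "s ^ (2 * (2 * a))"] scale_left_distrib)
qed

text \<open>The twist of the first 2a + 1 strands is absorbed by \<open>E a\<close> on the left as
  \<open>(- 1) ^ a * inverse s\<close>. Together with \<open>inverse s\<close> for the last strand
  this gives \<open>(- 1) ^ a * inverse (s\<^sup>2)\<close>, which exactly offsets the scalar
  \<open>(- 1) ^ a * s\<^sup>2\<close> of the encircling strand.\<close>

lemma E_twist_E:
  assumes "E_kills a" "2 * a + 1 < N" "s ^ 4 = - 1"
  shows "E a (ev (twist_expr s (2 * a + 2)) (E a v)) =
    E a v + (2 * inverse (s\<^sup>2)) \<bullet> E a (T (2 * a) (E a v))"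
proof -
  have s: "s \<noteq> 0" using assms(3) by auto
  have kill: "E a (T i v) = 0" if "Suc i < 2 * a + 1" for i v
    using assms(1) that by (auto simp: E_kills_def)
  have pow4: "s ^ (4 * k) = (- 1) ^ k" for k
    by (simp only: power_mult assms(3))
  have scalar: "inverse s * s powi (int (2 * a + 1) * (int (2 * a + 1) - 2)) = (- 1) ^ a * inverse (s\<^sup>2)"
    unfolding twist_scalar_odd[OF assms(3)] by (simp add: power2_eq_square)
  have "s ^ (2 * (2 * a + 1)) = s ^ (4 * a) * s\<^sup>2" "s ^ (2 * (2 * a)) = s ^ (4 * a)"
    by (simp_all flip: power_add)
  then have pow: "s ^ (2 * (2 * a + 1)) = (- 1) ^ a * s\<^sup>2" "s ^ (2 * (2 * a)) = (- 1) ^ a"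
    by (simp_all only: pow4)
  have coeffs: "(- 1) ^ a * inverse (s\<^sup>2) * ((- 1) ^ a * s\<^sup>2) = 1"
    "(- 1) ^ a * inverse (s\<^sup>2) * (2 * (- 1) ^ a) = 2 * inverse (s\<^sup>2)"
    using s by (cases "even a"; simp)+
  have "ev (twist_expr s (2 * a + 2)) v =
      inverse s \<bullet> ev (twist_expr s (2 * a + 1)) (ev (encircle s (2 * a + 1)) v)" for v
    by (simp add: encircle_def)
  then have "E a (ev (twist_expr s (2 * a + 2)) (E a v)) =
      ((- 1) ^ a * inverse (s\<^sup>2)) \<bullet> E a (ev (encircle s (2 * a + 1)) (E a v))"
    using twist_absorb[of "2 * a + 1" "jw_expr a" s, OF kill s]
    by (simp only: ev_scale scale_scale scalar)
  then show ?thesis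
    by (simp only: E_encircle_E[OF assms] pow scale_right_distrib scale_scale coeffs scale_one)
qed

end


section \<open>Elementary diagrams\<close>

text \<open>A label names a connected component, so that showing two points to be unconnected
  reduces to a function that is constant along edges.\<close>

definition label_diagram :: "nat \<Rightarrow> nat \<Rightarrow> (point \<Rightarrow> 'l) \<Rightarrow> diagram" where
  "label_diagram m n \<phi> = {(x, y). x \<in> boundary m n \<and> y \<in> boundary m n \<and> x \<noteq> y \<and> \<phi> x = \<phi> y}"

text \<open>Matchings are handled as involutions without fixed points, because stacking a hook then
  becomes a few function updates.\<close>

definition involution_on :: "point set \<Rightarrow> (point \<Rightarrow> point) \<Rightarrow> bool" where
  "involution_on B p \<longleftrightarrow> (\<forall>x\<in>B. p x \<in> B \<and> p x \<noteq> x \<and> p (p x) = x)"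

definition partner_diagram :: "nat \<Rightarrow> nat \<Rightarrow> (point \<Rightarrow> point) \<Rightarrow> diagram" where
  "partner_diagram m n p = (\<lambda>x. (x, p x)) ` boundary m n"

lemma mem_partner_diagram:
  "(x, y) \<in> partner_diagram m n p \<longleftrightarrow> x \<in> boundary m n \<and> y = p x"
  by (auto simp: partner_diagram_def)

lemma valid_partner_diagram: "involution_on (boundary m n) p \<Longrightarrow> valid m n (partner_diagram m n p)"
  unfolding valid_def sym_def subset_iff involution_on_def
  by (auto simp: mem_partner_diagram Domain_iff)

text \<open>The function \<open>\<psi>\<close> labels the connected components of the glued diagram.\<close>

lemma stack_eq_label_diagram:
  assumes D1: "D1 \<subseteq> boundary k m \<times> boundary k m" and D2: "D2 \<subseteq> boundary m l \<times> boundary m l"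
    and \<psi>: "\<And>x y. (x, y) \<in> glue D2 D1 \<Longrightarrow> \<psi> x = \<psi> y"
    and \<phi>: "\<And>x. x \<in> boundary k l \<Longrightarrow> \<phi> x = \<psi> (apfst ((*) 2) x)"
    and path: "\<And>x y. x \<in> boundary k l \<Longrightarrow> y \<in> boundary k l \<Longrightarrow> x \<noteq> y \<Longrightarrow> \<phi> x = \<phi> y \<Longrightarrow>
      (apfst ((*) 2) x, apfst ((*) 2) y) \<in> (glue D2 D1)\<^sup>*"
  shows "stack D2 D1 = label_diagram k l \<phi>"
proof -
  have \<psi>': "\<psi> x = \<psi> y" if "(x, y) \<in> (glue D2 D1)\<^sup>*" for x y
    using that by (induction rule: rtrancl_induct) (auto dest: \<psi>)
  have "(x, y) \<in> stack D2 D1 \<longleftrightarrow> (x, y) \<in> label_diagram k l \<phi>" for x y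
  proof
    assume xy: "(x, y) \<in> stack D2 D1"
    then have B: "x \<in> boundary k l" "y \<in> boundary k l"
      using stack_subset[OF D1 D2] by auto
    with xy show "(x, y) \<in> label_diagram k l \<phi>"
      using \<phi>[OF B(1)] \<phi>[OF B(2)] \<psi>' by (auto simp: stack_def label_diagram_def simp del: apfst_conv)
  next
    assume "(x, y) \<in> label_diagram k l \<phi>"
    then show "(x, y) \<in> stack D2 D1"
      using path[of x y] unfolding stack_def label_diagram_def by blast
  qed
  then show ?thesis by auto
qed

lemma partner_diagram_eq_label_diagram:
  assumes "involution_on (boundary m n) p"
  shows "partner_diagram m n p = label_diagram m n (\<lambda>x. {x, p x})"
proof -
  have "y = p x \<longleftrightarrow> x \<noteq> y \<and> {x, p x} = {y, p y}" if "x \<in> boundary m n" "y \<in> boundary m n" for x y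
    using assms that unfolding involution_on_def by (metis doubleton_eq_iff)
  then have "(x, y) \<in> partner_diagram m n p \<longleftrightarrow> (x, y) \<in> label_diagram m n (\<lambda>x. {x, p x})" for x y
    using assms unfolding mem_partner_diagram label_diagram_def involution_on_def by auto
  then show ?thesis by auto
qed

lemma sym_label_diagram: "sym (label_diagram m n \<phi>)"
  by (auto simp: sym_def label_diagram_def)

lemma label_diagram_subset: "label_diagram m n \<phi> \<subseteq> boundary m n \<times> boundary m n"
  by (auto simp: label_diagram_def)

lemma glue_lower: "(x, y) \<in> D1 \<Longrightarrow> (x, y) \<in> glue D2 D1"
  by (simp add: glue_def)

lemma glue_upper: "((a, b), (c, d)) \<in> D2 \<Longrightarrow> ((Suc a, b), (Suc c, d)) \<in> glue D2 D1"
  by (force simp: glue_def)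

lemma glueE:
  assumes "(x, y) \<in> glue D2 D1"
  obtains "(x, y) \<in> D1" | a b c d where "((a, b), (c, d)) \<in> D2" "x = (Suc a, b)" "y = (Suc c, d)"
  using assms by (auto simp: glue_def)

lemma sym_glue: "sym D1 \<Longrightarrow> sym D2 \<Longrightarrow> sym (glue D2 D1)"
  unfolding glue_def sym_def by (auto simp: image_iff Bex_def; blast)

text \<open>The diagram of U_i, with positions counted from 0. The labels \<open>n\<close> and
  \<open>n + 1\<close> mark the lower and the upper arc and stay clear of the labels below
  \<open>n\<close> of the through strands.\<close>

definition hook :: "nat \<Rightarrow> nat \<Rightarrow> diagram" where
  "hook n i = label_diagram n n (\<lambda>(h, j). if j = i \<or> j = Suc i then n + h else j)"

lemma hook_subset: "hook n i \<subseteq> boundary n n \<times> boundary n n"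
  by (simp add: hook_def label_diagram_subset)

lemma sym_hook: "sym (hook n i)"
  by (simp add: hook_def sym_label_diagram)

lemma hook_edge:
  "Suc i < n \<Longrightarrow> h \<le> 1 \<Longrightarrow> ((h, i), (h, Suc i)) \<in> hook n i"
  "j < n \<Longrightarrow> j \<noteq> i \<Longrightarrow> j \<noteq> Suc i \<Longrightarrow> ((0, j), (1, j)) \<in> hook n i"
  by (auto simp: hook_def label_diagram_def mem_boundary)

lemma hookE:
  assumes "((a, b), (c, d)) \<in> hook n i"
  obtains "a = c" "a \<le> 1" "b = i" "d = Suc i" | "a = c" "a \<le> 1" "d = i" "b = Suc i"
   | "b = d" "b \<noteq> i" "b \<noteq> Suc i" "a = 0" "c = 1" "b < n" | "b = d" "b \<noteq> i" "b \<noteq> Suc i" "a = 1" "c = 0" "b < n"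
  using assms by (auto simp: hook_def label_diagram_def mem_boundary split: if_splits)

lemma valid_hook: "Suc i < n \<Longrightarrow> valid n n (hook n i)"
  unfolding valid_def
proof (intro conjI hook_subset sym_hook subsetI)
  fix x assume i: "Suc i < n" and x: "x \<in> boundary n n"
  obtain h j where hj: "x = (h, j)" by fastforce
  have "h \<le> 1" "j < n" using x by (auto simp: hj mem_boundary)
  have *: "((h', j), (h'', j')) \<in> hook n i \<Longrightarrow> ((h'', j'), (h', j)) \<in> hook n i" for h' h'' j j'
    using sym_hook by (meson symD)
  consider "j = i" | "j = Suc i" | "j \<noteq> i" "j \<noteq> Suc i" by blast
  then show "x \<in> Domain (hook n i)"
  proof cases
    case 1 then show ?thesis using hook_edge(1)[OF i \<open>h \<le> 1\<close>] hj by auto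
  next
    case 2 then show ?thesis using *[OF hook_edge(1)[OF i \<open>h \<le> 1\<close>]] hj by auto
  next
    case 3
    then show ?thesis using hook_edge(2)[OF \<open>j < n\<close> 3] *[OF hook_edge(2)[OF \<open>j < n\<close> 3]] hj \<open>h \<le> 1\<close>
      by (cases h) auto
  qed
qed

text \<open>The effect of a hook stacked on top: its lower arc links the former partners of the two
  top points, and its upper arc joins these points anew. The updates for the new arc come last and
  take precedence.\<close>

definition reconnect :: "nat \<Rightarrow> (point \<Rightarrow> point) \<Rightarrow> point \<Rightarrow> point" where
  "reconnect i p = (let t = (1, i); t' = (1, Suc i) in
     p(p t := p t', p t' := p t, t := t', t' := t))"

lemma involution_on_reconnect:
  assumes "involution_on (boundary m n) p" "Suc i < n" "p (1, i) \<noteq> (1, Suc i)"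
  shows "involution_on (boundary m n) (reconnect i p)"
proof -
  define t t' where "t = (1::nat, i)" and "t' = (1::nat, Suc i)"
  have "t \<in> boundary m n" "t' \<in> boundary m n" "t \<noteq> t'"
    using assms(2) by (auto simp: t_def t'_def mem_boundary)
  moreover have "p t \<noteq> t'" using assms(3) by (simp add: t_def t'_def)
  ultimately show ?thesis
    using assms(1) unfolding involution_on_def reconnect_def Let_def t_def[symmetric] t'_def[symmetric]
    by (smt (verit) fun_upd_def)
qed

lemma stack_hook:
  assumes p: "involution_on (boundary m n) p" and i: "Suc i < n" and loop: "p (1, i) \<noteq> (1, Suc i)"
  shows "stack (hook n i) (partner_diagram m n p) = partner_diagram m n (reconnect i p)" (is ?stack)
    and "loop_free (hook n i) (partner_diagram m n p)" (is ?loop_free)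
proof -
  let ?B = "boundary m n" and ?D = "partner_diagram m n p"
  let ?G = "glue (hook n i) ?D"
  define t t' where "t = (1::nat, i)" and "t' = (1::nat, Suc i)"
  define q where "q = reconnect i p"
  have B: "t \<in> ?B" "t' \<in> ?B" "t \<noteq> t'"
    using i by (auto simp: t_def t'_def mem_boundary)
  have pI: "p x \<in> ?B" "p x \<noteq> x" "p (p x) = x" if "x \<in> ?B" for x
    using p that by (auto simp: involution_on_def)
  have pt: "p t \<noteq> t'" using loop by (simp add: t_def t'_def)
  have pt': "p t' \<noteq> t" using pt pI(3)[OF B(2)] by auto
  have ends: "p t \<noteq> t" "p t' \<noteq> t'" "p t \<noteq> p t'"
    using pI B by metis+
  have qI: "involution_on ?B q"
    unfolding q_def by (rule involution_on_reconnect[OF p i loop])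
  have q: "q t = t'" "q t' = t" "q (p t) = p t'" "q (p t') = p t"
     "x \<noteq> t \<Longrightarrow> x \<noteq> t' \<Longrightarrow> x \<noteq> p t \<Longrightarrow> x \<noteq> p t' \<Longrightarrow> q x = p x" for x
    using B pt pt' ends by (auto simp: q_def reconnect_def Let_def t_def t'_def)
  have valid: "valid m n ?D" by (rule valid_partner_diagram[OF p])
  have symG: "sym (?G\<^sup>*)"
    using valid by (intro sym_rtrancl sym_glue sym_hook) (auto simp: valid_def)
  have edge: "(x, p x) \<in> ?G\<^sup>*" if "x \<in> ?B" for x
    using that by (intro r_into_rtrancl glue_lower) (simp add: mem_partner_diagram)
  have bridge: "(t, t') \<in> ?G\<^sup>*" "(apfst ((*) 2) t, apfst ((*) 2) t') \<in> ?G\<^sup>*"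
    using glue_upper[OF hook_edge(1)[OF i, of 0]] glue_upper[OF hook_edge(1)[OF i, of 1]]
    by (auto simp: t_def t'_def numeral_2_eq_2)
  have up: "(x, apfst ((*) 2) x) \<in> ?G\<^sup>*" if "x \<in> ?B" "x \<noteq> t" "x \<noteq> t'" for x
  proof -
    obtain h j where x: "x = (h, j)" by fastforce
    show ?thesis
    proof (cases "h = 0")
      case False
      then have "h = 1" "j < n" "j \<noteq> i" "j \<noteq> Suc i"
        using that by (auto simp: x mem_boundary t_def t'_def)
      then show ?thesis
        using glue_upper[OF hook_edge(2)[of j n i]] by (auto simp: x numeral_2_eq_2)
    qed (simp add: x)
  qed
  have connect: "(apfst ((*) 2) x, apfst ((*) 2) (q x)) \<in> ?G\<^sup>*" if x: "x \<in> ?B" for x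
  proof -
    note up' = symD[OF symG up]
    consider "x = t" | "x = t'" | "x = p t" | "x = p t'" | "x \<noteq> t" "x \<noteq> t'" "x \<noteq> p t" "x \<noteq> p t'" by blast
    then show ?thesis
    proof cases
      case 1 then show ?thesis using bridge(2) q by simp
    next
      case 2 then show ?thesis using symD[OF symG bridge(2)] q by simp
    next
      case 3
      have "(apfst ((*) 2) x, x) \<in> ?G\<^sup>*" using up' x 3 pt ends by blast
      also have "(x, t) \<in> ?G\<^sup>*" using edge[OF x] pI(3)[OF B(1)] 3 by simp
      also have "(t, t') \<in> ?G\<^sup>*" by (rule bridge)
      also have "(t', p t') \<in> ?G\<^sup>*" using edge[OF B(2)] .
      also have "(p t', apfst ((*) 2) (p t')) \<in> ?G\<^sup>*" using up pI B pt' ends by blast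
      finally show ?thesis using q 3 by simp
    next
      case 4
      have "(apfst ((*) 2) x, x) \<in> ?G\<^sup>*" using up' x 4 pt' ends by blast
      also have "(x, t') \<in> ?G\<^sup>*" using edge[OF x] pI(3)[OF B(2)] 4 by simp
      also have "(t', t) \<in> ?G\<^sup>*" by (rule symD[OF symG bridge(1)])
      also have "(t, p t) \<in> ?G\<^sup>*" using edge[OF B(1)] .
      also have "(p t, apfst ((*) 2) (p t)) \<in> ?G\<^sup>*" using up pI B pt ends by blast
      finally show ?thesis using q 4 by simp
    next
      case 5
      then have px: "p x \<noteq> t" "p x \<noteq> t'" using pI(3)[OF x] by auto
      have "(apfst ((*) 2) x, x) \<in> ?G\<^sup>*" using up' x 5 by blast
      also have "(x, p x) \<in> ?G\<^sup>*" using edge[OF x] .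
      also have "(p x, apfst ((*) 2) (p x)) \<in> ?G\<^sup>*" using up[OF pI(1)[OF x] px] .
      finally show ?thesis using q(5) 5 by simp
    qed
  qed
  define cls where "cls x = {x, q x}" for x
  have cls_q: "cls (q x) = cls x" if "x \<in> ?B" for x
    using qI that by (auto simp: cls_def involution_on_def)
  \<comment> \<open>Level 2 carries the classes of the result. On the glued level the two points
    under the hook belong to the arc that passes through them, whose class is that of their old
    partners.\<close>
  define \<psi> where "\<psi> x = (if fst x = 2 then cls (1, snd x) else if x = t \<or> x = t' then cls (p x) else cls x)" for x
  have "stack (hook n i) ?D = label_diagram m n cls"
  proof (rule stack_eq_label_diagram[where \<psi> = \<psi>])
    show "?D \<subseteq> ?B \<times> ?B" using valid by (simp add: valid_def)
    show "hook n i \<subseteq> boundary n n \<times> boundary n n" by (rule hook_subset)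
    show "\<psi> x = \<psi> y" if "(x, y) \<in> ?G" for x y
      using that
    proof (cases rule: glueE)
      case 1
      then have x: "x \<in> ?B" "y = p x" by (auto simp: mem_partner_diagram)
      then have "fst x \<noteq> 2" "fst y \<noteq> 2" using pI(1)[OF x(1)] by (auto simp: boundary_def)
      moreover have "cls (p x) = cls x" if "x \<noteq> t" "x \<noteq> t'" "x \<noteq> p t" "x \<noteq> p t'"
        using cls_q[OF x(1)] q(5) that by simp
      ultimately show ?thesis
        unfolding \<psi>_def x(2) using pI x(1) B pt pt' ends by (smt (verit, best))
    next
      case (2 a b c d)
      note edge = 2
      show ?thesis using 2(1)
      proof (cases rule: hookE)
        case 1
        then consider "a = 0" | "a = 1" by linarith
        then show ?thesis
        proof cases
          assume "a = 0"
          then have "x = t" "y = t'" using 1 edge by (auto simp: t_def t'_def)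
          then show ?thesis using cls_q[OF pI(1)[OF B(1)]] q by (simp add: \<psi>_def t_def t'_def)
        next
          assume "a = 1"
          then show ?thesis using 1 edge cls_q[OF B(1)] q(1) by (simp add: \<psi>_def t_def t'_def numeral_2_eq_2)
        qed
      next
        case 2
        then consider "a = 0" | "a = 1" by linarith
        then show ?thesis
        proof cases
          assume "a = 0"
          then have "x = t'" "y = t" using 2 edge by (auto simp: t_def t'_def)
          then show ?thesis using cls_q[OF pI(1)[OF B(1)]] q by (simp add: \<psi>_def t_def t'_def)
        next
          assume "a = 1"
          then show ?thesis using 2 edge cls_q[OF B(1)] q(1) by (simp add: \<psi>_def t_def t'_def numeral_2_eq_2)
        qed
      next
        case 3 then show ?thesis using edge by (simp add: \<psi>_def t_def t'_def numeral_2_eq_2)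
      next
        case 4 then show ?thesis using edge by (simp add: \<psi>_def t_def t'_def numeral_2_eq_2)
      qed
    qed
    show "cls x = \<psi> (apfst ((*) 2) x)" if "x \<in> ?B" for x
      using that by (cases x) (auto simp: \<psi>_def mem_boundary t_def t'_def)
    show "(apfst ((*) 2) x, apfst ((*) 2) y) \<in> ?G\<^sup>*"
      if xy: "x \<in> ?B" "y \<in> ?B" "x \<noteq> y" "cls x = cls y" for x y
    proof -
      have "y = q x" using xy(3,4) by (auto simp: cls_def doubleton_eq_iff)
      then show ?thesis using connect[OF xy(1)] by simp
    qed
  qed
  then show ?stack
    unfolding cls_def q_def[symmetric] partner_diagram_eq_label_diagram[OF qI] .
  have reach: "\<exists>y. fst y \<noteq> 1 \<and> (x, y) \<in> ?G\<^sup>*" if "x \<in> ?B" "x \<noteq> t" "x \<noteq> t'" for x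
  proof -
    have "fst (apfst ((*) 2) x) \<noteq> 1" by (cases x) simp
    then show ?thesis using up[OF that] by blast
  qed
  have reach': "\<exists>y. fst y \<noteq> 1 \<and> (x, y) \<in> ?G\<^sup>*" if "x = t \<or> x = t'" for x
  proof -
    from that have "x \<in> ?B" "p x \<noteq> t" "p x \<noteq> t'"
      using B pt pt' ends by metis+
    with pI(1) edge have "p x \<in> ?B" "p x \<noteq> t" "p x \<noteq> t'" "(x, p x) \<in> ?G\<^sup>*"
      by blast+
    then show ?thesis using reach by (meson rtrancl_trans)
  qed
  show ?loop_free
    unfolding loop_free_iff[OF valid[unfolded valid_def, THEN conjunct1] hook_subset disjI1[OF valid]]
  proof
    fix x :: point assume "x \<in> {1} \<times> {..<n}"
    then have "x \<in> ?B" by (auto simp: mem_boundary)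
    then show "\<exists>y. fst y \<noteq> 1 \<and> (x, y) \<in> ?G\<^sup>*" using reach reach' by blast
  qed
qed

text \<open>The arc of the matching and the lower arc of the hook have the same two ends, which
  therefore form a component of their own on the glued level.\<close>

lemma not_loop_free_hook:
  assumes p: "involution_on (boundary m n) p" and i: "Suc i < n" and loop: "p (1, i) = (1, Suc i)"
  shows "\<not> loop_free (hook n i) (partner_diagram m n p)"
proof -
  let ?G = "glue (hook n i) (partner_diagram m n p)" and ?t = "(1::nat, i)" and ?t' = "(1::nat, Suc i)"
  have "?t \<in> boundary m n" using i by (simp add: mem_boundary)
  then have loop': "p ?t' = ?t" using p loop by (metis involution_on_def)
  have closed: "y \<in> {?t, ?t'}" if "(x, y) \<in> ?G" "x \<in> {?t, ?t'}" for x y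
    using that(1)
  proof (cases rule: glueE)
    case 1 then show ?thesis using loop loop' that(2) by (auto simp: mem_partner_diagram)
  next
    case (2 a b c d)
    show ?thesis using 2(1) by (cases rule: hookE) (use 2 that(2) in auto)
  qed
  have "y \<in> {?t, ?t'}" if "(?t, y) \<in> ?G\<^sup>*" for y
    using that by (induction rule: rtrancl_induct) (auto dest: closed)
  moreover have "?t \<in> Field ?G"
    using glue_lower[of ?t "p ?t" "partner_diagram m n p"] i
    by (auto simp: mem_partner_diagram mem_boundary intro: FieldI1)
  ultimately show ?thesis unfolding loop_free_def by fastforce
qed


section \<open>Planarity\<close>

definition between :: "nat \<Rightarrow> nat \<Rightarrow> nat \<Rightarrow> bool" where
  "between u v x \<longleftrightarrow> min u v < x \<and> x < max u v"

lemma between_iff: "u \<noteq> x \<Longrightarrow> v \<noteq> x \<Longrightarrow> between u v x \<longleftrightarrow> (u < x) \<noteq> (v < x)"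
  by (auto simp: between_def min_def max_def)

text \<open>That two arcs with distinct ends do not cross is a symmetric relation.\<close>

lemma between_sym:
  assumes "u \<noteq> x" "u \<noteq> y" "v \<noteq> x" "v \<noteq> y"
  shows "between u v x = between u v y \<longleftrightarrow> between x y u = between x y v"
proof -
  have "x < u \<longleftrightarrow> \<not> u < x" "y < u \<longleftrightarrow> \<not> u < y" "x < v \<longleftrightarrow> \<not> v < x" "y < v \<longleftrightarrow> \<not> v < y"
    using assms by auto
  then show ?thesis
    using assms by (simp add: between_iff eq_commute) argo
qed

lemma boundary_rank_inj:
  "x \<in> boundary m n \<Longrightarrow> y \<in> boundary m n \<Longrightarrow> boundary_rank m n x = boundary_rank m n y \<Longrightarrow> x = y"
  by (cases x; cases y) (auto simp: boundary_def boundary_rank_def split: if_splits)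

text \<open>Instead of forbidding an order pattern of four ranks, this asks that both ends of an arc
  lie on the same side of every other arc, which needs no case split on the order of the
  ends.\<close>

definition noncrossing :: "nat \<Rightarrow> nat \<Rightarrow> (point \<Rightarrow> point) \<Rightarrow> bool" where
  "noncrossing m n p \<longleftrightarrow> (\<forall>a\<in>boundary m n. \<forall>c\<in>boundary m n. c \<noteq> a \<longrightarrow> c \<noteq> p a \<longrightarrow>
     between (boundary_rank m n a) (boundary_rank m n (p a)) (boundary_rank m n c) =
     between (boundary_rank m n a) (boundary_rank m n (p a)) (boundary_rank m n (p c)))"

lemma partner_diagram_planar_iff:
  assumes p: "involution_on (boundary m n) p"
  shows "partner_diagram m n p \<in> planar_matchings m n \<longleftrightarrow> noncrossing m n p"
proof -
  let ?B = "boundary m n" and ?r = "boundary_rank m n"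
  have pI: "p x \<in> ?B" "p x \<noteq> x" "p (p x) = x" if "x \<in> ?B" for x
    using p that by (auto simp: involution_on_def)
  have valid: "valid m n (partner_diagram m n p)" by (rule valid_partner_diagram[OF p])
  have "irrefl (partner_diagram m n p)" using pI(2) by (fastforce simp: irrefl_def mem_partner_diagram)
  moreover have "\<forall>x\<in>?B. \<exists>!y. (x, y) \<in> partner_diagram m n p"
    by (simp add: mem_partner_diagram)
  moreover have "(\<exists>a b c d. (a, b) \<in> partner_diagram m n p \<and> (c, d) \<in> partner_diagram m n p \<and>
      ?r a < ?r c \<and> ?r c < ?r b \<and> ?r b < ?r d) \<longleftrightarrow>
    (\<exists>a\<in>?B. \<exists>c\<in>?B. ?r a < ?r c \<and> ?r c < ?r (p a) \<and> ?r (p a) < ?r (p c))"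
    unfolding mem_partner_diagram by blast
  ultimately have "partner_diagram m n p \<in> planar_matchings m n \<longleftrightarrow>
      \<not> (\<exists>a\<in>?B. \<exists>c\<in>?B. ?r a < ?r c \<and> ?r c < ?r (p a) \<and> ?r (p a) < ?r (p c))"
    using valid unfolding planar_matchings_def valid_def mem_Collect_eq by argo
  also have "\<dots> \<longleftrightarrow> noncrossing m n p"
  proof (intro iffI notI)
    assume nc: "\<not> (\<exists>a\<in>?B. \<exists>c\<in>?B. ?r a < ?r c \<and> ?r c < ?r (p a) \<and> ?r (p a) < ?r (p c))"
    have "between (?r a) (?r (p a)) (?r (p c))"
      if ac: "a \<in> ?B" "c \<in> ?B" "c \<noteq> a" "c \<noteq> p a" "between (?r a) (?r (p a)) (?r c)" for a c
    proof -
      have "p c \<noteq> a" "p c \<noteq> p a"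
        using ac(3,4) pI(3)[OF ac(1)] pI(3)[OF ac(2)] by auto
      then have "?r (p c) \<noteq> ?r a" "?r (p c) \<noteq> ?r (p a)"
        using boundary_rank_inj[OF pI(1)[OF ac(2)] ac(1)] boundary_rank_inj[OF pI(1)[OF ac(2)] pI(1)[OF ac(1)]]
        by auto
      \<comment> \<open>The forbidden pattern lists the smaller end of an arc first, so
        \<open>a'\<close> is chosen as that end.\<close>
      moreover obtain a' where a': "a' \<in> ?B" "?r a' < ?r c" "?r c < ?r (p a')" "{a', p a'} = {a, p a}"
      proof (cases "?r a < ?r (p a)")
        case True
        then show ?thesis using that[of a] ac by (auto simp: between_def)
      next
        case False
        then show ?thesis using that[of "p a"] ac pI[OF ac(1)] by (auto simp: between_def)
      qed
      moreover have "\<not> ?r (p a') < ?r (p c)" using nc a' ac(2) by blast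
      moreover have "\<not> (?r (p c) < ?r a' \<and> ?r a' < ?r (p (p c)) \<and> ?r (p (p c)) < ?r (p a'))"
        using nc pI(1)[OF ac(2)] a'(1) by blast
      then have "\<not> ?r (p c) < ?r a'"
        using a'(2,3) pI(3)[OF ac(2)] by simp
      ultimately show ?thesis
        unfolding between_def by (auto simp: doubleton_eq_iff)
    qed
    note inside = this
    have "between (?r a) (?r (p a)) (?r c) = between (?r a) (?r (p a)) (?r (p c))"
      if ac: "a \<in> ?B" "c \<in> ?B" "c \<noteq> a" "c \<noteq> p a" for a c
    proof -
      have "p c \<noteq> a" "p c \<noteq> p a"
        using ac(3,4) pI(3)[OF ac(1)] pI(3)[OF ac(2)] by auto
      then show ?thesis
        using inside[OF ac] inside[OF ac(1) pI(1)[OF ac(2)]] pI(3)[OF ac(2)] by auto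
    qed
    then show "noncrossing m n p" unfolding noncrossing_def by blast
  next
    assume nc: "noncrossing m n p" and "\<exists>a\<in>?B. \<exists>c\<in>?B. ?r a < ?r c \<and> ?r c < ?r (p a) \<and> ?r (p a) < ?r (p c)"
    then obtain a c where ac: "a \<in> ?B" "c \<in> ?B" "?r a < ?r c" "?r c < ?r (p a)" "?r (p a) < ?r (p c)" by blast
    then have "between (?r a) (?r (p a)) (?r c) = between (?r a) (?r (p a)) (?r (p c))"
      using nc unfolding noncrossing_def by (metis less_irrefl)
    then show False using ac by (auto simp: between_def)
  qed
  finally show ?thesis .
qed

lemma planar_matchings_partner:
  assumes "D \<in> planar_matchings m n"
  obtains p where "involution_on (boundary m n) p" "D = partner_diagram m n p"
proof -
  have D: "D \<subseteq> boundary m n \<times> boundary m n" "sym D" "irrefl D"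
      "\<And>x. x \<in> boundary m n \<Longrightarrow> \<exists>!y. (x, y) \<in> D"
    using assms by (auto simp: planar_matchings_def)
  define p where "p x = (THE y. (x, y) \<in> D)" for x
  have p: "(x, p x) \<in> D" if "x \<in> boundary m n" for x
    unfolding p_def by (rule theI'[OF D(4)[OF that]])
  have uniq: "y = p x" if "(x, y) \<in> D" for x y
    using D(1,4) p that by blast
  show ?thesis
  proof (rule that[of p])
    show "involution_on (boundary m n) p"
      unfolding involution_on_def
    proof (intro ballI conjI)
      fix x assume x: "x \<in> boundary m n"
      show "p x \<in> boundary m n" using p[OF x] D(1) by blast
      show "p x \<noteq> x" using p[OF x] D(3) by (metis irrefl_def)
      show "p (p x) = x" using uniq[OF symD[OF D(2) p[OF x]]] by simp
    qed
    show "D = partner_diagram m n p"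
      using p uniq D(1) by (auto simp: mem_partner_diagram)
  qed
qed

text \<open>The two top points under the hook have consecutive ranks. Their new arc therefore
  encloses nothing, and no arc ending elsewhere separates them. Such an arc then does not separate
  their old partners either, so it does not cross the arc that now joins these;
  \<open>between_sym\<close> gives the same with the arcs exchanged.\<close>

lemma noncrossing_reconnect:
  assumes p: "involution_on (boundary m n) p" and i: "Suc i < n" and loop: "p (1, i) \<noteq> (1, Suc i)"
    and nc: "noncrossing m n p"
  shows "noncrossing m n (reconnect i p)"
proof -
  let ?B = "boundary m n"
  define r where "r = boundary_rank m n"
  define t t' where "t = (1::nat, i)" and "t' = (1::nat, Suc i)"
  define q where "q = reconnect i p"
  have B: "t \<in> ?B" "t' \<in> ?B" "t \<noteq> t'"
    using i by (auto simp: t_def t'_def mem_boundary)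
  have pI: "p x \<in> ?B" "p x \<noteq> x" "p (p x) = x" if "x \<in> ?B" for x
    using p that by (auto simp: involution_on_def)
  have pt: "p t \<noteq> t'" using loop by (simp add: t_def t'_def)
  have pt': "p t' \<noteq> t" using pt pI(3)[OF B(2)] by auto
  have ends: "p t \<noteq> t" "p t' \<noteq> t'" "p t \<noteq> p t'"
    using pI B by metis+
  have q: "q t = t'" "q t' = t" "q (p t) = p t'" "q (p t') = p t"
     "x \<noteq> t \<Longrightarrow> x \<noteq> t' \<Longrightarrow> x \<noteq> p t \<Longrightarrow> x \<noteq> p t' \<Longrightarrow> q x = p x" for x
    using B pt pt' ends by (auto simp: q_def reconnect_def Let_def t_def t'_def)
  have inj: "r x \<noteq> r y" if "x \<in> ?B" "y \<in> ?B" "x \<noteq> y" for x y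
    using boundary_rank_inj that unfolding r_def by blast
  have adj: "r t = Suc (r t')" using i by (simp add: r_def t_def t'_def boundary_rank_def)
  have nc': "between (r a) (r (p a)) (r c) = between (r a) (r (p a)) (r (p c))"
    if "a \<in> ?B" "c \<in> ?B" "c \<noteq> a" "c \<noteq> p a" for a c
    using nc that unfolding noncrossing_def r_def by blast
  have adjacent: "between u v (r t) = between u v (r t')" if "u \<noteq> r t" "u \<noteq> r t'" "v \<noteq> r t" "v \<noteq> r t'" for u v
    using that unfolding between_def adj by linarith
  have old: "between (r a) (r (p a)) (r (p t)) = between (r a) (r (p a)) (r (p t'))"
    if a: "a \<in> ?B" "a \<notin> {t, t', p t, p t'}" for a
  proof -
    have pa: "p a \<in> ?B" "p a \<notin> {t, t', p t, p t'}" using a pI B by (auto, metis+)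
    have "between (r a) (r (p a)) (r t) = between (r a) (r (p a)) (r t')"
      using a pa B by (intro adjacent inj) auto
    then show ?thesis using nc'[of a t] nc'[of a t'] a pa B by auto
  qed
  have "between (r a) (r (q a)) (r c) = between (r a) (r (q a)) (r (q c))"
    if ac: "a \<in> ?B" "c \<in> ?B" "c \<noteq> a" "c \<noteq> q a" for a c
  proof -
    have outside: "x \<in> {t, t'} \<or> x \<in> {p t, p t'} \<or> x \<notin> {t, t', p t, p t'}" for x by blast
    have no: "\<not> between (r t) (r t') x" "\<not> between (r t') (r t) x" for x
      unfolding between_def adj by linarith+
    have pc: "p x \<in> ?B" "p x \<notin> {t, t', p t, p t'}" if "x \<in> ?B" "x \<notin> {t, t', p t, p t'}" for x
      using that pI B by (auto, metis+)
    have comm: "between u v = between v u" for u v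
      by (auto simp: between_def fun_eq_iff min.commute max.commute)
    have new: "between (r (p t)) (r (p t')) (r c) = between (r (p t)) (r (p t')) (r (p c))"
      if "c \<in> ?B" "c \<notin> {t, t', p t, p t'}" for c
    proof -
      have "r (p t) \<noteq> r c" "r (p t) \<noteq> r (p c)" "r (p t') \<noteq> r c" "r (p t') \<noteq> r (p c)"
        using that pc[OF that] pI B by (intro inj; auto)+
      then show ?thesis using between_sym old[OF that] by blast
    qed
    consider "a \<in> {t, t'}" | "a \<in> {p t, p t'}" "c \<in> {t, t'}" | "a \<in> {p t, p t'}" "c \<notin> {t, t', p t, p t'}"
      | "a \<notin> {t, t', p t, p t'}" "c \<in> {t, t'}" | "a \<notin> {t, t', p t, p t'}" "c \<in> {p t, p t'}"
      | "a \<notin> {t, t', p t, p t'}" "c \<notin> {t, t', p t, p t'}"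
    proof -
      have "\<not> (a \<in> {p t, p t'} \<and> c \<in> {p t, p t'})" using ac q by auto
      then show ?thesis using outside[of a] outside[of c] that by blast
    qed
    then show ?thesis
    proof cases
      case 1
      then show ?thesis using no q by auto
    next
      case 2
      have "between (r (p t)) (r (p t')) (r t) = between (r (p t)) (r (p t')) (r t')"
        using pI B pt pt' ends by (intro adjacent inj) auto
      then show ?thesis using 2 q comm[of "r (p t')" "r (p t)"] by auto
    next
      case 3
      then show ?thesis using new[OF ac(2) 3(2)] q(5)[of c] q comm[of "r (p t')" "r (p t)"] by auto
    next
      case 4
      have "between (r a) (r (p a)) (r t) = between (r a) (r (p a)) (r t')"
        using 4 ac pc[OF ac(1) 4(1)] B by (intro adjacent inj) auto
      then show ?thesis using 4 q q(5)[of a] by auto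
    next
      case 5
      then show ?thesis using old[OF ac(1) 5(1)] q q(5)[of a] by auto
    next
      case 6
      then show ?thesis using nc'[OF ac(1,2)] ac q(5)[of a] q(5)[of c] by auto
    qed
  qed
  then show ?thesis unfolding noncrossing_def q_def r_def by blast
qed

lemma planar_reconnect:
  assumes "involution_on (boundary m n) p" "Suc i < n" "p (1, i) \<noteq> (1, Suc i)"
    and "partner_diagram m n p \<in> planar_matchings m n"
  shows "partner_diagram m n (reconnect i p) \<in> planar_matchings m n"
  by (rule iffD2[OF partner_diagram_planar_iff[OF involution_on_reconnect[OF assms(1-3)]]
        noncrossing_reconnect[OF assms(1-3) iffD1[OF partner_diagram_planar_iff[OF assms(1)] assms(4)]]])

lemma id_diagram_eq: "id_diagram n = partner_diagram n n (\<lambda>(h, j). (1 - h, j))"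
  by (auto simp: id_diagram_def partner_diagram_def boundary_def image_iff)

lemma involution_on_id: "involution_on (boundary n n) (\<lambda>(h, j). (1 - h, j))"
  by (auto simp: involution_on_def boundary_def)

text \<open>The ranks of matched points add up to 2n - 1, so the arcs are nested around the
  middle.\<close>

lemma id_diagram_planar: "id_diagram n \<in> planar_matchings n n"
proof -
  have "between u (n + n - 1 - u) v = between u (n + n - 1 - u) (n + n - 1 - v)"
    if "u < n + n" "v < n + n" for u v
    using that unfolding between_def by linarith
  moreover have "boundary_rank n n x < n + n" if "x \<in> boundary n n" for x
    using that by (auto simp: boundary_def boundary_rank_def)
  moreover have "boundary_rank n n ((\<lambda>(h, j). (1 - h, j)) x) = n + n - 1 - boundary_rank n n x"
    if "x \<in> boundary n n" for x
    using that by (auto simp: boundary_def boundary_rank_def)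
  ultimately have "noncrossing n n (\<lambda>(h, j). (1 - h, j))"
    unfolding noncrossing_def by metis
  then show ?thesis
    unfolding id_diagram_eq partner_diagram_planar_iff[OF involution_on_id] .
qed

text \<open>If some arc joins two top points, then an innermost one joins neighbours. Otherwise the arcs
  form an increasing bijection from the top to the bottom points.\<close>

lemma planar_top_arc:
  assumes D: "D \<in> planar_matchings n n" and "D \<noteq> id_diagram n"
  obtains i where "Suc i < n" "((1, i), (1, Suc i)) \<in> D"
proof -
  obtain p where p: "involution_on (boundary n n) p" and D_eq: "D = partner_diagram n n p"
    using planar_matchings_partner[OF D] .
  let ?B = "boundary n n"
  have pI: "p x \<in> ?B" "p x \<noteq> x" "p (p x) = x" if "x \<in> ?B" for x
    using p that by (auto simp: involution_on_def)
  have "noncrossing n n p" using D p D_eq partner_diagram_planar_iff by blast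
  note nc = this[unfolded noncrossing_def, rule_format]
  have top: "(1, j) \<in> ?B" if "j < n" for j using that by (simp add: mem_boundary)
  show ?thesis
  proof (cases "\<exists>i j. i < j \<and> j < n \<and> p (1, i) = (1, j)")
    case True
    \<comment> \<open>\<open>P d\<close> says that some top arc has width \<open>d\<close>. An arc
      of least width must have width 1, since anything under it is matched under it by a narrower
      arc.\<close>
    define P where "P d \<longleftrightarrow> (\<exists>i. i + d < n \<and> 0 < d \<and> p (1, i) = (1, i + d))" for d
    have "\<exists>d. P d" using True unfolding P_def by (metis less_imp_add_positive)
    then have least: "P (Least P)" "\<And>d. d < Least P \<Longrightarrow> \<not> P d"
      by (metis LeastI, metis not_less_Least)
    define d where "d = Least P"
    obtain i where i: "i + d < n" "0 < d" "p (1, i) = (1, i + d)"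
      using least(1) unfolding P_def d_def by blast
    have "d = 1"
    proof (rule ccontr)
      assume "d \<noteq> 1"
      then have d: "1 < d" using i(2) by simp
      let ?c = "(1::nat, Suc i)"
      have c: "?c \<in> ?B" using i d by (simp add: mem_boundary)
      have pc: "p ?c \<in> ?B" by (rule pI(1)[OF c])
      have "between (boundary_rank n n (1, i)) (boundary_rank n n (1, i + d)) (boundary_rank n n ?c)"
        using i d by (auto simp: between_def boundary_rank_def)
      moreover have "?c \<noteq> (1, i)" "?c \<noteq> p (1, i)" using i d by auto
      ultimately have "between (boundary_rank n n (1, i)) (boundary_rank n n (1, i + d)) (boundary_rank n n (p ?c))"
        using nc[OF top[of i] c] i by simp
      then obtain j where j: "p ?c = (1, j)" "i < j" "j < i + d"
        using pc i by (cases "p ?c") (auto simp: between_def boundary_rank_def boundary_def)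
      have "j \<noteq> Suc i" using j(1) pI(2)[OF c] by auto
      then have "P (j - Suc i)"
        unfolding P_def using j i by (intro exI[of _ "Suc i"]) auto
      moreover have "j - Suc i < d" using j by simp
      ultimately show False using least(2) unfolding d_def by blast
    qed
    then show ?thesis using that[of i] i top[of i] by (auto simp: D_eq mem_partner_diagram)
  next
    case False
    have down: "\<exists>k<n. p (1, j) = (0, k)" if j: "j < n" for j
    proof -
      obtain h k where hk: "p (1, j) = (h, k)" by fastforce
      have B: "(h, k) \<in> ?B" using pI(1)[OF top[OF j]] hk by simp
      have "h \<noteq> 1"
      proof
        assume "h = 1"
        then have "p (1, k) = (1, j)" "k < n" "k \<noteq> j"
          using pI(2,3)[OF top[OF j]] hk B by (auto simp: mem_boundary)
        then show False using False hk \<open>h = 1\<close> j by (metis nat_neq_iff)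
      qed
      then show ?thesis using B hk by (auto simp: mem_boundary)
    qed
    then obtain f where f: "\<And>j. j < n \<Longrightarrow> f j < n \<and> p (1, j) = (0, f j)" by metis
    \<comment> \<open>The rank of the top point j lies between those of \<open>(0, f i)\<close> and
      \<open>(1, i)\<close>; its partner must lie there too, which for a bottom point means to the
      right of \<open>f i\<close>.\<close>
    have mono: "f i < f j" if ij: "i < j" "j < n" for i j
    proof -
      have fi: "f i < n" "p (1, i) = (0, f i)" and fj: "f j < n" "p (1, j) = (0, f j)"
        using f ij by (auto intro: less_trans)
      have "between (boundary_rank n n (1, i)) (boundary_rank n n (0, f i)) (boundary_rank n n (1, j)) =
          between (boundary_rank n n (1, i)) (boundary_rank n n (0, f i)) (boundary_rank n n (0, f j))"
        using nc[OF top[of i] top[of j]] ij fi fj by simp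
      moreover have "f i \<noteq> f j" using fi fj pI(3)[OF top[of i]] pI(3)[OF top[of j]] ij by auto
      ultimately show ?thesis using ij fi fj by (auto simp: between_def boundary_rank_def)
    qed
    have ge: "j \<le> f j" if "j < n" for j
      using that
    proof (induction j)
      case (Suc j)
      then show ?case using mono[of j "Suc j"] by simp
    qed simp
    have le: "f (n - Suc k) \<le> n - Suc k" if "k < n" for k
      using that
    proof (induction k)
      case 0
      then show ?case using f[of "n - 1"] by (cases n) auto
    next
      case (Suc k)
      then have "f (n - Suc k) \<le> n - Suc k" "n - Suc (Suc k) < n - Suc k" by auto
      then show ?case using mono[of "n - Suc (Suc k)" "n - Suc k"] Suc.prems by linarith
    qed
    have id: "f j = j" if "j < n" for j
      using ge[OF that] le[of "n - Suc j"] that by simp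
    have "p x = (case x of (h, j) \<Rightarrow> (1 - h, j))" if "x \<in> ?B" for x
    proof -
      obtain h j where x: "x = (h, j)" by fastforce
      have "j < n" using that by (auto simp: x boundary_def)
      then have "p (1, j) = (0, j)" using f id by simp
      then show ?thesis using pI(3)[OF top[OF \<open>j < n\<close>]] that by (auto simp: x boundary_def)
    qed
    then have "D = id_diagram n"
      unfolding D_eq id_diagram_eq partner_diagram_def by (intro image_cong) auto
    then show ?thesis using assms(2) by blast
  qed
qed


section \<open>Units, cups and caps\<close>

lemma id_diagram_valid: "valid n n (id_diagram n)"
  by (rule planar_matchings_valid[OF id_diagram_planar])

lemma mem_id_diagram: "((a, b), (c, d)) \<in> id_diagram n \<longleftrightarrow> b < n \<and> d = b \<and> a \<le> 1 \<and> c = 1 - a"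
  by (auto simp: id_diagram_def)

lemma stack_id:
  assumes p: "involution_on (boundary m n) p"
  shows "stack (id_diagram n) (partner_diagram m n p) = partner_diagram m n p" (is ?stack)
    and "loop_free (id_diagram n) (partner_diagram m n p)" (is ?loop_free)
proof -
  let ?B = "boundary m n" and ?D = "partner_diagram m n p"
  let ?G = "glue (id_diagram n) ?D"
  have valid: "valid m n ?D" by (rule valid_partner_diagram[OF p])
  have symG: "sym (?G\<^sup>*)"
    using valid id_diagram_valid[of n] by (intro sym_rtrancl sym_glue) (auto simp: valid_def)
  have up: "(x, apfst ((*) 2) x) \<in> ?G\<^sup>*" if "x \<in> ?B" for x
  proof -
    obtain h j where x: "x = (h, j)" by (cases x)
    show ?thesis
    proof (cases "h = 0")
      case False
      then have "((0, j), (1, j)) \<in> id_diagram n" "h = 1"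
        using that by (auto simp: x mem_boundary mem_id_diagram)
      then show ?thesis
        using glue_upper[of 0 j 1 j] by (auto simp: x numeral_2_eq_2)
    qed (simp add: x)
  qed
  define \<psi> where "\<psi> x = (if fst x = 2 then {(1, snd x), p (1, snd x)} else {x, p x})" for x
  have "stack (id_diagram n) ?D = label_diagram m n (\<lambda>x. {x, p x})"
  proof (rule stack_eq_label_diagram[where \<psi> = \<psi>])
    show "?D \<subseteq> ?B \<times> ?B" using valid by (simp add: valid_def)
    show "id_diagram n \<subseteq> boundary n n \<times> boundary n n"
      using id_diagram_valid by (simp add: valid_def)
    show "\<psi> x = \<psi> y" if "(x, y) \<in> ?G" for x y
      using that
    proof (cases rule: glueE)
      case 1
      then have "x \<in> ?B" "y = p x" by (auto simp: mem_partner_diagram)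
      then have "p x \<in> ?B" "p (p x) = x" using p by (auto simp: involution_on_def)
      then show ?thesis using \<open>x \<in> ?B\<close> \<open>y = p x\<close> by (auto simp: \<psi>_def boundary_def)
    next
      case (2 a b c d)
      then show ?thesis by (cases "a = 0") (auto simp: \<psi>_def mem_id_diagram numeral_2_eq_2)
    qed
    show "{x, p x} = \<psi> (apfst ((*) 2) x)" if "x \<in> ?B" for x
      using that by (cases x) (auto simp: \<psi>_def mem_boundary)
    show "(apfst ((*) 2) x, apfst ((*) 2) y) \<in> ?G\<^sup>*"
      if xy: "x \<in> ?B" "y \<in> ?B" "x \<noteq> y" "{x, p x} = {y, p y}" for x y
    proof -
      have y: "y = p x" using xy(3,4) by (auto simp: doubleton_eq_iff)
      have "(apfst ((*) 2) x, x) \<in> ?G\<^sup>*" by (rule symD[OF symG up[OF xy(1)]])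
      also have "(x, y) \<in> ?G\<^sup>*"
        using xy(1) y by (intro r_into_rtrancl glue_lower) (simp add: mem_partner_diagram)
      also have "(y, apfst ((*) 2) y) \<in> ?G\<^sup>*" by (rule up[OF xy(2)])
      finally show ?thesis .
    qed
  qed
  then show ?stack by (simp only: partner_diagram_eq_label_diagram[OF p])
  show ?loop_free
    unfolding loop_free_iff[OF conjunct1[OF valid[unfolded valid_def]]
        conjunct1[OF id_diagram_valid[unfolded valid_def]] disjI1[OF valid]]
  proof
    fix x :: point assume "x \<in> {1} \<times> {..<n}"
    then have "x \<in> ?B" "fst (apfst ((*) 2) x) \<noteq> 1" by (auto simp: mem_boundary)
    then show "\<exists>y. fst y \<noteq> 1 \<and> (x, y) \<in> ?G\<^sup>*" using up by blast
  qed
qed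

text \<open>The top position reached from bottom position j once the points i and i + 1 are capped
  off. The arc itself gets the label \<open>n\<close>, which is not a position among the remaining
  points.\<close>

definition cap_label :: "nat \<Rightarrow> nat \<Rightarrow> nat \<Rightarrow> nat" where
  "cap_label n i j = (if j < i then j else if j \<le> Suc i then n else j - 2)"

definition cap_at :: "nat \<Rightarrow> nat \<Rightarrow> diagram" where
  "cap_at n i = label_diagram n (n - 2) (\<lambda>(h, j). if h = 0 then cap_label n i j else j)"

definition cup_at :: "nat \<Rightarrow> nat \<Rightarrow> diagram" where
  "cup_at n i = label_diagram (n - 2) n (\<lambda>(h, j). if h = 1 then cap_label n i j else j)"

lemma mem_cap_at: "Suc i < n \<Longrightarrow> ((a, b), (c, d)) \<in> cap_at n i \<longleftrightarrow>
    a = 0 \<and> c = 0 \<and> (b = i \<and> d = Suc i \<or> b = Suc i \<and> d = i) \<or>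
    a = 0 \<and> c = 1 \<and> d < n - 2 \<and> b = (if d < i then d else d + 2) \<or>
    a = 1 \<and> c = 0 \<and> b < n - 2 \<and> d = (if b < i then b else b + 2)"
  by (auto simp: cap_at_def cap_label_def label_diagram_def mem_boundary split: if_splits)

lemma mem_cup_at: "Suc i < n \<Longrightarrow> ((a, b), (c, d)) \<in> cup_at n i \<longleftrightarrow>
    a = 1 \<and> c = 1 \<and> (b = i \<and> d = Suc i \<or> b = Suc i \<and> d = i) \<or>
    a = 1 \<and> c = 0 \<and> d < n - 2 \<and> b = (if d < i then d else d + 2) \<or>
    a = 0 \<and> c = 1 \<and> b < n - 2 \<and> d = (if b < i then b else b + 2)"
  by (auto simp: cup_at_def cap_label_def label_diagram_def mem_boundary split: if_splits)

lemma mem_hook: "Suc i < n \<Longrightarrow> ((a, b), (c, d)) \<in> hook n i \<longleftrightarrow>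
    a \<le> 1 \<and> c = a \<and> (b = i \<and> d = Suc i \<or> b = Suc i \<and> d = i) \<or>
    (a = 0 \<and> c = 1 \<or> a = 1 \<and> c = 0) \<and> b < n \<and> d = b \<and> b \<noteq> i \<and> b \<noteq> Suc i"
  by (auto simp: hook_def label_diagram_def mem_boundary split: if_splits)

text \<open>A relabelling that matches the labels of cap and cup, as the computation of their
  composite requires.\<close>

lemma hook_eq_label_diagram:
  "Suc i < n \<Longrightarrow> hook n i = label_diagram n n (\<lambda>(h, j). cap_label n i j + (if i \<le> j \<and> j \<le> Suc i then h else 0))"
  unfolding hook_def label_diagram_def
  by (auto simp: cap_label_def mem_boundary split: if_splits)

lemma valid_cap_at:
  assumes i: "Suc i < n"
  shows "valid n (n - 2) (cap_at n i)"
  unfolding valid_def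
proof (intro conjI)
  show "cap_at n i \<subseteq> boundary n (n - 2) \<times> boundary n (n - 2)" "sym (cap_at n i)"
    by (simp_all add: cap_at_def label_diagram_subset sym_label_diagram)
  show "boundary n (n - 2) \<subseteq> Domain (cap_at n i)"
  proof
    fix x assume x: "x \<in> boundary n (n - 2)"
    obtain h j where hj: "x = (h, j)" by (cases x)
    have "\<exists>y. ((h, j), y) \<in> cap_at n i"
    proof -
      consider "h = 1" "j < n - 2" | "h = 0" "j < i" | "h = 0" "j = i"
        | "h = 0" "j = Suc i" | "h = 0" "Suc i < j" "j < n"
        using x unfolding hj mem_boundary by linarith
      then show ?thesis
      proof cases
        case 1
        then show ?thesis
          using i by (intro exI[of _ "(0, if j < i then j else j + 2)"]) (simp add: mem_cap_at)
      next
        case 2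
        then show ?thesis using i by (intro exI[of _ "(1, j)"]) (simp add: mem_cap_at)
      next
        case 3
        then show ?thesis using i by (intro exI[of _ "(0, Suc i)"]) (simp add: mem_cap_at)
      next
        case 4
        then show ?thesis using i by (intro exI[of _ "(0, i)"]) (simp add: mem_cap_at)
      next
        case 5
        then show ?thesis using i by (intro exI[of _ "(1, j - 2)"]) (auto simp: mem_cap_at)
      qed
    qed
    then show "x \<in> Domain (cap_at n i)" by (auto simp: hj)
  qed
qed

lemma valid_cup_at:
  assumes i: "Suc i < n"
  shows "valid (n - 2) n (cup_at n i)"
  unfolding valid_def
proof (intro conjI)
  show "cup_at n i \<subseteq> boundary (n - 2) n \<times> boundary (n - 2) n" "sym (cup_at n i)"
    by (simp_all add: cup_at_def label_diagram_subset sym_label_diagram)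
  show "boundary (n - 2) n \<subseteq> Domain (cup_at n i)"
  proof
    fix x assume x: "x \<in> boundary (n - 2) n"
    obtain h j where hj: "x = (h, j)" by (cases x)
    have "\<exists>y. ((h, j), y) \<in> cup_at n i"
    proof -
      consider "h = 0" "j < n - 2" | "h = 1" "j < i" | "h = 1" "j = i"
        | "h = 1" "j = Suc i" | "h = 1" "Suc i < j" "j < n"
        using x unfolding hj mem_boundary by linarith
      then show ?thesis
      proof cases
        case 1
        then show ?thesis
          using i by (intro exI[of _ "(1, if j < i then j else j + 2)"]) (simp add: mem_cup_at)
      next
        case 2
        then show ?thesis using i by (intro exI[of _ "(0, j)"]) (simp add: mem_cup_at)
      next
        case 3
        then show ?thesis using i by (intro exI[of _ "(1, Suc i)"]) (simp add: mem_cup_at)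
      next
        case 4
        then show ?thesis using i by (intro exI[of _ "(1, i)"]) (simp add: mem_cup_at)
      next
        case 5
        then show ?thesis using i by (intro exI[of _ "(0, j - 2)"]) (auto simp: mem_cup_at)
      qed
    qed
    then show "x \<in> Domain (cup_at n i)" by (auto simp: hj)
  qed
qed

text \<open>This factorization turns annihilation by a cap into annihilation by the corresponding
  hook.\<close>

lemma stack_cup_cap:
  assumes i: "Suc i < n"
  shows "stack (cup_at n i) (cap_at n i) = hook n i" (is ?stack)
    and "loop_free (cup_at n i) (cap_at n i)" (is ?loop_free)
proof -
  let ?G = "glue (cup_at n i) (cap_at n i)"
  have symG: "sym (?G\<^sup>*)"
    by (intro sym_rtrancl sym_glue) (simp_all add: cap_at_def cup_at_def sym_label_diagram)
  have sub: "cap_at n i \<subseteq> boundary n (n - 2) \<times> boundary n (n - 2)"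
    "cup_at n i \<subseteq> boundary (n - 2) n \<times> boundary (n - 2) n"
    by (simp_all add: cap_at_def cup_at_def label_diagram_subset)
  have bottom: "((0, i), (0, Suc i)) \<in> ?G\<^sup>*"
    using i by (intro r_into_rtrancl glue_lower) (simp add: mem_cap_at)
  have top: "((2, i), (2, Suc i)) \<in> ?G\<^sup>*"
    using i glue_upper[of 1 i 1 "Suc i" "cup_at n i"] by (auto simp: mem_cup_at numeral_2_eq_2)
  have strand: "((0, if k < i then k else k + 2), (1, k)) \<in> ?G\<^sup>*"
      "((1, k), (2, if k < i then k else k + 2)) \<in> ?G\<^sup>*" if "k < n - 2" for k
    using i that glue_lower[of "(0, if k < i then k else k + 2)" "(1, k)" "cap_at n i" "cup_at n i"]
      glue_upper[of 0 k 1 "if k < i then k else k + 2" "cup_at n i" "cap_at n i"]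
    by (auto simp: mem_cup_at mem_cap_at numeral_2_eq_2)
  have through: "((0, j), (2, j)) \<in> ?G\<^sup>*" if j: "j < n" "j \<noteq> i" "j \<noteq> Suc i" for j
  proof -
    obtain k where "k < n - 2" "j = (if k < i then k else k + 2)"
    proof (cases "j < i")
      case True then show ?thesis using that[of j] i by auto
    next
      case False
      then have "j - 2 < n - 2" "\<not> j - 2 < i" "j - 2 + 2 = j" using i j by linarith+
      then show ?thesis using that[of "j - 2"] by presburger
    qed
    then show ?thesis using rtrancl_trans[OF strand[of k]] by simp
  qed
  define \<psi> where "\<psi> = (\<lambda>(h::nat, j). if h = 1 then j
    else cap_label n i j + (if i \<le> j \<and> j \<le> Suc i \<and> h = 2 then 1 else 0))"
  show ?stack
    unfolding hook_eq_label_diagram[OF i]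
  proof (rule stack_eq_label_diagram[OF sub, where \<psi> = \<psi>])
    show "\<psi> x = \<psi> y" if "(x, y) \<in> ?G" for x y
      using that
    proof (cases rule: glueE)
      case 1
      then show ?thesis using i by (cases x; cases y) (auto simp: \<psi>_def mem_cap_at cap_label_def split: if_splits)
    next
      case (2 a b c d)
      then show ?thesis using i by (auto simp: \<psi>_def mem_cup_at cap_label_def split: if_splits)
    qed
    show "(\<lambda>(h, j). cap_label n i j + (if i \<le> j \<and> j \<le> Suc i then h else 0)) x = \<psi> (apfst ((*) 2) x)"
      if "x \<in> boundary n n" for x
      using that by (cases x) (auto simp: \<psi>_def mem_boundary)
    show "(apfst ((*) 2) x, apfst ((*) 2) y) \<in> ?G\<^sup>*"
      if "x \<in> boundary n n" "y \<in> boundary n n" "x \<noteq> y"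
        and "(\<lambda>(h, j). cap_label n i j + (if i \<le> j \<and> j \<le> Suc i then h else 0)) x =
          (\<lambda>(h, j). cap_label n i j + (if i \<le> j \<and> j \<le> Suc i then h else 0)) y" for x y
    proof -
      have "(x, y) \<in> hook n i"
        unfolding hook_eq_label_diagram[OF i] label_diagram_def using that by blast
      then show ?thesis
        using bottom top through symD[OF symG bottom] symD[OF symG top] symD[OF symG through]
        by (cases x; cases y) (auto simp: mem_hook[OF i] le_Suc_eq)
    qed
  qed
  show ?loop_free
    unfolding loop_free_iff[OF sub disjI1[OF valid_cap_at[OF i]]]
  proof
    fix x :: point assume "x \<in> {1} \<times> {..<n - 2}"
    then obtain k where "x = (1, k)" "k < n - 2" by auto
    then show "\<exists>y. fst y \<noteq> 1 \<and> (x, y) \<in> ?G\<^sup>*"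
      using strand(2)[of k] by (intro exI[of _ "(2, if k < i then k else k + 2)"]) simp
  qed
qed

text \<open>The cap at i has to be written as something times the hook at i, so that killing the
  hook kills the cap. The cap at i itself would close a loop of value 0; the neighbouring cap
  straightens instead.\<close>

lemma stack_cap_hook:
  assumes i: "Suc i < n" and k: "Suc k < n" "k = Suc i \<or> i = Suc k"
  shows "stack (cap_at n k) (hook n i) = cap_at n i" (is ?stack)
    and "loop_free (cap_at n k) (hook n i)" (is ?loop_free)
proof -
  let ?G = "glue (cap_at n k) (hook n i)"
  have symG: "sym (?G\<^sup>*)"
    by (intro sym_rtrancl sym_glue sym_hook) (simp add: cap_at_def sym_label_diagram)
  have sub: "cap_at n k \<subseteq> boundary n (n - 2) \<times> boundary n (n - 2)"
    by (simp add: cap_at_def label_diagram_subset)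
  have bottom: "((0, i), (0, Suc i)) \<in> ?G\<^sup>*" and middle: "((1, i), (1, Suc i)) \<in> ?G\<^sup>*"
    using i by (auto intro!: r_into_rtrancl glue_lower simp: mem_hook)
  have cap: "((1, k), (1, Suc k)) \<in> ?G\<^sup>*"
    using k(1) glue_upper[of 0 k 0 "Suc k" "cap_at n k"] by (auto simp: mem_cap_at)
  have vertical: "((0, j), (1, j)) \<in> ?G\<^sup>*" if "j < n" "j \<noteq> i" "j \<noteq> Suc i" for j
    using that i by (auto intro!: r_into_rtrancl glue_lower simp: mem_hook)
  have strand: "((1, if j < k then j else j + 2), (2, j)) \<in> ?G\<^sup>*" if "j < n - 2" for j
    using that k(1) glue_upper[of 0 "if j < k then j else j + 2" 1 j "cap_at n k"]
    by (auto simp: mem_cap_at numeral_2_eq_2)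
  \<comment> \<open>Of all through strands only the one ending at position \<open>min i k\<close>
    meets the upper arc of the hook and the arc of the cap; the others pass the glued level in one
    point.\<close>
  have turn: "((1, if min i k < i then min i k else min i k + 2), (1, if min i k < k then min i k else min i k + 2)) \<in> ?G\<^sup>*"
    using k(2)
  proof
    assume "k = Suc i"
    then show ?thesis using rtrancl_trans[of _ "(1, k)", OF symD[OF symG cap]] symD[OF symG middle] by simp
  next
    assume "i = Suc k"
    then show ?thesis using rtrancl_trans[of _ "(1, i)", OF _ middle] cap by simp
  qed
  have through: "((0, if j < i then j else j + 2), (2, j)) \<in> ?G\<^sup>*" if j: "j < n - 2" for j
  proof -
    have "((0, if j < i then j else j + 2), (1, if j < i then j else j + 2)) \<in> ?G\<^sup>*"
      using j by (intro vertical) auto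
    also have "((1, if j < i then j else j + 2), (1, if j < k then j else j + 2)) \<in> ?G\<^sup>*"
    proof (cases "j = min i k")
      case True
      show ?thesis unfolding True by (rule turn)
    next
      case False
      then have "j < i \<longleftrightarrow> j < k" using k(2) by auto
      then show ?thesis by simp
    qed
    also have "((1, if j < k then j else j + 2), (2, j)) \<in> ?G\<^sup>*" by (rule strand[OF j])
    finally show ?thesis .
  qed
  have through_left: "((0, j), (2, j)) \<in> ?G\<^sup>*" if "j < n - 2" "j < i" for j
    using through[OF that(1)] that(2) by simp
  have through_right: "((0, Suc (Suc j)), (2, j)) \<in> ?G\<^sup>*" if "j < n - 2" "\<not> j < i" for j
    using through[OF that(1)] that(2) by simp
  let ?\<phi> = "\<lambda>(h::nat, j). if h = 0 then cap_label n i j else j"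
  define \<psi> where "\<psi> = (\<lambda>(h::nat, j). if h = 2 then j
    else if h = 1 \<and> i \<le> j \<and> j \<le> Suc i then min i k else cap_label n i j)"
  show ?stack
    unfolding cap_at_def[of n i]
  proof (rule stack_eq_label_diagram[OF hook_subset sub, where \<psi> = \<psi>])
    show "\<psi> x = \<psi> y" if "(x, y) \<in> ?G" for x y
      using that
    proof (cases rule: glueE)
      case 1
      then show ?thesis using i by (cases x; cases y) (auto simp: \<psi>_def mem_hook cap_label_def)
    next
      case (2 a b c d)
      then show ?thesis using i k by (auto simp: \<psi>_def mem_cap_at cap_label_def split: if_splits)
    qed
    show "?\<phi> x = \<psi> (apfst ((*) 2) x)" if "x \<in> boundary n (n - 2)" for x
      using that by (cases x) (auto simp: \<psi>_def mem_boundary)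
    show "(apfst ((*) 2) x, apfst ((*) 2) y) \<in> ?G\<^sup>*"
      if "x \<in> boundary n (n - 2)" "y \<in> boundary n (n - 2)" "x \<noteq> y" "?\<phi> x = ?\<phi> y" for x y
    proof -
      have "(x, y) \<in> cap_at n i"
        unfolding cap_at_def label_diagram_def using that by blast
      then show ?thesis
        using bottom through_left through_right symD[OF symG bottom]
          symD[OF symG through_left] symD[OF symG through_right]
        by (cases x; cases y) (auto simp: mem_cap_at[OF i] split: if_splits)
    qed
  qed
  show ?loop_free
    unfolding loop_free_iff[OF hook_subset sub disjI1[OF valid_hook[OF i]]]
  proof
    fix x :: point assume "x \<in> {1} \<times> {..<n}"
    then obtain j where x: "x = (1, j)" and j: "j < n" by auto
    have down: "\<exists>y. fst y \<noteq> 1 \<and> ((1, j), y) \<in> ?G\<^sup>*" if "j < n" "j \<noteq> i" "j \<noteq> Suc i" for j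
      using symD[OF symG vertical[OF that]] by (intro exI[of _ "(0, j)"]) simp
    have up: "\<exists>y. fst y \<noteq> 1 \<and> ((1, if j < k then j else j + 2), y) \<in> ?G\<^sup>*" if "j < n - 2" for j
      using strand[OF that] by (intro exI[of _ "(2, j)"]) simp
    show "\<exists>y. fst y \<noteq> 1 \<and> (x, y) \<in> ?G\<^sup>*"
    proof (cases "j = i \<or> j = Suc i")
      case False then show ?thesis using down j x by blast
    next
      case True
      then have "(x, (1, i)) \<in> ?G\<^sup>*" "(x, (1, Suc i)) \<in> ?G\<^sup>*"
        using middle symD[OF symG middle] x by auto
      moreover have "(if min i k < k then min i k else min i k + 2) = i \<or>
          (if min i k < k then min i k else min i k + 2) = Suc i"
        using k(2) by auto
      ultimately have "(x, (1, if min i k < k then min i k else min i k + 2)) \<in> ?G\<^sup>*"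
        by auto
      moreover have "min i k < n - 2" using i k by auto
      ultimately show ?thesis using up[of "min i k"] by (meson rtrancl_trans)
    qed
  qed
qed


section \<open>Juxtaposition\<close>

lemma Field_valid: "valid m n D \<Longrightarrow> Field D = boundary m n"
  unfolding valid_def Field_def by (auto simp: sym_def)

lemma shift_right_valid:
  assumes "valid m n D" "h \<le> 1"
  shows "shift_right D (h, j) = (h, j + (if h = 0 then m else n))"
proof -
  have "{i. (h, i) \<in> Field D} = {..<if h = 0 then m else n}"
    using assms by (auto simp: Field_valid mem_boundary)
  then show ?thesis by (simp add: shift_right_def)
qed

lemma mem_juxtapose:
  assumes D1: "valid m n D1" and D2: "D2 \<subseteq> boundary m' n' \<times> boundary m' n'"
  defines "off \<equiv> \<lambda>h. if h = 0 then m else n"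
  shows "((a, b), (c, d)) \<in> juxtapose D1 D2 \<longleftrightarrow> ((a, b), (c, d)) \<in> D1 \<or>
    off a \<le> b \<and> off c \<le> d \<and> ((a, b - off a), (c, d - off c)) \<in> D2"
proof -
  have "((a, b), (c, d)) \<in> map_prod (shift_right D1) (shift_right D1) ` D2 \<longleftrightarrow>
    off a \<le> b \<and> off c \<le> d \<and> ((a, b - off a), (c, d - off c)) \<in> D2"
  proof
    assume "((a, b), (c, d)) \<in> map_prod (shift_right D1) (shift_right D1) ` D2"
    then obtain h j k l where *: "((h, j), (k, l)) \<in> D2"
      "(a, b) = shift_right D1 (h, j)" "(c, d) = shift_right D1 (k, l)" by auto
    then have "h \<le> 1" "k \<le> 1" using D2 by (auto simp: boundary_def)
    with * show "off a \<le> b \<and> off c \<le> d \<and> ((a, b - off a), (c, d - off c)) \<in> D2"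
      by (auto simp: shift_right_valid[OF D1] off_def)
  next
    assume *: "off a \<le> b \<and> off c \<le> d \<and> ((a, b - off a), (c, d - off c)) \<in> D2"
    then have "a \<le> 1" "c \<le> 1" using D2 by (auto simp: boundary_def)
    with * show "((a, b), (c, d)) \<in> map_prod (shift_right D1) (shift_right D1) ` D2"
      by (intro image_eqI[of _ _ "((a, b - off a), (c, d - off c))"])
         (auto simp: shift_right_valid[OF D1] off_def)
  qed
  then show ?thesis by (auto simp: juxtapose_def)
qed

lemma diagram_eqI: "(\<And>a b c d. ((a, b), (c, d)) \<in> D \<longleftrightarrow> ((a, b), (c, d)) \<in> D') \<Longrightarrow> (D :: diagram) = D'"
  by auto

lemma juxtapose_cap:
  "juxtapose (juxtapose (id_diagram i) cap_diagram) (id_diagram j) = cap_at (i + 2 + j) i"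
proof -
  have *: "juxtapose (id_diagram i) cap_diagram = cap_at (i + 2) i"
  proof (rule diagram_eqI)
    fix a b c d
    have "cap_diagram \<subseteq> boundary 2 0 \<times> boundary 2 0" by (auto simp: cap_diagram_def boundary_def)
    from mem_juxtapose[OF id_diagram_valid this]
    show "((a, b), (c, d)) \<in> juxtapose (id_diagram i) cap_diagram \<longleftrightarrow> ((a, b), (c, d)) \<in> cap_at (i + 2) i"
      by (auto simp: mem_id_diagram mem_cap_at cap_diagram_def)
  qed
  have D1: "valid (i + 2) i (cap_at (i + 2) i)" using valid_cap_at[of i "i + 2"] by simp
  have D2: "id_diagram j \<subseteq> boundary j j \<times> boundary j j" using id_diagram_valid by (simp add: valid_def)
  show ?thesis
    unfolding *
  proof (rule diagram_eqI)
    fix a b c d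
    show "((a, b), (c, d)) \<in> juxtapose (cap_at (i + 2) i) (id_diagram j) \<longleftrightarrow>
        ((a, b), (c, d)) \<in> cap_at (i + 2 + j) i"
      unfolding mem_juxtapose[OF D1 D2] by (auto simp: mem_id_diagram mem_cap_at split: if_splits)
  qed
qed

lemma juxtapose_cup:
  "juxtapose (juxtapose (id_diagram i) cup_diagram) (id_diagram j) = cup_at (i + 2 + j) i"
proof -
  have *: "juxtapose (id_diagram i) cup_diagram = cup_at (i + 2) i"
  proof (rule diagram_eqI)
    fix a b c d
    have "cup_diagram \<subseteq> boundary 0 2 \<times> boundary 0 2" by (auto simp: cup_diagram_def boundary_def)
    from mem_juxtapose[OF id_diagram_valid this]
    show "((a, b), (c, d)) \<in> juxtapose (id_diagram i) cup_diagram \<longleftrightarrow> ((a, b), (c, d)) \<in> cup_at (i + 2) i"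
      by (auto simp: mem_id_diagram mem_cup_at cup_diagram_def)
  qed
  have D1: "valid i (i + 2) (cup_at (i + 2) i)" using valid_cup_at[of i "i + 2"] by simp
  have D2: "id_diagram j \<subseteq> boundary j j \<times> boundary j j" using id_diagram_valid by (simp add: valid_def)
  show ?thesis
    unfolding *
  proof (rule diagram_eqI)
    fix a b c d
    show "((a, b), (c, d)) \<in> juxtapose (cup_at (i + 2) i) (id_diagram j) \<longleftrightarrow>
        ((a, b), (c, d)) \<in> cup_at (i + 2 + j) i"
      unfolding mem_juxtapose[OF D1 D2] by (auto simp: mem_id_diagram mem_cup_at split: if_splits)
  qed
qed

lemma cap_diagram_eq: "cap_diagram = cap_at 2 0"
  by (rule diagram_eqI) (auto simp: cap_diagram_def mem_cap_at)

lemma cup_diagram_eq: "cup_diagram = cup_at 2 0"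
  by (rule diagram_eqI) (auto simp: cup_diagram_def mem_cup_at)

lemma juxtapose_id: "juxtapose (id_diagram m) (id_diagram n) = id_diagram (m + n)"
proof (rule diagram_eqI)
  fix a b c d
  have D2: "id_diagram n \<subseteq> boundary n n \<times> boundary n n" using id_diagram_valid by (simp add: valid_def)
  show "((a, b), (c, d)) \<in> juxtapose (id_diagram m) (id_diagram n) \<longleftrightarrow> ((a, b), (c, d)) \<in> id_diagram (m + n)"
    unfolding mem_juxtapose[OF id_diagram_valid D2] by (auto simp: mem_id_diagram)
qed

section \<open>Adding identity strands to a matching\<close>

definition pad_right :: "nat \<Rightarrow> (point \<Rightarrow> point) \<Rightarrow> point \<Rightarrow> point" where
  "pad_right n p = (\<lambda>(h, j). if j < n then p (h, j) else (1 - h, j))"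

definition pad_left :: "nat \<Rightarrow> (point \<Rightarrow> point) \<Rightarrow> point \<Rightarrow> point" where
  "pad_left m p = (\<lambda>(h, j). if j < m then (1 - h, j) else apsnd ((+) m) (p (h, j - m)))"

lemma involution_on_boundaryD:
  assumes "involution_on (boundary n n) p" "h \<le> 1" "j < n"
  obtains k l where "p (h, j) = (k, l)" "k \<le> 1" "l < n" "(k, l) \<noteq> (h, j)" "p (k, l) = (h, j)"
proof -
  obtain k l where kl: "p (h, j) = (k, l)" by fastforce
  have "(h, j) \<in> boundary n n" using assms by (auto simp: mem_boundary)
  then have "p (h, j) \<in> boundary n n" "p (h, j) \<noteq> (h, j)" "p (p (h, j)) = (h, j)"
    using assms(1) unfolding involution_on_def by blast+
  then show ?thesis using that[OF kl] by (auto simp: kl mem_boundary)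
qed

lemma involution_on_pad_right:
  assumes p: "involution_on (boundary n n) p"
  shows "involution_on (boundary (n + m) (n + m)) (pad_right n p)"
  unfolding involution_on_def
proof (intro ballI)
  fix x assume "x \<in> boundary (n + m) (n + m)"
  then obtain h j where x: "x = (h, j)" "h \<le> 1" "j < n + m" by (cases x) (auto simp: mem_boundary)
  show "pad_right n p x \<in> boundary (n + m) (n + m) \<and> pad_right n p x \<noteq> x \<and> pad_right n p (pad_right n p x) = x"
  proof (cases "j < n")
    case True
    obtain k l where "p (h, j) = (k, l)" "k \<le> 1" "l < n" "(k, l) \<noteq> (h, j)" "p (k, l) = (h, j)"
      by (rule involution_on_boundaryD[OF p x(2) True])
    then show ?thesis using True by (auto simp: x pad_right_def mem_boundary)
  next
    case False
    have "1 - h \<noteq> h" by presburger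
    then show ?thesis using False x by (auto simp: pad_right_def mem_boundary)
  qed
qed

lemma involution_on_pad_left:
  assumes p: "involution_on (boundary n n) p"
  shows "involution_on (boundary (m + n) (m + n)) (pad_left m p)"
  unfolding involution_on_def
proof (intro ballI)
  fix x assume "x \<in> boundary (m + n) (m + n)"
  then obtain h j where x: "x = (h, j)" "h \<le> 1" "j < m + n" by (cases x) (auto simp: mem_boundary)
  show "pad_left m p x \<in> boundary (m + n) (m + n) \<and> pad_left m p x \<noteq> x \<and> pad_left m p (pad_left m p x) = x"
  proof (cases "j < m")
    case True
    have "1 - h \<noteq> h" by presburger
    then show ?thesis using True x by (auto simp: pad_left_def mem_boundary)
  next
    case False
    then have "j - m < n" using x by auto
    then obtain k l where "p (h, j - m) = (k, l)" "k \<le> 1" "l < n" "(k, l) \<noteq> (h, j - m)" "p (k, l) = (h, j - m)"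
      by (rule involution_on_boundaryD[OF p x(2)])
    then show ?thesis using False by (auto simp: x pad_left_def mem_boundary)
  qed
qed

lemma mem_partner_diagram_subset:
  "involution_on (boundary m n) p \<Longrightarrow> partner_diagram m n p \<subseteq> boundary m n \<times> boundary m n"
  using valid_partner_diagram by (auto simp: valid_def)

lemma juxtapose_pad_right:
  assumes p: "involution_on (boundary n n) p"
  shows "juxtapose (partner_diagram n n p) (id_diagram m) = partner_diagram (n + m) (n + m) (pad_right n p)"
proof (rule diagram_eqI)
  fix a b c d
  have D2: "id_diagram m \<subseteq> boundary m m \<times> boundary m m" using id_diagram_valid by (simp add: valid_def)
  show "((a, b), (c, d)) \<in> juxtapose (partner_diagram n n p) (id_diagram m) \<longleftrightarrow>
      ((a, b), (c, d)) \<in> partner_diagram (n + m) (n + m) (pad_right n p)"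
    unfolding mem_juxtapose[OF valid_partner_diagram[OF p] D2]
    by (auto simp: mem_partner_diagram mem_id_diagram pad_right_def mem_boundary)
qed

lemma juxtapose_pad_left:
  assumes p: "involution_on (boundary n n) p"
  shows "juxtapose (id_diagram m) (partner_diagram n n p) = partner_diagram (m + n) (m + n) (pad_left m p)"
proof (rule diagram_eqI)
  fix a b c d
  have "((a, b), (c, d)) \<in> juxtapose (id_diagram m) (partner_diagram n n p) \<longleftrightarrow>
      b < m \<and> d = b \<and> a \<le> 1 \<and> c = 1 - a \<or>
      m \<le> b \<and> m \<le> d \<and> (a, b - m) \<in> boundary n n \<and> (c, d - m) = p (a, b - m)"
    unfolding mem_juxtapose[OF id_diagram_valid mem_partner_diagram_subset[OF p]]
    by (auto simp: mem_partner_diagram mem_id_diagram)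
  also have "\<dots> \<longleftrightarrow> ((a, b), (c, d)) \<in> partner_diagram (m + n) (m + n) (pad_left m p)"
  proof (cases "b < m")
    case True
    then show ?thesis by (auto simp: mem_partner_diagram pad_left_def mem_boundary)
  next
    case False
    obtain k l where kl: "p (a, b - m) = (k, l)" by fastforce
    have "(a, b) \<in> boundary (m + n) (m + n) \<longleftrightarrow> (a, b - m) \<in> boundary n n"
      using False by (auto simp: mem_boundary)
    moreover have "m \<le> d \<and> (c, d - m) = (k, l) \<longleftrightarrow> (c, d) = (k, m + l)" by auto
    ultimately show ?thesis using False by (auto simp: mem_partner_diagram pad_left_def kl)
  qed
  finally show "((a, b), (c, d)) \<in> juxtapose (id_diagram m) (partner_diagram n n p) \<longleftrightarrow>
      ((a, b), (c, d)) \<in> partner_diagram (m + n) (m + n) (pad_left m p)" .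
qed

lemma reconnect_pad_right:
  assumes p: "involution_on (boundary n n) p" and i: "Suc i < n"
  shows "reconnect i (pad_right n p) = pad_right n (reconnect i p)"
proof -
  obtain k l where kl: "p (1, i) = (k, l)" "l < n"
    using involution_on_boundaryD[OF p, of 1 i] i by (metis Suc_lessD le_refl)
  obtain k' l' where kl': "p (1, Suc i) = (k', l')" "l' < n"
    using involution_on_boundaryD[OF p, of 1 "Suc i"] i by (metis le_refl)
  show ?thesis
    using i kl kl' by (auto simp: fun_eq_iff reconnect_def Let_def pad_right_def)
qed

lemma reconnect_pad_left:
  "reconnect (m + i) (pad_left m p) = pad_left m (reconnect i p)"
proof -
  obtain k l where kl: "p (1, i) = (k, l)" by fastforce
  obtain k' l' where kl': "p (1, Suc i) = (k', l')" by fastforce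
  show ?thesis
  proof
    fix x :: point
    obtain h j where x: "x = (h, j)" by fastforce
    have start: "pad_left m p (1, m + i) = (k, m + l)" "pad_left m p (1, Suc (m + i)) = (k', m + l')"
      using kl kl' by (simp_all add: pad_left_def)
    show "reconnect (m + i) (pad_left m p) x = pad_left m (reconnect i p) x"
    proof (cases "j < m")
      case True
      then show ?thesis
        by (simp add: x reconnect_def Let_def start kl kl' pad_left_def del: One_nat_def)
    next
      case False
      then obtain j' where "j = m + j'" using le_Suc_ex not_less by blast
      then show ?thesis
        by (auto simp: x reconnect_def Let_def start kl kl' pad_left_def simp del: One_nat_def)
    qed
  qed
qed

lemma pad_right_loop_iff:
  "Suc i < n \<Longrightarrow> pad_right n p (1, i) = (1, Suc i) \<longleftrightarrow> p (1, i) = (1, Suc i)"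
  by (simp add: pad_right_def)

lemma pad_left_loop_iff:
  "pad_left m p (1, m + i) = (1, Suc (m + i)) \<longleftrightarrow> p (1, i) = (1, Suc i)"
  by (cases "p (1, i)") (simp add: pad_left_def)

lemma hook_eq_partner_diagram:
  assumes "Suc i < n"
  shows "hook n i = partner_diagram n n (reconnect i (\<lambda>(h, j). (1 - h, j)))"
  by (rule diagram_eqI)
     (use assms in \<open>auto simp: mem_hook mem_partner_diagram reconnect_def Let_def mem_boundary split: if_splits\<close>)

definition cup_partner :: "nat \<Rightarrow> point \<Rightarrow> point" where
  "cup_partner i = (\<lambda>(h, j). if h = 0 then (1, if j < i then j else j + 2)
     else if j < i then (0, j) else if j = i then (1, Suc i) else if j = Suc i then (1, i) else (0, j - 2))"

lemma cup_at_eq_partner_diagram: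
  "Suc i < n \<Longrightarrow> cup_at n i = partner_diagram (n - 2) n (cup_partner i)"
  by (rule diagram_eqI) (auto simp: mem_cup_at mem_partner_diagram cup_partner_def mem_boundary split: if_splits)

lemma involution_on_cup_partner: "Suc i < n \<Longrightarrow> involution_on (boundary (n - 2) n) (cup_partner i)"
  unfolding involution_on_def
  by (auto simp: boundary_def cup_partner_def split: if_splits)

text \<open>The mirror image of \<open>stack_cap_hook\<close>. Here the hook is on top, so the
  general result on stacking a hook applies, and only the partner function has to be
  computed.\<close>

lemma stack_hook_cup:
  assumes i: "Suc i < n" and k: "Suc k < n" "k = Suc i \<or> i = Suc k"
  shows "stack (hook n i) (cup_at n k) = cup_at n i" and "loop_free (hook n i) (cup_at n k)"
proof -
  have loop: "cup_partner k (1, i) \<noteq> (1, Suc i)"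
    using k(2) by (auto simp: cup_partner_def)
  have "reconnect i (cup_partner k) x = cup_partner i x" if "x \<in> boundary (n - 2) n" for x
    using k(2)
  proof
    assume "k = Suc i"
    then show ?thesis
      using that by (cases x) (simp add: reconnect_def Let_def cup_partner_def mem_boundary, linarith?)
  next
    assume "i = Suc k"
    then show ?thesis
      using that by (cases x) (simp add: reconnect_def Let_def cup_partner_def mem_boundary, linarith?)
  qed
  then have "partner_diagram (n - 2) n (reconnect i (cup_partner k)) = cup_at n i"
    unfolding cup_at_eq_partner_diagram[OF i] partner_diagram_def by (intro image_cong) auto
  then show "stack (hook n i) (cup_at n k) = cup_at n i" "loop_free (hook n i) (cup_at n k)"
    unfolding cup_at_eq_partner_diagram[OF k(1)]
    using stack_hook[OF involution_on_cup_partner[OF k(1)] i loop] by simp_all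
qed


section \<open>The action of the hooks\<close>

text \<open>The type of morphisms contains combinations of arbitrary sets of pairs, whereas a module
  law is required of every vector. Projecting to planar matchings before a hook acts makes the laws
  hold everywhere, since all other diagrams go to 0.\<close>

definition planar_part :: "nat \<Rightarrow> 'k::field tl_mor \<Rightarrow> 'k tl_mor" where
  "planar_part n = extend_linearly (\<lambda>D. if D \<in> planar_matchings n n then Poly_Mapping.single D 1 else 0)"

definition hook_mult :: "'k::field \<Rightarrow> nat \<Rightarrow> nat \<Rightarrow> 'k tl_mor \<Rightarrow> 'k tl_mor" where
  "hook_mult z n i f = tl_comp z (Poly_Mapping.single (hook n i) 1) (planar_part n f)"

lemma tl_linear_hook_mult: "tl_linear (hook_mult z n i)"
  unfolding hook_mult_def[abs_def] planar_part_def
  by (intro tl_linear_compose[OF tl_linear_comp_right tl_linear_extend_linearly])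

lemma planar_part_hom:
  assumes "f \<in> tl_hom n n"
  shows "planar_part n f = f"
proof -
  have "tl_linear (\<lambda>f :: 'a tl_mor. f)" by (simp add: tl_linear_def)
  then have "planar_part n f = (\<lambda>f. f) f"
    using assms unfolding planar_part_def tl_hom_def mem_Collect_eq
    by (rule tl_linear_eqI[OF tl_linear_extend_linearly]) (simp add: extend_linearly_single)
  then show ?thesis .
qed

lemma hook_mult_hom:
  "f \<in> tl_hom n n \<Longrightarrow> hook_mult z n i f = tl_comp z (Poly_Mapping.single (hook n i) 1) f"
  by (simp add: hook_mult_def planar_part_hom)

lemma hook_mult_partner_diagram:
  assumes z: "z + inverse z = 0" and i: "Suc i < n"
    and p: "involution_on (boundary n n) p" "partner_diagram n n p \<in> planar_matchings n n"
  shows "hook_mult z n i (Poly_Mapping.single (partner_diagram n n p) 1) =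
    (if p (1, i) = (1, Suc i) then 0
     else Poly_Mapping.single (partner_diagram n n (reconnect i p)) 1)"
  using stack_hook[OF p(1) i] not_loop_free_hook[OF p(1) i] p(2)
    tl_comp_single_zero_loop[OF z valid_partner_diagram[OF p(1)] valid_hook[OF i]]
  by (simp add: hook_mult_def planar_part_def extend_linearly_single)

lemma hook_mult_nonplanar:
  "D \<notin> planar_matchings n n \<Longrightarrow> hook_mult z n i (Poly_Mapping.single D 1) = 0"
  by (simp add: hook_mult_def planar_part_def extend_linearly_single)

lemma hook_mult_zero [simp]: "hook_mult z n i 0 = 0"
  by (rule tl_linear_zero[OF tl_linear_hook_mult])

lemma tl_linear_eqI_planar:
  assumes "tl_linear F" "tl_linear G"
    and "\<And>D. D \<notin> planar_matchings n n \<Longrightarrow> F (Poly_Mapping.single D 1) = G (Poly_Mapping.single D 1)"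
    and "\<And>p. involution_on (boundary n n) p \<Longrightarrow> partner_diagram n n p \<in> planar_matchings n n \<Longrightarrow>
      F (Poly_Mapping.single (partner_diagram n n p) 1) = G (Poly_Mapping.single (partner_diagram n n p) 1)"
  shows "F f = G f"
proof (rule tl_linear_eqI[OF assms(1,2), of _ UNIV])
  fix D
  show "F (Poly_Mapping.single D 1) = G (Poly_Mapping.single D 1)"
  proof (cases "D \<in> planar_matchings n n")
    case True
    then show ?thesis using assms(4) planar_matchings_partner[OF True] by metis
  next
    case False
    then show ?thesis using assms(3) by blast
  qed
qed simp

text \<open>The pairs at i and k cover three consecutive points: \<open>b\<close> is common to both,
  \<open>a\<close> is the other end of the arc at i, and \<open>c\<close> is the third. The hook at
  k joins \<open>b\<close> with \<open>c\<close> and \<open>a\<close> with the old partner of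
  \<open>c\<close>; the hook at i then restores both original arcs.\<close>

lemma reconnect_zigzag:
  assumes p: "involution_on B p" and B: "(1, i) \<in> B" "(1, Suc i) \<in> B" "(1, k) \<in> B" "(1, Suc k) \<in> B"
    and k: "k = Suc i \<or> i = Suc k" and arc: "p (1, i) = (1, Suc i)"
  shows "p (1, k) \<noteq> (1, Suc k)" "reconnect k p (1, i) \<noteq> (1, Suc i)" "reconnect i (reconnect k p) = p"
proof -
  define t t' where "t = (1::nat, i)" and "t' = (1::nat, Suc i)"
  define c where "c = (if k = Suc i then (1::nat, Suc k) else (1, k))"
  have pt: "p t = t'" "p t' = t"
    using p B(1) arc by (auto simp: involution_on_def t_def t'_def)
  have c: "c \<noteq> t" "c \<noteq> t'" "c \<in> B" using k B by (auto simp: c_def t_def t'_def)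
  have pc: "p (p c) = c" "p c \<noteq> c" "p c \<noteq> t" "p c \<noteq> t'"
    using p c pt unfolding involution_on_def by metis+
  have tt': "t \<noteq> t'" by (simp add: t_def t'_def)
  define a b where "a = (if k = Suc i then t else t')" and "b = (if k = Suc i then t' else t)"
  have ab: "p a = b" "p b = a" "a \<noteq> b" "c \<noteq> a" "c \<noteq> b" "p c \<noteq> a" "p c \<noteq> b"
    using pt c pc tt' by (auto simp: a_def b_def)
  have bc: "(1, k) = b \<and> (1, Suc k) = c \<or> (1, k) = c \<and> (1, Suc k) = b"
    using k by (auto simp: b_def c_def t_def t'_def)
  have rk: "reconnect k p = p(a := p c, p c := a, b := c, c := b)"
    using bc
  proof
    assume "(1, k) = b \<and> (1, Suc k) = c"
    then show ?thesis by (simp add: reconnect_def Let_def ab(2))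
  next
    assume "(1, k) = c \<and> (1, Suc k) = b"
    then have "reconnect k p = p(p c := a, a := p c, c := b, b := c)"
      by (simp add: reconnect_def Let_def ab(2))
    also have "\<dots> = p(a := p c, p c := a, b := c, c := b)"
      unfolding fun_upd_twist[OF ab(6)] fun_upd_twist[OF ab(5)] ..
    finally show ?thesis .
  qed
  show "p (1, k) \<noteq> (1, Suc k)"
    using bc ab by metis
  show "reconnect k p (1, i) \<noteq> (1, Suc i)"
  proof -
    have "reconnect k p a = p c" "reconnect k p b = c"
      unfolding rk fun_upd_apply using ab pc(2) by metis+
    moreover have "a = t \<or> b = t" by (simp add: a_def b_def)
    ultimately have "reconnect k p t \<noteq> t'" using c pc by metis
    then show ?thesis by (simp add: t_def t'_def)
  qed
  have "reconnect i q = q(q a := q b, q b := q a, a := b, b := a)" if "q a \<noteq> q b" for q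
  proof -
    have "reconnect i q = q(q t := q t', q t' := q t, t := t', t' := t)"
      by (simp add: reconnect_def Let_def t_def t'_def)
    moreover have "a = t \<and> b = t' \<or> a = t' \<and> b = t" by (simp add: a_def b_def)
    moreover have "q(q t := q t', q t' := q t, t := t', t' := t) = q(q t' := q t, q t := q t', t' := t, t := t')"
      if "q t \<noteq> q t'"
      unfolding fun_upd_twist[OF that] fun_upd_twist[OF tt'] ..
    ultimately show ?thesis
      using that by auto
  qed
  moreover have rka: "reconnect k p a = p c" "reconnect k p b = c"
    unfolding rk fun_upd_apply using ab pc(2) by metis+
  moreover have "p c \<noteq> c" by (rule pc(2))
  ultimately have eq: "reconnect i (reconnect k p) = (reconnect k p)(p c := c, c := p c, a := b, b := a)"
    by metis
  show "reconnect i (reconnect k p) = p"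
  proof
    fix x
    show "reconnect i (reconnect k p) x = p x"
      unfolding eq unfolding rk
      by (cases "x = a"; cases "x = b"; cases "x = c"; cases "x = p c") (use ab pc(1,2) in simp_all)
  qed
qed

lemma reconnect_same: "reconnect i p (1, i) = (1, Suc i)"
  by (simp add: reconnect_def Let_def)

text \<open>The identity matching suffices: this compares the two products of hooks, and
  associativity carries the result over to all matchings.\<close>

lemma reconnect_comm_id:
  assumes ij: "Suc i < j"
  defines "p \<equiv> \<lambda>(h::nat, k::nat). (1 - h, k)"
  shows "reconnect i (reconnect j p) = reconnect j (reconnect i p)"
    and "reconnect j p (1, i) \<noteq> (1, Suc i)" and "reconnect i p (1, j) \<noteq> (1, Suc j)"
proof -
  have p: "p (1, k) = (0, k)" for k by (simp add: p_def)
  have r: "reconnect k p = p((0, k) := (0, Suc k), (0, Suc k) := (0, k), (1, k) := (1, Suc k), (1, Suc k) := (1, k))" for k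
    by (simp add: reconnect_def Let_def p del: One_nat_def)
  have rk: "reconnect j p (1, i) = (0, i)" "reconnect j p (1, Suc i) = (0, Suc i)"
    "reconnect i p (1, j) = (0, j)" "reconnect i p (1, Suc j) = (0, Suc j)"
    using ij by (simp_all add: r p del: One_nat_def)
  show "reconnect j p (1, i) \<noteq> (1, Suc i)" "reconnect i p (1, j) \<noteq> (1, Suc j)"
    unfolding rk by simp_all
  have "reconnect i (reconnect j p) = (reconnect j p)
      ((0, i) := (0, Suc i), (0, Suc i) := (0, i), (1, i) := (1, Suc i), (1, Suc i) := (1, i))"
    unfolding reconnect_def[of i "reconnect j p"] Let_def rk ..
  moreover have "reconnect j (reconnect i p) = (reconnect i p)
      ((0, j) := (0, Suc j), (0, Suc j) := (0, j), (1, j) := (1, Suc j), (1, Suc j) := (1, j))"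
    unfolding reconnect_def[of j "reconnect i p"] Let_def rk ..
  ultimately show "reconnect i (reconnect j p) = reconnect j (reconnect i p)"
    unfolding r using ij by (auto simp: fun_eq_iff)
qed

section \<open>The hooks satisfy the Temperley--Lieb relations\<close>

lemma hook_mult_in_hom:
  assumes z: "z + inverse z = 0" and i: "Suc i < n"
  shows "hook_mult z n i f \<in> tl_hom n n"
proof -
  let ?b = "\<lambda>D. hook_mult z n i (Poly_Mapping.single D 1)"
  have "?b D \<in> tl_hom n n" for D
  proof (cases "D \<in> planar_matchings n n")
    case True
    then obtain p where p: "involution_on (boundary n n) p" "D = partner_diagram n n p"
      by (rule planar_matchings_partner)
    then show ?thesis
      using True hook_mult_partner_diagram[OF z i p(1)] planar_reconnect[OF p(1) i]
      by (auto simp: tl_hom_def)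
  next
    case False
    then show ?thesis by (simp add: hook_mult_nonplanar tl_hom_def)
  qed
  then have "Poly_Mapping.keys (tl_scale c (?b D)) \<subseteq> planar_matchings n n" for c D
    using keys_tl_scale_subset by (fastforce simp: tl_hom_def)
  moreover have "hook_mult z n i f = (\<Sum>D\<in>Poly_Mapping.keys f. tl_scale (Poly_Mapping.lookup f D) (?b D))"
    by (subst tl_mor_eq_sum[of f])
       (simp only: tl_linear_sum[OF tl_linear_hook_mult] tl_linear_scale[OF tl_linear_hook_mult])
  ultimately show ?thesis
    unfolding tl_hom_def using keys_sum by fastforce
qed

lemma planar_part_in_hom: "planar_part n f \<in> tl_hom n n"
proof -
  have "Poly_Mapping.keys (tl_scale c (if D \<in> planar_matchings n n then Poly_Mapping.single D 1 else 0))
      \<subseteq> planar_matchings n n" for c D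
    by (cases "D \<in> planar_matchings n n") (auto dest!: subsetD[OF keys_tl_scale_subset])
  then show ?thesis
    unfolding tl_hom_def planar_part_def extend_linearly_def using keys_sum by fastforce
qed

lemma tl_comp_hook_hook:
  assumes z: "z + inverse z = 0" and "Suc i < j" "Suc j < n"
  shows "tl_comp z (Poly_Mapping.single (hook n j) 1) (Poly_Mapping.single (hook n i) 1) =
    tl_comp z (Poly_Mapping.single (hook n i) 1) (Poly_Mapping.single (hook n j) 1)"
proof -
  let ?p = "\<lambda>(h::nat, k::nat). (1 - h, k)"
  have i: "Suc i < n" using assms by simp
  have loop: "?p (1, k) \<noteq> (1, Suc k)" for k by simp
  have inv: "involution_on (boundary n n) (reconnect k ?p)" if "Suc k < n" for k
    using involution_on_reconnect[OF involution_on_id that loop] .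
  show ?thesis
    unfolding tl_comp_single_zero_loop[OF z valid_hook[OF i] valid_hook[OF assms(3)]]
      tl_comp_single_zero_loop[OF z valid_hook[OF assms(3)] valid_hook[OF i]]
    unfolding hook_eq_partner_diagram[OF i] hook_eq_partner_diagram[OF assms(3)]
    using stack_hook[OF inv[OF i] assms(3) reconnect_comm_id(3)[OF assms(2)]]
      stack_hook[OF inv[OF assms(3)] i reconnect_comm_id(2)[OF assms(2)]]
      reconnect_comm_id(1)[OF assms(2)]
    by (simp add: hook_eq_partner_diagram[OF i] hook_eq_partner_diagram[OF assms(3)])
qed

lemma tl_valid_hook: "Suc i < n \<Longrightarrow> tl_valid n n (Poly_Mapping.single (hook n i) 1)"
  by (intro tl_valid_single valid_hook)

text \<open>A hook leaves an arc at its own position. A second hook there closes a loop, which gives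
  the square, and a neighbouring hook followed by the same one restores the matching by
  \<open>reconnect_zigzag\<close>. Distant hooks commute as diagrams, and associativity of
  composition does the rest.\<close>

lemma tl_module_hook_mult:
  fixes z :: "'k::field"
  assumes z: "z + inverse z = 0"
  shows "tl_module tl_scale (hook_mult z n) n"
proof (unfold_locales; (intro tl_linear_add[OF tl_linear_hook_mult] tl_linear_scale[OF tl_linear_hook_mult])?)
  note lin = tl_linear_hook_mult
  note lin2 = tl_linear_compose[OF lin lin]
  note lin3 = tl_linear_compose[OF lin lin2]
  have top: "(1, k) \<in> boundary n n" if "k < n" for k using that by (simp add: mem_boundary)
  fix i j :: nat and f :: "'k tl_mor"
  show "hook_mult z n i (hook_mult z n i f) = 0" if i: "Suc i < n"
  proof -
    have "hook_mult z n i (hook_mult z n i f) = (\<lambda>f. 0) f"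
    proof (rule tl_linear_eqI_planar[OF lin2])
      fix p assume p: "involution_on (boundary n n) p" "partner_diagram n n p \<in> planar_matchings n n"
      show "hook_mult z n i (hook_mult z n i (Poly_Mapping.single (partner_diagram n n p) 1)) = 0"
      proof (cases "p (1, i) = (1, Suc i)")
        case False
        then show ?thesis
          using hook_mult_partner_diagram[OF z i p]
            hook_mult_partner_diagram[OF z i involution_on_reconnect[OF p(1) i False] planar_reconnect[OF p(1) i False p(2)]]
          by (simp add: reconnect_same del: One_nat_def)
      qed (simp add: hook_mult_partner_diagram[OF z i p])
    qed (simp_all add: hook_mult_nonplanar tl_linear_def)
    then show ?thesis .
  qed
  have zigzag: "hook_mult z n i (hook_mult z n k (hook_mult z n i f)) = hook_mult z n i f"
    if i: "Suc i < n" and k: "Suc k < n" "k = Suc i \<or> i = Suc k" for i k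
  proof (rule tl_linear_eqI_planar[OF lin3 lin])
    fix p assume p: "involution_on (boundary n n) p" "partner_diagram n n p \<in> planar_matchings n n"
    show "hook_mult z n i (hook_mult z n k (hook_mult z n i (Poly_Mapping.single (partner_diagram n n p) 1))) =
        hook_mult z n i (Poly_Mapping.single (partner_diagram n n p) 1)"
    proof (cases "p (1, i) = (1, Suc i)")
      case False
      let ?q = "reconnect i p"
      have q: "involution_on (boundary n n) ?q" "partner_diagram n n ?q \<in> planar_matchings n n"
        using involution_on_reconnect[OF p(1) i False] planar_reconnect[OF p(1) i False p(2)] .
      note zz = reconnect_zigzag[OF q(1) top top top top k(2) reconnect_same]
      have nk: "?q (1, k) \<noteq> (1, Suc k)" "reconnect k ?q (1, i) \<noteq> (1, Suc i)" "reconnect i (reconnect k ?q) = ?q"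
        using zz i k(1) by auto
      have r: "involution_on (boundary n n) (reconnect k ?q)" "partner_diagram n n (reconnect k ?q) \<in> planar_matchings n n"
        using involution_on_reconnect[OF q(1) k(1) nk(1)] planar_reconnect[OF q(1) k(1) nk(1) q(2)] .
      show ?thesis
        using False nk hook_mult_partner_diagram[OF z i p] hook_mult_partner_diagram[OF z k(1) q]
          hook_mult_partner_diagram[OF z i r] by simp
    qed (simp add: hook_mult_partner_diagram[OF z i p])
  qed (simp_all add: hook_mult_nonplanar)
  show "hook_mult z n i (hook_mult z n (Suc i) (hook_mult z n i f)) = hook_mult z n i f"
    if "Suc (Suc i) < n"
    using zigzag[of i "Suc i"] that by simp
  show "hook_mult z n (Suc i) (hook_mult z n i (hook_mult z n (Suc i) f)) = hook_mult z n (Suc i) f"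
    if "Suc (Suc i) < n"
    using zigzag[of "Suc i" i] that by simp
  show "hook_mult z n j (hook_mult z n i f) = hook_mult z n i (hook_mult z n j f)"
    if ij: "Suc i < j" "Suc j < n"
  proof -
    have i: "Suc i < n" using ij by simp
    note assoc = tl_comp_assoc[OF z tl_hom_valid[OF planar_part_in_hom], symmetric]
    have "hook_mult z n j (hook_mult z n i f) =
        tl_comp z (tl_comp z (Poly_Mapping.single (hook n j) 1) (Poly_Mapping.single (hook n i) 1)) (planar_part n f)"
      unfolding hook_mult_hom[OF hook_mult_in_hom[OF z i], where i = j] unfolding hook_mult_def
      by (rule assoc[symmetric, OF tl_valid_hook[OF i] tl_valid_hook[OF ij(2)]])
    also have "\<dots> = tl_comp z (tl_comp z (Poly_Mapping.single (hook n i) 1) (Poly_Mapping.single (hook n j) 1)) (planar_part n f)"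
      by (simp only: tl_comp_hook_hook[OF z ij])
    also have "\<dots> = hook_mult z n i (hook_mult z n j f)"
      unfolding hook_mult_hom[OF hook_mult_in_hom[OF z ij(2)], where i = i] unfolding hook_mult_def
      by (rule assoc[OF tl_valid_hook[OF ij(2)] tl_valid_hook[OF i]])
    finally show ?thesis .
  qed
qed


section \<open>Morphisms generated by the hooks\<close>

lemma tl_hom_add: "f \<in> tl_hom m n \<Longrightarrow> g \<in> tl_hom m n \<Longrightarrow> f + g \<in> tl_hom m n"
  unfolding tl_hom_def using keys_add[of f g] by blast

lemma tl_hom_scale: "f \<in> tl_hom m n \<Longrightarrow> tl_scale c f \<in> tl_hom m n"
  unfolding tl_hom_def using keys_tl_scale_subset[of c f] by blast

lemma tl_hom_single: "D \<in> planar_matchings m n \<Longrightarrow> Poly_Mapping.single D 1 \<in> tl_hom m n"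
  by (simp add: tl_hom_def)

lemma tl_id_hom: "tl_id n \<in> tl_hom n n"
  unfolding tl_id_def by (rule tl_hom_single[OF id_diagram_planar])

lemma tl_tensor_id: "tl_tensor (tl_id m) (tl_id n) = tl_id (m + n)"
  by (simp add: tl_id_def tl_tensor_single juxtapose_id)

primrec shift_expr :: "nat \<Rightarrow> 'k tl_expr \<Rightarrow> 'k tl_expr" where
  "shift_expr m One = One"
| "shift_expr m (Gen i) = Gen (m + i)"
| "shift_expr m (Add x y) = Add (shift_expr m x) (shift_expr m y)"
| "shift_expr m (Mul x y) = Mul (shift_expr m x) (shift_expr m y)"
| "shift_expr m (Scale c x) = Scale c (shift_expr m x)"

context
  fixes z :: "'k::field"
  assumes z: "z + inverse z = 0"
begin

abbreviation act :: "nat \<Rightarrow> 'k tl_expr \<Rightarrow> 'k tl_mor \<Rightarrow> 'k tl_mor" where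
  "act n \<equiv> tl_eval tl_scale (hook_mult z n)"

abbreviation mor :: "nat \<Rightarrow> 'k tl_expr \<Rightarrow> 'k tl_mor" where
  "mor n x \<equiv> act n x (tl_id n)"

section \<open>Composition of morphisms given by expressions\<close>

lemma tl_id_comp:
  assumes "f \<in> tl_hom n n"
  shows "tl_comp z (tl_id n) f = f"
proof -
  have "tl_linear (\<lambda>f :: 'k tl_mor. f)" by (simp add: tl_linear_def)
  then have "tl_comp z (tl_id n) f = (\<lambda>f. f) f"
    using assms unfolding tl_hom_def mem_Collect_eq
  proof (rule tl_linear_eqI[OF tl_linear_comp_right])
    fix D assume "D \<in> planar_matchings n n"
    then obtain p where "involution_on (boundary n n) p" "D = partner_diagram n n p"
      by (rule planar_matchings_partner)
    then show "tl_comp z (tl_id n) (Poly_Mapping.single D 1) = Poly_Mapping.single D 1"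
      using tl_comp_single_zero_loop[OF z valid_partner_diagram id_diagram_valid] stack_id
      by (simp add: tl_id_def)
  qed
  then show ?thesis .
qed

lemma act_hom:
  assumes "\<And>i. i \<in> gens x \<Longrightarrow> Suc i < n" "f \<in> tl_hom n n"
  shows "act n x f \<in> tl_hom n n"
  using assms
  by (induction x arbitrary: f) (auto intro: tl_hom_add tl_hom_scale hook_mult_in_hom[OF z])

text \<open>Hooks act from the left and \<open>g\<close> from the right, so associativity lets them
  pass each other. The hypothesis on \<open>tl_comp z f g\<close> ensures that
  \<open>hook_mult\<close>, which drops nonplanar diagrams, is a true composition on it.\<close>

lemma act_comp:
  assumes "\<And>i. i \<in> gens x \<Longrightarrow> Suc i < n"
    and "f \<in> tl_hom n n" "g \<in> tl_hom n n" "tl_comp z f g \<in> tl_hom n n"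
  shows "tl_comp z (act n x f) g = act n x (tl_comp z f g)"
  using assms
proof (induction x arbitrary: f)
  case (Gen i)
  then have "Suc i < n" by simp
  then show ?case
    using tl_comp_assoc[OF z tl_hom_valid[OF Gen.prems(3)] tl_hom_valid[OF Gen.prems(2)] tl_valid_hook]
    by (simp add: hook_mult_hom Gen.prems)
next
  case (Mul x y)
  have gens: "\<And>i. i \<in> gens x \<Longrightarrow> Suc i < n" "\<And>i. i \<in> gens y \<Longrightarrow> Suc i < n"
    using Mul.prems(1) by auto
  have y: "tl_comp z (act n y f) g = act n y (tl_comp z f g)"
    by (rule Mul.IH(2)[OF gens(2) Mul.prems(2-4)])
  have "tl_comp z (act n x (act n y f)) g = act n x (tl_comp z (act n y f) g)"
    by (rule Mul.IH(1)[OF gens(1) act_hom[OF gens(2) Mul.prems(2)] Mul.prems(3)])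
       (simp_all add: y act_hom[OF gens(2) Mul.prems(4)])
  then show ?case by (simp add: y)
qed (simp_all add: tl_linear_add[OF tl_linear_comp_left] tl_linear_scale[OF tl_linear_comp_left])

lemma mor_hom: "(\<And>i. i \<in> gens x \<Longrightarrow> Suc i < n) \<Longrightarrow> mor n x \<in> tl_hom n n"
  by (rule act_hom[OF _ tl_id_hom])

lemma mor_comp:
  assumes "\<And>i. i \<in> gens x \<Longrightarrow> Suc i < n" "g \<in> tl_hom n n"
  shows "tl_comp z (mor n x) g = act n x g"
  using act_comp[OF assms(1) tl_id_hom assms(2)] assms(2) by (simp add: tl_id_comp)

lemma mor_comp_mor:
  assumes "\<And>i. i \<in> gens x \<union> gens y \<Longrightarrow> Suc i < n"
  shows "tl_comp z (mor n x) (mor n y) = mor n (Mul x y)"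
  using assms by (subst mor_comp) (auto intro: mor_hom)

lemma mor_Gen: "Suc i < n \<Longrightarrow> mor n (Gen i) = Poly_Mapping.single (hook n i) 1"
  using hook_mult_partner_diagram[OF z _ involution_on_id, of i n] id_diagram_planar[of n]
  by (simp add: tl_id_def id_diagram_eq hook_eq_partner_diagram)

section \<open>Tensoring with identity strands\<close>

lemma tensor_right_hook:
  assumes i: "Suc i < n" and f: "f \<in> tl_hom n n"
  shows "tl_tensor (tl_comp z (Poly_Mapping.single (hook n i) 1) f) (tl_id m) =
    tl_comp z (Poly_Mapping.single (hook (n + m) i) 1) (tl_tensor f (tl_id m))"
proof (rule tl_linear_eqI[OF tl_linear_compose[OF tl_linear_tensor_left tl_linear_comp_right]
      tl_linear_compose[OF tl_linear_comp_right tl_linear_tensor_left]])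
  show "Poly_Mapping.keys f \<subseteq> planar_matchings n n" using f by (simp add: tl_hom_def)
  fix D assume "D \<in> planar_matchings n n"
  then obtain p where p: "involution_on (boundary n n) p" and D: "D = partner_diagram n n p"
    by (rule planar_matchings_partner)
  have i': "Suc i < n + m" using i by simp
  note q = involution_on_pad_right[OF p, of m]
  show "tl_tensor (tl_comp z (Poly_Mapping.single (hook n i) 1) (Poly_Mapping.single D 1)) (tl_id m) =
      tl_comp z (Poly_Mapping.single (hook (n + m) i) 1) (tl_tensor (Poly_Mapping.single D 1) (tl_id m))"
  proof (cases "p (1, i) = (1, Suc i)")
    case True
    then have True': "pad_right n p (1, i) = (1, Suc i)" by (simp only: pad_right_loop_iff[OF i])
    show ?thesis
      using not_loop_free_hook[OF p i True] not_loop_free_hook[OF q i' True']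
      by (simp add: D tl_comp_single_zero_loop[OF z valid_partner_diagram[OF p] valid_hook[OF i]]
          tl_id_def tl_tensor_single juxtapose_pad_right[OF p] tl_linear_zero[OF tl_linear_tensor_left]
          tl_comp_single_zero_loop[OF z valid_partner_diagram[OF q] valid_hook[OF i']])
  next
    case False
    then have False': "pad_right n p (1, i) \<noteq> (1, Suc i)"
      by (simp only: pad_right_loop_iff[OF i] not_False_eq_True)
    show ?thesis
      using stack_hook[OF p i False] stack_hook[OF q i' False']
      by (simp add: D tl_comp_single_zero_loop[OF z valid_partner_diagram[OF p] valid_hook[OF i]]
          tl_id_def tl_tensor_single juxtapose_pad_right[OF p] reconnect_pad_right[OF p i]
          juxtapose_pad_right[OF involution_on_reconnect[OF p i False]]
          tl_comp_single_zero_loop[OF z valid_partner_diagram[OF q] valid_hook[OF i']])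
  qed
qed

lemma tensor_left_hook:
  assumes i: "Suc i < n" and f: "f \<in> tl_hom n n"
  shows "tl_tensor (tl_id m) (tl_comp z (Poly_Mapping.single (hook n i) 1) f) =
    tl_comp z (Poly_Mapping.single (hook (m + n) (m + i)) 1) (tl_tensor (tl_id m) f)"
proof (rule tl_linear_eqI[OF tl_linear_compose[OF tl_linear_tensor_right tl_linear_comp_right]
      tl_linear_compose[OF tl_linear_comp_right tl_linear_tensor_right]])
  show "Poly_Mapping.keys f \<subseteq> planar_matchings n n" using f by (simp add: tl_hom_def)
  fix D assume "D \<in> planar_matchings n n"
  then obtain p where p: "involution_on (boundary n n) p" and D: "D = partner_diagram n n p"
    by (rule planar_matchings_partner)
  have i': "Suc (m + i) < m + n" using i by simp
  note q = involution_on_pad_left[OF p, of m]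
  show "tl_tensor (tl_id m) (tl_comp z (Poly_Mapping.single (hook n i) 1) (Poly_Mapping.single D 1)) =
      tl_comp z (Poly_Mapping.single (hook (m + n) (m + i)) 1) (tl_tensor (tl_id m) (Poly_Mapping.single D 1))"
  proof (cases "p (1, i) = (1, Suc i)")
    case True
    then have True': "pad_left m p (1, m + i) = (1, Suc (m + i))" by (simp only: pad_left_loop_iff)
    show ?thesis
      using not_loop_free_hook[OF p i True] not_loop_free_hook[OF q i' True']
      by (simp add: D tl_comp_single_zero_loop[OF z valid_partner_diagram[OF p] valid_hook[OF i]]
          tl_id_def tl_tensor_single juxtapose_pad_left[OF p] tl_linear_zero[OF tl_linear_tensor_right]
          tl_comp_single_zero_loop[OF z valid_partner_diagram[OF q] valid_hook[OF i']])
  next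
    case False
    then have False': "pad_left m p (1, m + i) \<noteq> (1, Suc (m + i))" by (simp only: pad_left_loop_iff not_False_eq_True)
    show ?thesis
      using stack_hook[OF p i False] stack_hook[OF q i' False']
      by (simp add: D tl_comp_single_zero_loop[OF z valid_partner_diagram[OF p] valid_hook[OF i]]
          tl_id_def tl_tensor_single juxtapose_pad_left[OF p] reconnect_pad_left
          juxtapose_pad_left[OF involution_on_reconnect[OF p i False]]
          tl_comp_single_zero_loop[OF z valid_partner_diagram[OF q] valid_hook[OF i']])
  qed
qed

lemma tensor_right_act:
  assumes "\<And>i. i \<in> gens x \<Longrightarrow> Suc i < n" "f \<in> tl_hom n n" "tl_tensor f (tl_id m) \<in> tl_hom (n + m) (n + m)"
  shows "tl_tensor (act n x f) (tl_id m) = act (n + m) x (tl_tensor f (tl_id m))"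
  using assms
proof (induction x arbitrary: f)
  case (Gen i)
  then show ?case by (simp add: hook_mult_hom tensor_right_hook)
next
  case (Mul x y)
  have gens: "\<And>i. i \<in> gens x \<Longrightarrow> Suc i < n" "\<And>i. i \<in> gens y \<Longrightarrow> Suc i < n"
    using Mul.prems(1) by auto
  have gens': "\<And>i. i \<in> gens y \<Longrightarrow> Suc i < n + m" using gens(2) by fastforce
  have y: "tl_tensor (act n y f) (tl_id m) = act (n + m) y (tl_tensor f (tl_id m))"
    by (rule Mul.IH(2)[OF gens(2) Mul.prems(2,3)])
  have "tl_tensor (act n x (act n y f)) (tl_id m) = act (n + m) x (tl_tensor (act n y f) (tl_id m))"
    by (rule Mul.IH(1)[OF gens(1) act_hom[OF gens(2) Mul.prems(2)]])
       (simp_all add: y act_hom[OF gens' Mul.prems(3)])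
  then show ?case by (simp add: y)
qed (simp_all add: tl_linear_add[OF tl_linear_tensor_left] tl_linear_scale[OF tl_linear_tensor_left])

lemma tensor_left_act:
  assumes "\<And>i. i \<in> gens x \<Longrightarrow> Suc i < n" "f \<in> tl_hom n n" "tl_tensor (tl_id m) f \<in> tl_hom (m + n) (m + n)"
  shows "tl_tensor (tl_id m) (act n x f) = act (m + n) (shift_expr m x) (tl_tensor (tl_id m) f)"
  using assms
proof (induction x arbitrary: f)
  case (Gen i)
  then show ?case by (simp add: hook_mult_hom tensor_left_hook)
next
  case (Mul x y)
  have gens: "\<And>i. i \<in> gens x \<Longrightarrow> Suc i < n" "\<And>i. i \<in> gens y \<Longrightarrow> Suc i < n"
    using Mul.prems(1) by auto
  have "gens (shift_expr m y) = (+) m ` gens y" by (induction y) auto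
  then have gens': "\<And>i. i \<in> gens (shift_expr m y) \<Longrightarrow> Suc i < m + n" using gens(2) by auto
  have y: "tl_tensor (tl_id m) (act n y f) = act (m + n) (shift_expr m y) (tl_tensor (tl_id m) f)"
    by (rule Mul.IH(2)[OF gens(2) Mul.prems(2,3)])
  have "tl_tensor (tl_id m) (act n x (act n y f)) = act (m + n) (shift_expr m x) (tl_tensor (tl_id m) (act n y f))"
    by (rule Mul.IH(1)[OF gens(1) act_hom[OF gens(2) Mul.prems(2)]])
       (simp_all add: y act_hom[OF gens' Mul.prems(3)])
  then show ?case by (simp add: y)
qed (simp_all add: tl_linear_add[OF tl_linear_tensor_right] tl_linear_scale[OF tl_linear_tensor_right])

lemma tensor_right_mor:
  "(\<And>i. i \<in> gens x \<Longrightarrow> Suc i < n) \<Longrightarrow> tl_tensor (mor n x) (tl_id m) = mor (n + m) x"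
  using tensor_right_act[of x n "tl_id n" m] by (simp add: tl_tensor_id tl_id_hom)

lemma tensor_left_mor:
  "(\<And>i. i \<in> gens x \<Longrightarrow> Suc i < n) \<Longrightarrow> tl_tensor (tl_id m) (mor n x) = mor (m + n) (shift_expr m x)"
  using tensor_left_act[of x n "tl_id n" m] by (simp add: tl_tensor_id tl_id_hom)

lemma cup_comp_cap: "Suc i < n \<Longrightarrow>
    tl_comp z (Poly_Mapping.single (cup_at n i) 1) (Poly_Mapping.single (cap_at n i) 1) =
    Poly_Mapping.single (hook n i) 1"
  using tl_comp_single_zero_loop[OF z valid_cap_at valid_cup_at] stack_cup_cap by simp

lemma tl_cup_comp_tl_cap: "tl_comp z tl_cup tl_cap = mor 2 (Gen 0)"
  using cup_comp_cap[of 0 2] mor_Gen[of 0 2] by (simp add: tl_cup_def tl_cap_def cup_diagram_eq cap_diagram_eq)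

lemma tl_linear_act: "tl_linear (act n x)"
  unfolding tl_linear_def
proof -
  interpret tl_module tl_scale "hook_mult z n" n by (rule tl_module_hook_mult[OF z])
  show "(\<forall>f g. act n x (f + g) = act n x f + act n x g) \<and> (\<forall>c f. act n x (tl_scale c f) = tl_scale c (act n x f))"
    by (simp add: ev_add ev_scale)
qed


section \<open>Existence and uniqueness of the Jones--Wenzl idempotents\<close>

context
  fixes a :: nat
  assumes char: "\<And>k. 0 < k \<Longrightarrow> k \<le> a \<Longrightarrow> of_nat k \<noteq> (0::'k)"
begin

lemma jw_kills:
  assumes "2 * a < n" "i < 2 * a"
  shows "hook_mult z n i (act n (jw_expr a) f) = 0" "act n (jw_expr a) (hook_mult z n i f) = 0"
proof -
  interpret tl_module tl_scale "hook_mult z n" n by (rule tl_module_hook_mult[OF z])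
  show "hook_mult z n i (act n (jw_expr a) f) = 0" "act n (jw_expr a) (hook_mult z n i f) = 0"
    using E_kills[OF assms(1) char] assms(2) by (auto simp: E_kills_def)
qed

lemma jw_absorb:
  assumes "\<And>i. i < 2 * a \<Longrightarrow> hook_mult z n i f = 0"
  shows "act n (jw_expr a) f = f"
proof -
  interpret tl_module tl_scale "hook_mult z n" n by (rule tl_module_hook_mult[OF z])
  show ?thesis by (rule E_absorb_left[OF assms])
qed

lemma jw_idem: "2 * a < n \<Longrightarrow> act n (jw_expr a) (act n (jw_expr a) f) = act n (jw_expr a) f"
  by (rule jw_absorb) (rule jw_kills)

lemma gens_jw_lt: "2 * a < n \<Longrightarrow> i \<in> gens (jw_expr a) \<Longrightarrow> Suc i < n"
  using gens_jw_expr[of a] by fastforce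

text \<open>Every diagram produced by a hook has an arc between two top points, and the identity has
  none. This is why the correction terms of the recursion do not change the leading
  coefficient.\<close>

lemma lookup_hook_mult_id: "Suc i < n \<Longrightarrow> Poly_Mapping.lookup (hook_mult z n i f) (id_diagram n) = 0"
proof -
  assume i: "Suc i < n"
  let ?b = "\<lambda>D. hook_mult z n i (Poly_Mapping.single D 1)"
  have "Poly_Mapping.lookup (?b D) (id_diagram n) = 0" for D
  proof (cases "D \<in> planar_matchings n n")
    case True
    then obtain p where p: "involution_on (boundary n n) p" and D: "D = partner_diagram n n p"
      by (rule planar_matchings_partner)
    have "((1, i), (1, Suc i)) \<in> partner_diagram n n (reconnect i p)"
      using i by (simp add: mem_partner_diagram reconnect_same mem_boundary del: One_nat_def)
    then have "partner_diagram n n (reconnect i p) \<noteq> id_diagram n"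
      by (auto simp: mem_id_diagram)
    then show ?thesis
      using True hook_mult_partner_diagram[OF z i p] by (simp add: D lookup_single)
  next
    case False
    then show ?thesis by (simp add: hook_mult_nonplanar)
  qed
  moreover have "hook_mult z n i f = (\<Sum>D\<in>Poly_Mapping.keys f. tl_scale (Poly_Mapping.lookup f D) (?b D))"
    by (subst tl_mor_eq_sum[of f])
       (simp only: tl_linear_sum[OF tl_linear_hook_mult] tl_linear_scale[OF tl_linear_hook_mult])
  ultimately show ?thesis by (simp add: lookup_sum)
qed

lemma lookup_act_jw_id:
  "2 * b < n \<Longrightarrow> Poly_Mapping.lookup (act n (jw_expr b) f) (id_diagram n) = Poly_Mapping.lookup f (id_diagram n)"
  by (induction b arbitrary: f)
     (simp_all add: Let_def lookup_add lookup_minus lookup_uminus lookup_hook_mult_id)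

text \<open>The hook at i sends \<open>D\<close> to 0, so \<open>D\<close> is exhibited as an image
  of that hook by a detour over its neighbour. An idempotent that kills hooks on its right thereby
  kills \<open>D\<close>.\<close>

lemma top_arc_factor:
  assumes "D \<in> planar_matchings n n" "((1, i), (1, Suc i)) \<in> D" "Suc i < n" "Suc k < n" "k = Suc i \<or> i = Suc k"
  shows "hook_mult z n i (hook_mult z n k (Poly_Mapping.single D 1)) = Poly_Mapping.single D 1"
proof -
  obtain p where p: "involution_on (boundary n n) p" and D: "D = partner_diagram n n p"
    using planar_matchings_partner[OF assms(1)] .
  have pD: "partner_diagram n n p \<in> planar_matchings n n" using assms(1) D by simp
  have arc: "p (1, i) = (1, Suc i)" using assms(2) by (simp add: D mem_partner_diagram)
  have top: "(1, j) \<in> boundary n n" if "j < n" for j using that by (simp add: mem_boundary)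
  have zz: "p (1, k) \<noteq> (1, Suc k)" "reconnect k p (1, i) \<noteq> (1, Suc i)" "reconnect i (reconnect k p) = p"
    using reconnect_zigzag[OF p top top top top assms(5) arc] assms(3,4) by auto
  show ?thesis
    using zz hook_mult_partner_diagram[OF z assms(4) p pD]
      hook_mult_partner_diagram[OF z assms(3) involution_on_reconnect[OF p assms(4) zz(1)]
        planar_reconnect[OF p assms(4) zz(1) pD]]
    by (simp add: D)
qed

lemma cap_tensor: "i + 2 + j = n \<Longrightarrow>
    tl_tensor (tl_tensor (tl_id i) tl_cap) (tl_id j) = Poly_Mapping.single (cap_at n i) 1"
  by (auto simp: tl_id_def tl_cap_def tl_tensor_single juxtapose_cap)

lemma cup_tensor: "i + 2 + j = n \<Longrightarrow>
    tl_tensor (tl_tensor (tl_id i) tl_cup) (tl_id j) = Poly_Mapping.single (cup_at n i) 1"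
  by (auto simp: tl_id_def tl_cup_def tl_tensor_single juxtapose_cup)

text \<open>An odd number of strands with room for one hook has at least three strands, hence room
  for an adjacent hook.\<close>

lemma neighbour: "Suc i < 2 * a + 1 \<Longrightarrow> \<exists>k. Suc k < 2 * a + 1 \<and> (k = Suc i \<or> i = Suc k)"
proof (cases "Suc (Suc i) < 2 * a + 1")
  case False
  assume "Suc i < 2 * a + 1"
  with False have "Suc (i - 1) < 2 * a + 1 \<and> i = Suc (i - 1)" by presburger
  then show ?thesis by blast
qed blast

lemma is_jones_wenzl_mor: "is_jones_wenzl z (2 * a + 1) (mor (2 * a + 1) (jw_expr a))"
proof -
  let ?n = "2 * a + 1"
  let ?E = "mor ?n (jw_expr a)"
  have gens: "\<And>i. i \<in> gens (jw_expr a) \<Longrightarrow> Suc i < ?n" by (rule gens_jw_lt) simp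
  have hom: "?E \<in> tl_hom ?n ?n" by (rule mor_hom[OF gens])
  have "tl_comp z (Poly_Mapping.single (cap_at ?n i) 1) ?E = 0 \<and>
      tl_comp z ?E (Poly_Mapping.single (cup_at ?n i) 1) = 0" if i: "Suc i < ?n" for i
  proof
    obtain k where k: "Suc k < ?n" "k = Suc i \<or> i = Suc k" using neighbour[OF i] by blast
    have kill: "hook_mult z ?n i ?E = 0" "act ?n (jw_expr a) (hook_mult z ?n i f) = 0" for f
      using i by (intro jw_kills; simp)+
    have "Poly_Mapping.single (cap_at ?n i) 1 =
        tl_comp z (Poly_Mapping.single (cap_at ?n k) 1) (Poly_Mapping.single (hook ?n i) 1)"
      using tl_comp_single_zero_loop[OF z valid_hook[OF i] valid_cap_at[OF k(1)]] stack_cap_hook[OF i k] by simp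
    then have "tl_comp z (Poly_Mapping.single (cap_at ?n i) 1) ?E =
        tl_comp z (Poly_Mapping.single (cap_at ?n k) 1) (hook_mult z ?n i ?E)"
      using tl_comp_assoc[OF z tl_hom_valid[OF hom] tl_valid_hook[OF i] tl_valid_single[OF valid_cap_at[OF k(1)]]]
      by (simp only: hook_mult_hom[OF hom])
    then show "tl_comp z (Poly_Mapping.single (cap_at ?n i) 1) ?E = 0"
      by (simp only: kill tl_comp_zero)
    have "Poly_Mapping.single (cup_at ?n i) 1 =
        tl_comp z (Poly_Mapping.single (hook ?n i) 1) (Poly_Mapping.single (cup_at ?n k) 1)"
      using tl_comp_single_zero_loop[OF z valid_cup_at[OF k(1)] valid_hook[OF i]] stack_hook_cup[OF i k] by simp
    then have "tl_comp z ?E (Poly_Mapping.single (cup_at ?n i) 1) =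
        tl_comp z (tl_comp z ?E (mor ?n (Gen i))) (Poly_Mapping.single (cup_at ?n k) 1)"
      using tl_comp_assoc[OF z tl_valid_single[OF valid_cup_at[OF k(1)]] tl_valid_hook[OF i] tl_hom_valid[OF hom]]
      by (simp only: mor_Gen[OF i])
    also have "tl_comp z ?E (mor ?n (Gen i)) = act ?n (jw_expr a) (mor ?n (Gen i))"
      using i by (intro mor_comp[OF gens] mor_hom) auto
    also have "\<dots> = 0" by (simp only: tl_eval.simps kill)
    finally show "tl_comp z ?E (Poly_Mapping.single (cup_at ?n i) 1) = 0"
      by (simp only: tl_comp_zero)
  qed
  moreover have "tl_comp z ?E ?E = ?E"
    by (subst mor_comp[OF gens hom]) (auto intro: jw_idem)
  moreover have "Poly_Mapping.lookup ?E (id_diagram ?n) = 1"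
    using lookup_act_jw_id[of a ?n] by (simp add: tl_id_def)
  ultimately show ?thesis
    using hom unfolding is_jones_wenzl_def by (auto simp: cap_tensor cup_tensor)
qed

text \<open>Apply the explicit idempotent to \<open>e\<close>. As caps kill \<open>e\<close>, so do
  hooks, and the result is \<open>e\<close>. Expanding \<open>e\<close> in diagrams instead, only
  the identity survives, because any other planar matching has an arc between neighbouring top
  points; the result is then the coefficient 1 times the explicit idempotent.\<close>

lemma is_jones_wenzl_unique:
  assumes e: "is_jones_wenzl z (2 * a + 1) e"
  shows "e = mor (2 * a + 1) (jw_expr a)"
proof -
  let ?n = "2 * a + 1"
  let ?E = "mor ?n (jw_expr a)"
  have hom: "e \<in> tl_hom ?n ?n" and coeff: "Poly_Mapping.lookup e (id_diagram ?n) = 1"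
    using e by (auto simp: is_jones_wenzl_def)
  have "hook_mult z ?n i e = 0" if "i < 2 * a" for i
  proof -
    have i: "Suc i < ?n" using that by simp
    have "i + 2 + (?n - i - 2) = ?n" using that by simp
    then have cap: "tl_comp z (Poly_Mapping.single (cap_at ?n i) 1) e = 0"
      using e cap_tensor[of i "?n - i - 2" ?n] unfolding is_jones_wenzl_def by metis
    have "hook_mult z ?n i e =
        tl_comp z (Poly_Mapping.single (cup_at ?n i) 1) (tl_comp z (Poly_Mapping.single (cap_at ?n i) 1) e)"
      using tl_comp_assoc[OF z tl_hom_valid[OF hom] tl_valid_single[OF valid_cap_at[OF i]]
          tl_valid_single[OF valid_cup_at[OF i]]]
      by (simp only: hook_mult_hom[OF hom] cup_comp_cap[OF i])
    then show ?thesis by (simp only: cap tl_comp_zero)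
  qed
  then have "act ?n (jw_expr a) e = e" by (rule jw_absorb)
  moreover have "act ?n (jw_expr a) e = (\<lambda>f. tl_scale (Poly_Mapping.lookup f (id_diagram ?n)) ?E) e"
  proof (rule tl_linear_eqI[OF tl_linear_act])
    show "tl_linear (\<lambda>f. tl_scale (Poly_Mapping.lookup f (id_diagram ?n)) ?E)"
      by (simp add: tl_linear_def lookup_add tl.scale_left_distrib)
    show "Poly_Mapping.keys e \<subseteq> planar_matchings ?n ?n" using hom by (simp add: tl_hom_def)
    fix D assume D: "D \<in> planar_matchings ?n ?n"
    show "act ?n (jw_expr a) (Poly_Mapping.single D 1) =
        tl_scale (Poly_Mapping.lookup (Poly_Mapping.single D 1) (id_diagram ?n)) ?E"
    proof (cases "D = id_diagram ?n")
      case True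
      then show ?thesis by (simp add: tl_id_def)
    next
      case False
      then obtain i where i: "Suc i < ?n" "((1, i), (1, Suc i)) \<in> D"
        by (rule planar_top_arc[OF D])
      obtain k where k: "Suc k < ?n" "k = Suc i \<or> i = Suc k" using neighbour[OF i(1)] by blast
      have "act ?n (jw_expr a) (hook_mult z ?n i f) = 0" for f
        using i by (intro jw_kills) auto
      then have "act ?n (jw_expr a) (Poly_Mapping.single D 1) = 0"
        by (metis top_arc_factor[OF D i(2,1) k])
      then show ?thesis using False by (simp add: lookup_single)
    qed
  qed
  ultimately have "e = tl_scale (Poly_Mapping.lookup e (id_diagram ?n)) ?E" by (rule trans[OF sym])
  then show ?thesis by (simp only: coeff tl.scale_one)
qed

lemma jones_wenzl_eq: "jones_wenzl z (2 * a + 1) = mor (2 * a + 1) (jw_expr a)"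
  unfolding jones_wenzl_def using is_jones_wenzl_mor is_jones_wenzl_unique by (rule the_equality)

end

end


section \<open>The twist\<close>

context
  fixes s :: "'k::field"
  assumes s: "s\<^sup>2 + inverse (s\<^sup>2) = 0"
begin

abbreviation "M \<equiv> mor (s\<^sup>2)"

lemma tl_crossing_eq: "tl_crossing s = M 2 (crossing_expr s 0)"
  by (simp add: tl_crossing_def crossing_expr_def tl_cup_comp_tl_cap[OF s])

lemma tl_braid_one_eq: "tl_braid_one s n = M (n + 1) (over_expr s n)"
proof (induction n)
  case (Suc n)
  have shift: "shift_expr n (crossing_expr s 0) = crossing_expr s n" by (simp add: crossing_expr_def)
  have "tl_tensor (tl_id n) (tl_crossing s) = M (n + 2) (crossing_expr s n)"
    using tensor_left_mor[OF s, of "crossing_expr s 0" 2 n]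
    unfolding tl_crossing_eq shift by (simp add: crossing_expr_def)
  moreover have "tl_tensor (tl_braid_one s n) (tl_id 1) = M (n + 2) (over_expr s n)"
    using tensor_right_mor[OF s, of "over_expr s n" "n + 1" 1] gens_over_expr[of s n]
    unfolding Suc by fastforce
  moreover have "tl_comp (s\<^sup>2) (M (n + 2) (crossing_expr s n)) (M (n + 2) (over_expr s n)) =
      M (n + 2) (Mul (crossing_expr s n) (over_expr s n))"
    using gens_over_expr[of s n] by (intro mor_comp_mor[OF s]) (auto simp: crossing_expr_def)
  ultimately show ?case by simp
qed simp

text \<open>The braiding recursion adds its new strand on the left, the recursion of
  \<open>under_expr\<close> adds a crossing at the right end. Both build the same product of
  crossings, here split at its other end.\<close>

lemma act_under_expr_Suc:
  "tl_eval sc T (under_expr s (Suc n)) v =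
    tl_eval sc T (crossing_expr s 0) (tl_eval sc T (shift_expr 1 (under_expr s n)) v)"
proof (induction n arbitrary: v)
  case (Suc n)
  have "shift_expr 1 (crossing_expr s n) = crossing_expr s (Suc n)" by (simp add: crossing_expr_def)
  then show ?case
    using Suc by (simp del: One_nat_def)
qed simp

lemma tl_braid_one_right_eq: "tl_braid s n 1 = M (n + 1) (under_expr s n)"
proof (induction n)
  case (Suc n)
  have gens_shift: "gens (shift_expr 1 x) = Suc ` gens x" for x :: "'k tl_expr" by (induction x) auto
  have "tl_tensor (tl_braid_one s 1) (tl_id n) = M (n + 2) (over_expr s 1)"
  proof -
    have gens: "\<And>i. i \<in> gens (over_expr s 1) \<Longrightarrow> Suc i < 2" using gens_over_expr[of s 1] by auto
    show ?thesis
      using tensor_right_mor[OF s gens, where m = n]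
      by (simp only: tl_braid_one_eq one_add_one add.commute[of n 2])
  qed
  moreover have "tl_tensor (tl_id 1) (tl_braid s n 1) = M (n + 2) (shift_expr 1 (under_expr s n))"
    using tensor_left_mor[OF s, of "under_expr s n" "n + 1" 1] gens_under_expr[of s n]
    unfolding Suc by fastforce
  moreover have "tl_comp (s\<^sup>2) (M (n + 2) (over_expr s 1)) (M (n + 2) (shift_expr 1 (under_expr s n))) =
      M (n + 2) (Mul (over_expr s 1) (shift_expr 1 (under_expr s n)))"
    using gens_under_expr[of s n] gens_over_expr[of s 1]
    by (intro mor_comp_mor[OF s]) (auto simp: gens_shift simp del: One_nat_def over_expr.simps)
  ultimately have "tl_braid s (Suc n) 1 = M (n + 2) (Mul (over_expr s 1) (shift_expr 1 (under_expr s n)))"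
    by simp
  then show ?case by (simp add: act_under_expr_Suc[simplified])
qed simp

lemma tl_braid_one_left_eq: "tl_braid s 1 n = M (n + 1) (over_expr s n)"
proof -
  have gens: "\<And>i. i \<in> gens (over_expr s n) \<Longrightarrow> Suc i < n + 1" using gens_over_expr[of s n] by fastforce
  have "tl_tensor (tl_braid_one s n) (tl_id 0) = M (n + 1) (over_expr s n)"
    using tensor_right_mor[OF s gens, where m = 0] by (simp add: tl_braid_one_eq)
  moreover have "tl_tensor (tl_id 1) (tl_id n) = (tl_id (n + 1) :: 'k tl_mor)"
    by (simp add: tl_tensor_id)
  ultimately show ?thesis
    using mor_comp[OF s gens tl_id_hom] by simp
qed

lemma tl_twist_eq: "tl_twist s n = M n (twist_expr s n)"
proof (induction n)
  case (Suc n)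
  have gens: "\<And>i. i \<in> gens (twist_expr s n) \<Longrightarrow> Suc i < n" using gens_twist_expr[of s n] by fastforce
  have "tl_tensor (tl_twist s n) (tl_scale (inverse s) (tl_id 1)) =
      tl_scale (inverse s) (M (n + 1) (twist_expr s n))"
    using tensor_right_mor[OF s gens, where m = 1] by (simp add: Suc tl_linear_scale[OF tl_linear_tensor_right])
  also have "\<dots> = M (n + 1) (Scale (inverse s) (twist_expr s n))" by simp
  finally have 1: "tl_tensor (tl_twist s n) (tl_scale (inverse s) (tl_id 1)) =
      M (n + 1) (Scale (inverse s) (twist_expr s n))" .
  have 2: "tl_comp (s\<^sup>2) (tl_braid s 1 n) (tl_braid s n 1) = M (n + 1) (Mul (over_expr s n) (under_expr s n))"
    unfolding tl_braid_one_left_eq tl_braid_one_right_eq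
    using gens_over_expr[of s n] gens_under_expr[of s n] by (intro mor_comp_mor[OF s]) fastforce
  have "tl_twist s (Suc n) =
      M (n + 1) (Mul (Scale (inverse s) (twist_expr s n)) (Mul (over_expr s n) (under_expr s n)))"
    unfolding tl_twist.simps 1 2
    using gens_twist_expr[of s n] gens_over_expr[of s n] gens_under_expr[of s n]
    by (intro mor_comp_mor[OF s]) fastforce
  then show ?case by simp
qed simp

end

section \<open>The twist on the image of an idempotent\<close>

lemma mat_comp_mat_of_tl: "mat_comp z [n] (mat_of_tl g) (mat_of_tl f) = mat_of_tl (tl_comp z g f)"
  by (auto simp: mat_comp_def mat_of_tl_def fun_eq_iff)

lemma tilt_twist_T:
  "tilt_twist s (tilt_T (s\<^sup>2) n) =
    mat_of_tl (tl_comp (s\<^sup>2) (tilt_idem (s\<^sup>2) n) (tl_comp (s\<^sup>2) (tl_twist s n) (tilt_idem (s\<^sup>2) n)))"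
proof -
  have "(\<lambda>i j. if i = j \<and> i < length [n] then tl_twist s ([n] ! i) else 0) = mat_of_tl (tl_twist s n)"
    by (auto simp: mat_of_tl_def fun_eq_iff)
  then show ?thesis by (simp add: tilt_twist_def tilt_T_def mat_comp_mat_of_tl)
qed

lemma sqrt_loop_value:
  fixes s :: "'k::field"
  shows "s ^ 4 = - 1 \<Longrightarrow> s\<^sup>2 + inverse (s\<^sup>2) = 0"
  by (simp add: inverse_square_eq_minus)

lemma tilt_T_twist_odd:
  fixes s :: "'k::field"
  assumes s: "s ^ 4 = - 1" and char: "\<And>k. 0 < k \<Longrightarrow> k \<le> b \<Longrightarrow> of_nat k \<noteq> (0::'k)"
  shows "tilt_twist s (tilt_T (s\<^sup>2) (2 * b + 1)) =
    mat_of_tl (tl_scale (s powi (int (2 * b + 1) * (int (2 * b + 1) - 2))) (tilt_idem (s\<^sup>2) (2 * b + 1)))"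
proof -
  let ?z = "s\<^sup>2" and ?n = "2 * b + 1"
  have "s \<noteq> 0" using s by auto
  have z: "?z + inverse ?z = 0" by (rule sqrt_loop_value[OF s])
  let ?c = "s powi (int ?n * (int ?n - 2))" and ?E = "mor ?z ?n (jw_expr b)"
  have idem: "tilt_idem ?z ?n = ?E"
    using jones_wenzl_eq[OF z char] by (simp add: tilt_idem_def)
  interpret tl_module tl_scale "hook_mult ?z ?n" ?n by (rule tl_module_hook_mult[OF z])
  have gens: "\<And>i. i \<in> gens (jw_expr b) \<Longrightarrow> Suc i < ?n" "\<And>i. i \<in> gens (twist_expr s ?n) \<Longrightarrow> Suc i < ?n"
    using gens_jw_expr[of b] gens_twist_expr[of s ?n] by fastforce+
  have hom: "?E \<in> tl_hom ?n ?n" by (rule mor_hom[OF z gens(1)])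
  have "tl_comp ?z (tl_twist s ?n) ?E = ev (twist_expr s ?n) ?E"
    unfolding tl_twist_eq[OF z] by (rule mor_comp[OF z gens(2) hom])
  also have "\<dots> = tl_scale ?c ?E"
    using \<open>s \<noteq> 0\<close> by (intro twist_kill jw_kills(1)[OF z char]) auto
  finally have twist: "tl_comp ?z (tl_twist s ?n) ?E = tl_scale ?c ?E" .
  have "tl_comp ?z ?E (tl_scale ?c ?E) = tl_scale ?c (tl_comp ?z ?E ?E)"
    by (rule tl_linear_scale[OF tl_linear_comp_right])
  also have "tl_comp ?z ?E ?E = ev (jw_expr b) ?E"
    by (rule mor_comp[OF z gens(1) hom])
  also have "\<dots> = ?E"
    by (rule jw_idem[OF z char]) auto
  finally show ?thesis
    by (simp only: tilt_twist_T idem twist)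
qed

lemma tilt_T_twist_even:
  fixes s :: "'k::field"
  assumes s: "s ^ 4 = - 1" and char: "\<And>k. 0 < k \<Longrightarrow> k \<le> b \<Longrightarrow> of_nat k \<noteq> (0::'k)"
  shows "tilt_twist s (tilt_T (s\<^sup>2) (2 * b + 2)) =
    mat_of_tl (tilt_idem (s\<^sup>2) (2 * b + 2) + tl_scale (2 * inverse (s\<^sup>2)) (tilt_loop (s\<^sup>2) (2 * b + 2)))"
proof -
  let ?z = "s\<^sup>2" and ?n = "2 * b + 2"
  have z: "?z + inverse ?z = 0" by (rule sqrt_loop_value[OF s])
  let ?E = "mor ?z ?n (jw_expr b)"
  have gens': "\<And>i. i \<in> gens (jw_expr b) \<Longrightarrow> Suc i < 2 * b + 1" using gens_jw_expr[of b] by fastforce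
  have "tilt_idem ?z ?n = tl_tensor (mor ?z (2 * b + 1) (jw_expr b)) (tl_id 1)"
    using jones_wenzl_eq[OF z char] by (simp add: tilt_idem_def)
  also have "\<dots> = mor ?z (2 * b + 1 + 1) (jw_expr b)"
    by (rule tensor_right_mor[OF z gens'])
  finally have idem: "tilt_idem ?z ?n = ?E" by simp
  interpret tl_module tl_scale "hook_mult ?z ?n" ?n by (rule tl_module_hook_mult[OF z])
  have gens: "\<And>i. i \<in> gens (jw_expr b) \<Longrightarrow> Suc i < ?n" "\<And>i. i \<in> gens (twist_expr s ?n) \<Longrightarrow> Suc i < ?n"
    "\<And>i. i \<in> gens (Gen (2 * b)) \<Longrightarrow> Suc i < ?n"
    using gens_jw_expr[of b] gens_twist_expr[of s ?n] by fastforce+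
  have hom: "?E \<in> tl_hom ?n ?n" by (rule mor_hom[OF z gens(1)])
  have comp: "tl_comp ?z ?E (tl_comp ?z (mor ?z ?n x) ?E) = ev (jw_expr b) (ev x ?E)"
    if x: "\<And>i. i \<in> gens x \<Longrightarrow> Suc i < ?n" for x
  proof -
    have "tl_comp ?z (mor ?z ?n x) ?E = ev x ?E" by (rule mor_comp[OF z x hom])
    moreover have "tl_comp ?z ?E (ev x ?E) = ev (jw_expr b) (ev x ?E)"
      by (rule mor_comp[OF z gens(1) act_hom[OF z x hom]])
    ultimately show ?thesis by simp
  qed
  have "tl_tensor (tl_id (2 * b)) (mor ?z 2 (Gen 0)) = mor ?z (2 * b + 2) (shift_expr (2 * b) (Gen 0))"
    by (rule tensor_left_mor[OF z]) simp
  then have hook: "tl_tensor (tl_id (?n - 2)) (tl_comp ?z tl_cup tl_cap) = mor ?z ?n (Gen (2 * b))"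
    by (simp add: tl_cup_comp_tl_cap[OF z])
  have loop: "tilt_loop ?z ?n = ev (jw_expr b) (ev (Gen (2 * b)) ?E)"
    unfolding tilt_loop_def idem hook
    by (rule comp[OF gens(3)])
  have kills: "E_kills b" by (rule E_kills[OF _ char]) auto
  have "tl_comp ?z ?E (tl_comp ?z (tl_twist s ?n) ?E) = ev (jw_expr b) (ev (twist_expr s ?n) ?E)"
    unfolding tl_twist_eq[OF z] by (rule comp[OF gens(2)])
  also have "\<dots> = ?E + tl_scale (2 * inverse ?z) (ev (jw_expr b) (ev (Gen (2 * b)) ?E))"
    using E_twist_E[OF kills _ s, where v = "tl_id ?n"] by simp
  finally show ?thesis
    by (simp only: tilt_twist_T idem loop)
qed

theorem proposition2p7:
  fixes \<zeta> s :: "'k::alg_closed_field"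
    and p v a\<^sub>1 a\<^sub>0 :: nat
  assumes "CHAR('k) = p" and "p > 2"
    and "\<zeta> ^ 4 = 1" and "\<forall>k. 0 < k \<and> k < 4 \<longrightarrow> \<zeta> ^ k \<noteq> 1"
    and "s\<^sup>2 = \<zeta>"
    and "1 \<le> a\<^sub>1" and "a\<^sub>1 \<le> p - 1" and "a\<^sub>0 \<in> {0, 1}"
    and "v = 2 * a\<^sub>1 + a\<^sub>0"
  shows "(a\<^sub>0 = 0 \<longrightarrow>
      tiltJ_twist s p (v - 1) =
        tiltJ_End \<zeta> p (v - 1)
          (tl_scale (s powi ((int v - 1) * (int v - 3))) (tilt_idem \<zeta> (v - 1))) \<and>
      tiltJ_twist s p (v - 1) =
        tiltJ_End \<zeta> p (v - 1)
          (tl_scale (s powi (4 * (int a\<^sub>1)\<^sup>2 - 8 * int a\<^sub>1 + 3)) (tilt_idem \<zeta> (v - 1))) \<and>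
      tiltJ_twist s p (v - 1) =
        tiltJ_End \<zeta> p (v - 1)
          (tl_scale ((- 1) ^ a\<^sub>1 * s ^ 3) (tilt_idem \<zeta> (v - 1)))) \<and>
    (a\<^sub>0 = 1 \<longrightarrow>
      tiltJ_twist s p (v - 1) =
        tiltJ_End \<zeta> p (v - 1)
          (tilt_idem \<zeta> (v - 1) + tl_scale (2 * inverse \<zeta>) (tilt_loop \<zeta> (v - 1))))"
proof -
  \<comment> \<open>A primitive fourth root of unity squares to -1, so s has fourth power
    -1.\<close>
  have "\<zeta>\<^sup>2 \<noteq> 1" using assms(4) by auto
  moreover have "(\<zeta>\<^sup>2 - 1) * (\<zeta>\<^sup>2 + 1) = 0"
    using \<open>\<zeta> ^ 4 = 1\<close> by (simp add: algebra_simps flip: power_add)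
  ultimately have "\<zeta>\<^sup>2 = - 1" by (simp add: eq_neg_iff_add_eq_0)
  then have s4: "s ^ 4 = - 1"
    using \<open>s\<^sup>2 = \<zeta>\<close> by (metis numeral_Bit0 mult_2 power2_eq_square power_add)
  obtain b where b: "a\<^sub>1 = Suc b" using \<open>1 \<le> a\<^sub>1\<close> by (cases a\<^sub>1) auto
  \<comment> \<open>With b = \<open>a\<^sub>1 - 1\<close> the idempotent on 2b + 1 strands divides
    by 1, ..., b only, and b is less than p.\<close>
  have char: "of_nat k \<noteq> (0::'k)" if "0 < k" "k \<le> b" for k
    using that b assms(1,7) by (auto simp: of_nat_eq_0_iff_char_dvd dest: dvd_imp_le)
  have quotient: "tiltJ_twist s p n = tiltJ_End \<zeta> p n f"
    if "tilt_twist s (tilt_T (s\<^sup>2) n) = mat_of_tl f" for n f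
    using that by (simp add: tiltJ_twist_def tiltJ_End_def \<open>s\<^sup>2 = \<zeta>\<close>)
  show ?thesis
  proof (intro conjI impI)
    assume "a\<^sub>0 = 0"
    then have v: "v - 1 = 2 * b + 1" "int v = 2 * int b + 2" using b assms(9) by auto
    have exponents: "int (2 * b + 1) * (int (2 * b + 1) - 2) = (int v - 1) * (int v - 3)"
        "int (2 * b + 1) * (int (2 * b + 1) - 2) = 4 * (int a\<^sub>1)\<^sup>2 - 8 * int a\<^sub>1 + 3"
      by (simp_all add: v b algebra_simps power2_eq_square)
    have "s powi (int (2 * b + 1) * (int (2 * b + 1) - 2)) = (- 1) ^ b * inverse s"
      by (rule twist_scalar_odd[OF s4])
    also have "\<dots> = (- 1) ^ a\<^sub>1 * s ^ 3"
    proof -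
      \<comment> \<open>The sign in \<open>inverse s = - (s ^ 3)\<close> turns
        \<open>(- 1) ^ b\<close> into \<open>(- 1) ^ a\<^sub>1\<close>.\<close>
      have "inverse s = - (s ^ 3)"
        using s4 by (intro inverse_unique) (simp add: eval_nat_numeral mult.assoc)
      then show ?thesis by (simp add: b)
    qed
    finally have scalar: "s powi (int (2 * b + 1) * (int (2 * b + 1) - 2)) = (- 1) ^ a\<^sub>1 * s ^ 3" .
    note twist = quotient[OF tilt_T_twist_odd[OF s4 char], unfolded \<open>s\<^sup>2 = \<zeta>\<close>]
    show "tiltJ_twist s p (v - 1) = tiltJ_End \<zeta> p (v - 1)
        (tl_scale (s powi ((int v - 1) * (int v - 3))) (tilt_idem \<zeta> (v - 1)))"
      unfolding v(1) exponents(1)[symmetric] by (rule twist)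
    show "tiltJ_twist s p (v - 1) = tiltJ_End \<zeta> p (v - 1)
        (tl_scale (s powi (4 * (int a\<^sub>1)\<^sup>2 - 8 * int a\<^sub>1 + 3)) (tilt_idem \<zeta> (v - 1)))"
      unfolding v(1) exponents(2)[symmetric] by (rule twist)
    show "tiltJ_twist s p (v - 1) = tiltJ_End \<zeta> p (v - 1)
        (tl_scale ((- 1) ^ a\<^sub>1 * s ^ 3) (tilt_idem \<zeta> (v - 1)))"
      unfolding v(1) scalar[symmetric] by (rule twist)
  next
    assume "a\<^sub>0 = 1"
    then have v: "v - 1 = 2 * b + 2" using b assms(9) by auto
    show "tiltJ_twist s p (v - 1) = tiltJ_End \<zeta> p (v - 1)
        (tilt_idem \<zeta> (v - 1) + tl_scale (2 * inverse \<zeta>) (tilt_loop \<zeta> (v - 1)))"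
      unfolding v by (rule quotient[OF tilt_T_twist_even[OF s4 char], unfolded \<open>s\<^sup>2 = \<zeta>\<close>])
  qed
qed

end
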